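(* Let $\Gamma\subset\mathbb{R}^p$ be a closed convex cone with non-empty interior and with $\Gamma\cap(-\Gamma)=\{0\}$, and let $\widehat{\Gamma}$ be its conjugate cone. Let $f(x)$ be an almost periodic function on $\mathbb{R}^p$ that has a holomorphic extension $f(z)$ to $T_{\operatorname{Int}\widehat{\Gamma}}$ with the following estimates: there exists $b<\infty$ such that for every closed cone $\Gamma'\subset\operatorname{Int}\widehat{\Gamma}\cup\{0\}$ there exists $B(\Gamma')<\infty$ with $|f(z)|\le B(\Gamma')e^{b|y|}$ for all $z=x+iy\in T_{\Gamma'}$. Then: 1. if $(\operatorname{sp}f\setminus\{0\})\subset\Gamma$, then $f(z)$ tends to a finite limit as $y\to\infty$, $y\in\Gamma'$, uniformly in $x\in\mathbb{R}^p$, for every closed cone $\Gamma'\subset\operatorname{Int}\widehat{\Gamma}\cup\{0\}$; 2. if $(\operatorname{sp}f\setminus\{0\})\subset\Lambda+\Gamma$ with some $\Lambda\in\bigl(\operatorname{sp}f\cap(-\Gamma)\bigr)\setminus\{0\}$, then $f(z)$ tends to $\infty$ as $y\to\infty$, $y\in\Gamma'$, uniformly in $x\in\mathbb{R}^p$, for every closed cone $\Gamma'\subset\operatorname{Int}\widehat{\Gamma}\cup\{0\}$; 3. if $(\operatorname{sp}f\setminus\{0\})\subset\Lambda+\Gamma$ with some $\Lambda\in\bigl((\overline{\operatorname{sp}f}\setminus\operatorname{sp}f)\cap(-\Gamma)\bigr)\setminus\{0\}$, then $f(z)$ takes every complex value on the set $\operatorname{Int}T_{\widehat{\Gamma}\cap\{|y|>q\}}$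 for each $q<\infty$; 4. if $(\operatorname{sp}f\setminus\{0\})\subset\Lambda+\Gamma$ with some $\Lambda\in\overline{\operatorname{sp}f}\setminus\bigl((-\Gamma)\cup\Gamma\bigr)$, then $f(z)$ takes every complex value, except for at most one, on the set $\operatorname{Int}T_{\widehat{\Gamma}\cap\{|y|>q\}}$ for each $q<\infty$; 5. if $(\operatorname{sp}f\setminus\{0\})\not\subset\Lambda+\Gamma$ for all $\Lambda\in\overline{\operatorname{sp}f}$ and $\operatorname{sp}f\not\subset\Gamma$, then $f(z)$ takes every complex value on the set $\operatorname{Int}T_{\widehat{\Gamma}\cap\{|y|>q\}}$ for each $q<\infty$.
   Context: Notation: $\langle\cdot,\cdot\rangle$ is the scalar product on $\mathbb{R}^p$, $|\cdot|$ the Euclidean norm, $m_p$ Lebesgue measure on $\mathbb{R}^p$, $\operatorname{Int}A$ the interior and $\overline{A}$ the closure of $A$. For $K\subset\mathbb{R}^p$, $T_K=\{z=x+iy\in\mathbb{C}^p: x\in\mathbb{R}^p,\ y\in K\}$. A cone is a set $\Gamma\subset\mathbb{R}^p$ with $y\in\Gamma,\ t>0\Rightarrow ty\in\Gamma$. The conjugate cone is $\widehat{\Gamma}=\{x\in\mathbb{R}^p:\langle x,y\rangle\ge 0\ \forall y\in\Gamma\}$. Almost periodicity: a continuous function $f$ on $\mathbb{R}^p$ is almost periodic if for every $\varepsilon>0$ there is $L=L(\varepsilon)$ such that every $p$-dimensional cube in $\mathbb{R}^p$ of side length $L$ contains at least one $\tau$ with $\sup_{x\in\mathbb{R}^p}|f(x+\tau)-f(x)|<\varepsilon$.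 Holomorphic extension: $f$ is extended to $T_{\operatorname{Int}\widehat{\Gamma}\cup\{0\}}$, holomorphic on $T_{\operatorname{Int}\widehat{\Gamma}}$, equal to the given function on $\mathbb{R}^p$, and continuous on $T_{\Gamma'}$ for every closed cone $\Gamma'\subset\operatorname{Int}\widehat{\Gamma}\cup\{0\}$; the extension is again denoted $f$. Spectrum: $\operatorname{sp}f$ is the set of $\lambda\in\mathbb{R}^p$ for which $\lim_{S\to\infty}(2S)^{-p}\int_{[-S,S]^p}f(x)e^{-i\langle x,\lambda\rangle}\,dm_p(x)\ne 0$. *)

theory Defs
  imports "HOL-Analysis.Analysis"
begin

text \<open>A cone is only required to be closed under multiplication by strictly positive scalars,
  whereas the library's \<^const>\<open>cone\<close> allows the factor 0. The two notions agree for closed sets.\<close>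

definition pos_cone :: "'a::real_vector set \<Rightarrow> bool" where
  "pos_cone \<Gamma> \<longleftrightarrow> (\<forall>y\<in>\<Gamma>. \<forall>t>0. t *\<^sub>R y \<in> \<Gamma>)"

lemma pos_cone_iff_cone:
  fixes \<Gamma> :: "'a::real_normed_vector set"
  assumes "closed \<Gamma>"
  shows "pos_cone \<Gamma> \<longleftrightarrow> cone \<Gamma>"
proof
  assume *: "pos_cone \<Gamma>"
  have "0 \<in> \<Gamma>" if y: "y \<in> \<Gamma>" for y
  proof (rule closed_sequentially[OF assms])
    show "inverse (real (Suc n)) *\<^sub>R y \<in> \<Gamma>" for n
      using * y unfolding pos_cone_def by simp
    show "(\<lambda>n. inverse (real (Suc n)) *\<^sub>R y) \<longlonglongrightarrow> 0"
      using tendsto_scaleR[OF LIMSEQ_inverse_real_of_nat tendsto_const, of y] by simp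
  qed
  with * show "cone \<Gamma>"
    unfolding pos_cone_def cone_def by (metis order_le_less scaleR_zero_left)
qed (auto simp: pos_cone_def cone_def)

definition conjugate_cone :: "'a::real_inner set \<Rightarrow> 'a set" where
  "conjugate_cone \<Gamma> = {x. \<forall>y\<in>\<Gamma>. x \<bullet> y \<ge> 0}"

definition cvec :: "real ^ 'p \<Rightarrow> real ^ 'p \<Rightarrow> complex ^ 'p" where
  "cvec x y = (\<chi> i. Complex (x $ i) (y $ i))"

definition tube :: "(real ^ 'p) set \<Rightarrow> (complex ^ 'p) set" where
  "tube K = {cvec x y |x y. y \<in> K}"

text \<open>Holomorphy in several variables: real Frechet differentiability at every point, with a
  complex-linear derivative. It is meant for open sets \<open>U\<close>.\<close>

definition holomorphic_vec_on :: "(complex ^ 'p \<Rightarrow> complex) \<Rightarrow> (complex ^ 'p) set \<Rightarrow> bool" where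
  "holomorphic_vec_on F U \<longleftrightarrow>
     (\<forall>z\<in>U. \<exists>D. (F has_derivative D) (at z) \<and> (\<forall>c v. D (c *s v) = c * D v))"

definition almost_periodic :: "(real ^ 'p \<Rightarrow> complex) \<Rightarrow> bool" where
  "almost_periodic f \<longleftrightarrow> continuous_on UNIV f \<and>
     (\<forall>\<epsilon>>0. \<exists>L>0. \<forall>a. \<exists>\<tau>\<in>cbox a (\<chi> i. a $ i + L).
        (SUP x. ereal (cmod (f (x + \<tau>) - f x))) < ereal \<epsilon>)"

definition spectrum :: "(real ^ 'p \<Rightarrow> complex) \<Rightarrow> (real ^ 'p) set" where
  "spectrum f = {\<mu>. \<exists>a. a \<noteq> 0 \<and>
     ((\<lambda>S. (LINT x:cbox (\<chi> i. - S) (\<chi> i. S)|lborel. f x * exp (- \<i> * of_real (x \<bullet> \<mu>)))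
            / of_real ((2 * S) ^ CARD('p))) \<longlongrightarrow> a) at_top}"

definition inner_cone :: "(real ^ 'p) set \<Rightarrow> (real ^ 'p) set \<Rightarrow> bool" where
  "inner_cone \<Gamma> \<Gamma>' \<longleftrightarrow>
     closed \<Gamma>' \<and> pos_cone \<Gamma>' \<and> \<Gamma>' \<subseteq> interior (conjugate_cone \<Gamma>) \<union> {0}"

definition holomorphic_extension ::
    "(real ^ 'p) set \<Rightarrow> (real ^ 'p \<Rightarrow> complex) \<Rightarrow> (complex ^ 'p \<Rightarrow> complex) \<Rightarrow> bool" where
  "holomorphic_extension \<Gamma> f F \<longleftrightarrow>
     holomorphic_vec_on F (tube (interior (conjugate_cone \<Gamma>))) \<and>
     (\<forall>x. F (cvec x 0) = f x) \<and>
     (\<forall>\<Gamma>'. inner_cone \<Gamma> \<Gamma>' \<longrightarrow> continuous_on (tube \<Gamma>') F)"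

abbreviation to_infinity_in :: "(real ^ 'p) set \<Rightarrow> (real ^ 'p) filter" where
  "to_infinity_in \<Gamma>' \<equiv> inf at_infinity (principal \<Gamma>')"

definition far_tube :: "(real ^ 'p) set \<Rightarrow> real \<Rightarrow> (complex ^ 'p) set" where
  "far_tube \<Gamma> q = interior (tube (conjugate_cone \<Gamma> \<inter> {y. norm y > q}))"

end

theory Submission
  imports Defs "HOL-Complex_Analysis.Complex_Analysis"
begin

text \<open>Write \<open>e\<^sub>l\<close> for the character with frequency \<open>l\<close>. Two facts about almost periodic functions with a
holomorphic extension to the tube over the interior of the conjugate cone carry the theorem.

The first concerns limits. An almost periodic function is a uniform limit of trigonometric
polynomials whose frequencies lie in its spectrum (\<open>trig_approx\<close>). If the spectrum lies in \<open>\<Gamma>\<close>, these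
polynomials are bounded on the tube, and by the maximum principle they converge there uniformly to
the extension (\<open>trig_approx_tube\<close>); every nonconstant term decays along an inner cone, so the extension tends
to the mean value (\<open>uniform_limit_at_infinity\<close>). This is part 1, and part 2 follows by applying it
to the extension of \<open>f\<close> multiplied by the character with frequency \<open>-\<Lambda>\<close>.

The second concerns zeros: if the extension has no zeros far out in the tube, then the spectrum has
a vertex, that is, it contains a point \<open>c\<close> and lies in \<open>c + \<Gamma>\<close> (\<open>zero_free_spectrum\<close>). Indeed the
function equals the character of frequency \<open>c\<close> times \<open>exp H\<close>, where \<open>H\<close> is almost periodic on every
level by Bohr's theorem on the argument; growth estimates put the spectrum of \<open>H\<close> into
\<open>\<Gamma>\<close>, and since \<open>\<Gamma>\<close> contains no line, the constant term of \<open>exp H\<close> is the exponential of that of \<open>H\<close>,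
hence not zero. Now let the extension omit the value \<open>w\<close> and let \<open>c\<close> be the vertex of
the spectrum of \<open>f - w\<close>. That spectrum differs from the one of \<open>f\<close> at most at 0. In part 3 both \<open>\<Lambda> - c\<close>
and \<open>c - \<Lambda>\<close> lie in \<open>\<Gamma>\<close>, so that \<open>\<Lambda> = c\<close> would be a frequency. In part 4 the same comparison gives
\<open>\<Lambda> = c\<close>, and then 0 is not a frequency of \<open>f - w\<close>; so \<open>w\<close> can only be the mean value of \<open>f\<close>. In part 5 the
existence of \<open>c\<close> contradicts the hypotheses at once. The exponential growth of the extension is harmless:
multiplication by a character with frequency deep inside \<open>\<Gamma>\<close> makes it bounded on rays
(\<open>bounded_tube_extension\<close>) and merely translates the spectrum.

The theory of almost periodic functions is built from the total boundedness of the set of translates.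
Cube averages converge because they are nearly independent of the centre; the mean value is moreover
a limit of finite convex combinations of point values (\<open>mean_uniform_approx\<close>), which replaces
Fubini's theorem for means and shows that means of holomorphic families are holomorphic. The
uniqueness theorem (\<open>fourier_uniqueness\<close>) is proved variationally: the operator
\<open>u \<mapsto> mean\<^sub>t f(x + t) u(t)\<close>, composed with its adjoint, has an eigenfunction; among the eigenfunctions one
whose autocorrelation has maximal mean square has a character as autocorrelation.\<close>

section \<open>Almost periodicity in terms of translates\<close>

text \<open>For fixed \<open>f\<close> this is closeness for the pseudometric
\<open>sup\<^sub>s dist (f (x + s)) (f (y + s))\<close> on the domain, stated without the supremum; \<open>x - y\<close> is then
an almost period of \<open>f\<close>.\<close>

definition close_translates :: "('a::real_normed_vector \<Rightarrow> 'b::metric_space) \<Rightarrow> real \<Rightarrow> 'a \<Rightarrow> 'a \<Rightarrow> bool" where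
  "close_translates f d x y \<longleftrightarrow> (\<forall>s. dist (f (x + s)) (f (y + s)) \<le> d)"

text \<open>Bochner's form of almost periodicity: the translates are totally bounded. Unlike Bohr's relatively
dense almost periods it passes to pairs of functions, hence to sums and products; for
that reason the values may lie in any metric space.\<close>

definition ap :: "('a::real_normed_vector \<Rightarrow> 'b::metric_space) \<Rightarrow> bool" where
  "ap f \<longleftrightarrow> continuous_on UNIV f \<and>
     (\<forall>e>0. \<exists>X. finite X \<and> (\<forall>x. \<exists>y\<in>X. close_translates f e x y))"

definition dominated :: "('a::real_normed_vector \<Rightarrow> 'b::metric_space) \<Rightarrow> ('a \<Rightarrow> 'c::metric_space) \<Rightarrow> bool" where
  "dominated f w \<longleftrightarrow>
     (\<forall>e>0. \<exists>d>0. \<forall>x y. close_translates f d x y \<longrightarrow> dist (w x) (w y) \<le> e)"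

lemma close_translatesD: "close_translates f d x y \<Longrightarrow> dist (f (x + s)) (f (y + s)) \<le> d"
  by (simp add: close_translates_def)

lemma close_translates_sym: "close_translates f d x y \<longleftrightarrow> close_translates f d y x"
  by (simp add: close_translates_def dist_commute)

lemma close_translates_trans:
  "close_translates f d x y \<Longrightarrow> close_translates f e y z \<Longrightarrow> close_translates f (d + e) x z"
  unfolding close_translates_def by (metis add_mono dist_triangle order_trans)

lemma close_translates_mono: "close_translates f d x y \<Longrightarrow> d \<le> e \<Longrightarrow> close_translates f e x y"
  unfolding close_translates_def by (meson order_trans)

lemma close_translates_shift: "close_translates f d x y \<Longrightarrow> close_translates f d (x + t) (y + t)"
  unfolding close_translates_def by (metis add.assoc)

lemma close_translates_dist: "close_translates f d x y \<Longrightarrow> dist (f x) (f y) \<le> d"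
  using close_translatesD[of f d x y 0] by simp

lemma ap_net: "ap f \<Longrightarrow> e > 0 \<Longrightarrow> \<exists>X. finite X \<and> (\<forall>x. \<exists>y\<in>X. close_translates f e x y)"
  by (simp add: ap_def)

lemma ap_continuous: "ap f \<Longrightarrow> continuous_on S f"
  unfolding ap_def using continuous_on_subset by blast

lemma continuous_on_UNIV_if_close:
  fixes f :: "'a::metric_space \<Rightarrow> 'b::metric_space"
  assumes "\<And>e. e > 0 \<Longrightarrow> \<exists>d>0. \<forall>x y. dist x y < d \<longrightarrow> dist (f x) (f y) \<le> e"
  shows "continuous_on UNIV f"
proof (rule uniformly_continuous_imp_continuous, unfold uniformly_continuous_on_def, intro allI impI)
  fix e :: real assume "e > 0"
  then obtain d where "d > 0" "\<And>x y. dist x y < d \<Longrightarrow> dist (f x) (f y) \<le> e/2" using assms[of "e/2"] by auto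
  moreover have "a \<le> e/2 \<Longrightarrow> a < e" for a using \<open>e > 0\<close> by simp
  ultimately show "\<exists>d>0. \<forall>x\<in>UNIV. \<forall>x'\<in>UNIV. dist x' x < d \<longrightarrow> dist (f x') (f x) < e"
    by (intro exI[of _ d]) simp
qed

text \<open>Continuity at the finitely many points of a net controls small shifts everywhere, since every
translate is close to the translate by a point of the net.\<close>

lemma ap_uniformly_close:
  assumes "ap f" "e > 0"
  shows "\<exists>d>0. \<forall>x y. dist x y < d \<longrightarrow> close_translates f e x y"
proof -
  obtain X where X: "finite X" "\<And>x. \<exists>y\<in>X. close_translates f (e/3) x y"
    using ap_net[OF assms(1), of "e/3"] assms(2) by auto
  have "\<forall>x. \<exists>d>0. \<forall>h. norm h < d \<longrightarrow> dist (f (x + h)) (f x) < e/3"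
  proof
    fix x
    have "isCont f x" using assms(1) by (simp add: ap_def continuous_on_eq_continuous_at)
    then obtain d where d: "d > 0" "\<And>z. dist z x < d \<Longrightarrow> dist (f z) (f x) < e/3"
      unfolding continuous_at_eps_delta using assms(2) by (metis divide_pos_pos zero_less_numeral)
    show "\<exists>d>0. \<forall>h. norm h < d \<longrightarrow> dist (f (x + h)) (f x) < e/3"
      using d by (intro exI[of _ d]) (auto simp: dist_norm)
  qed
  then obtain d where d: "\<And>x. d x > 0" "\<And>x h. norm h < d x \<Longrightarrow> dist (f (x + h)) (f x) < e/3"
    by metis
  define m where "m = Min (insert 1 (d ` X))"
  have m: "m > 0" "\<And>x. x \<in> X \<Longrightarrow> m \<le> d x"
    unfolding m_def using X(1) d(1) by auto
  have *: "dist (f (x + h)) (f x) \<le> e" if "norm h < m" for x h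
  proof -
    obtain y where y: "y \<in> X" "close_translates f (e/3) x y" using X(2) by blast
    have "dist (f (x + h)) (f x) \<le> dist (f (x + h)) (f (y + h)) + dist (f (y + h)) (f y) + dist (f y) (f x)"
      using dist_triangle[of "f (x + h)" "f x" "f (y + h)"] dist_triangle[of "f (y + h)" "f x" "f y"] by linarith
    also have "\<dots> \<le> e/3 + e/3 + e/3"
      using close_translatesD[OF y(2), of h] close_translates_dist[OF y(2)] d(2)[of h y] m(2)[OF y(1)] that
      by (intro add_mono) (auto simp: dist_commute)
    finally show ?thesis by simp
  qed
  show ?thesis
  proof (intro exI[of _ m] conjI allI impI m(1))
    fix x y :: 'a assume "dist x y < m"
    then show "close_translates f e x y"
      unfolding close_translates_def using *[of "x - y" "y + s" for s]
      by (auto simp: dist_norm algebra_simps)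
  qed
qed

text \<open>Domination is the working tool: a function that is uniformly continuous for the pseudometric given
by the distance of the translates of \<open>f\<close> inherits the finite nets of \<open>f\<close>.\<close>

lemma ap_dominated:
  assumes f: "ap f" and "dominated f w"
  shows "ap w"
proof -
  have *: "\<exists>d>0. \<forall>x y. close_translates f d x y \<longrightarrow> close_translates w e x y" if e: "e > 0" for e
    using assms(2) e unfolding dominated_def close_translates_def[of w]
    by (metis close_translates_shift)
  have "continuous_on UNIV w"
  proof (rule continuous_on_UNIV_if_close)
    fix e :: real assume "e > 0"
    then obtain d where d: "d > 0" "\<And>x y. close_translates f d x y \<Longrightarrow> close_translates w e x y"
      using *[of e] by auto
    obtain \<delta> where \<delta>: "\<delta> > 0" "\<And>x y. dist x y < \<delta> \<Longrightarrow> close_translates f d x y"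
      using ap_uniformly_close[OF f d(1)] by blast
    show "\<exists>d>0. \<forall>x y. dist x y < d \<longrightarrow> dist (w x) (w y) \<le> e"
      using \<delta> close_translates_dist[OF d(2)[OF \<delta>(2)]] by blast
  qed
  moreover have "\<exists>X. finite X \<and> (\<forall>x. \<exists>y\<in>X. close_translates w e x y)" if e: "e > 0" for e
    using *[OF e] ap_net[OF f] by meson
  ultimately show ?thesis by (simp add: ap_def)
qed

text \<open>Nets of \<open>f\<close> and \<open>g\<close> divide the points into finitely many classes, according to the pair of net points
that they are close to; one representative of each class gives a net for the pair.\<close>

lemma ap_Pair:
  assumes "ap f" "ap g"
  shows "ap (\<lambda>x. (f x, g x))"
proof -
  have "\<exists>Z. finite Z \<and> (\<forall>x. \<exists>z\<in>Z. close_translates (\<lambda>x. (f x, g x)) e x z)" if e: "e > 0" for e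
  proof -
    obtain X where X: "finite X" "\<And>x. \<exists>y\<in>X. close_translates f (e/4) x y"
      using ap_net[OF assms(1), of "e/4"] e by auto
    obtain Y where Y: "finite Y" "\<And>x. \<exists>y\<in>Y. close_translates g (e/4) x y"
      using ap_net[OF assms(2), of "e/4"] e by auto
    define z where "z = (\<lambda>(x,y). SOME z. close_translates f (e/4) z x \<and> close_translates g (e/4) z y)"
    have "\<exists>u\<in>z ` (X \<times> Y). close_translates (\<lambda>x. (f x, g x)) e v u" for v
    proof -
      obtain x y where xy: "x \<in> X" "close_translates f (e/4) v x" "y \<in> Y" "close_translates g (e/4) v y"
        using X(2) Y(2) by blast
      have "close_translates f (e/4) (z (x,y)) x \<and> close_translates g (e/4) (z (x,y)) y"
        unfolding z_def prod.case by (rule someI[where x = v]) (use xy in auto)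
      then have "close_translates f (e/4 + e/4) v (z (x,y))" "close_translates g (e/4 + e/4) v (z (x,y))"
        using xy close_translates_trans close_translates_sym by blast+
      then have "close_translates (\<lambda>x. (f x, g x)) e v (z (x,y))"
        unfolding close_translates_def
      proof (intro allI)
        fix s
        assume a: "\<forall>s. dist (f (v + s)) (f (z (x,y) + s)) \<le> e/4 + e/4" "\<forall>s. dist (g (v + s)) (g (z (x,y) + s)) \<le> e/4 + e/4"
        have "dist (f (v + s), g (v + s)) (f (z (x, y) + s), g (z (x, y) + s))
            \<le> dist (f (v + s)) (f (z (x,y) + s)) + dist (g (v + s)) (g (z (x,y) + s))"
          unfolding dist_Pair_Pair by (rule sqrt_sum_squares_le_sum) auto
        also have "\<dots> \<le> (e/4 + e/4) + (e/4 + e/4)" using a by (intro add_mono) auto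
        finally show "dist (f (v + s), g (v + s)) (f (z (x, y) + s), g (z (x, y) + s)) \<le> e" by simp
      qed
      then show ?thesis using xy by blast
    qed
    then show ?thesis using X(1) Y(1) by (intro exI[of _ "z ` (X \<times> Y)"]) auto
  qed
  moreover have "continuous_on UNIV (\<lambda>x. (f x, g x))"
    using assms by (intro continuous_on_Pair) (auto simp: ap_def)
  ultimately show ?thesis by (simp add: ap_def)
qed

lemma ap_bounded:
  fixes f :: "'a::real_normed_vector \<Rightarrow> 'b::real_normed_vector"
  assumes "ap f"
  obtains B where "B > 0" "\<And>x. norm (f x) \<le> B"
proof -
  obtain X where X: "finite X" "\<And>x. \<exists>y\<in>X. close_translates f 1 x y"
    using ap_net[OF assms, of 1] by auto
  define B where "B = 1 + (\<Sum>x\<in>X. norm (f x))"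
  have "norm (f x) \<le> B" for x
  proof -
    obtain y where y: "y \<in> X" "close_translates f 1 x y" using X by blast
    have "norm (f x) \<le> dist (f x) (f y) + norm (f y)"
      by (metis dist_norm norm_triangle_sub add.commute)
    also have "\<dots> \<le> 1 + (\<Sum>x\<in>X. norm (f x))"
      by (intro add_mono close_translates_dist[OF y(2)] member_le_sum) (use X y in auto)
    finally show ?thesis by (simp add: B_def)
  qed
  moreover have "B > 0" unfolding B_def by (simp add: sum_nonneg add_pos_nonneg)
  ultimately show ?thesis using that by blast
qed

lemma ap_compose:
  fixes f :: "'a::real_normed_vector \<Rightarrow> 'b::{real_normed_vector,heine_borel}" and \<phi> :: "'b \<Rightarrow> 'c::metric_space"
  assumes "ap f" "continuous_on (closure (range f)) \<phi>"
  shows "ap (\<lambda>x. \<phi> (f x))"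
proof (rule ap_dominated[OF assms(1)], unfold dominated_def, intro allI impI)
  fix e :: real assume "e > 0"
  obtain B where "\<And>x. norm (f x) \<le> B" using ap_bounded[OF assms(1)] by blast
  then have "bounded (range f)" unfolding bounded_iff by blast
  then have "compact (closure (range f))" by (simp add: compact_closure)
  then have "uniformly_continuous_on (closure (range f)) \<phi>"
    using assms(2) compact_uniformly_continuous by blast
  then obtain d where d: "d > 0" "\<And>x y. dist (f y) (f x) < d \<Longrightarrow> dist (\<phi> (f y)) (\<phi> (f x)) < e"
    unfolding uniformly_continuous_on_def using \<open>e > 0\<close> closure_subset[of "range f"] by (metis UNIV_I image_subset_iff)
  show "\<exists>d>0. \<forall>x y. close_translates f d x y \<longrightarrow> dist (\<phi> (f x)) (\<phi> (f y)) \<le> e"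
  proof (intro exI[of _ "d/2"] conjI allI impI)
    fix x y assume "close_translates f (d/2) x y"
    then have "dist (f x) (f y) < d" using close_translates_dist[of f "d/2" x y] d(1) by linarith
    then show "dist (\<phi> (f x)) (\<phi> (f y)) \<le> e" using d(2) by (simp add: less_imp_le)
  qed (use d in auto)
qed

lemma ap_compose_UNIV:
  fixes f :: "'a::real_normed_vector \<Rightarrow> 'b::{real_normed_vector,heine_borel}" and \<phi> :: "'b \<Rightarrow> 'c::metric_space"
  assumes "ap f" "continuous_on UNIV \<phi>"
  shows "ap (\<lambda>x. \<phi> (f x))"
  using ap_compose[OF assms(1)] assms(2) continuous_on_subset by blast

named_theorems ap_intros

lemma ap_const [ap_intros]: "ap (\<lambda>x. c)"
  unfolding ap_def close_translates_def by (auto intro!: exI[of _ "{0}"])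

lemma ap_translate [ap_intros]:
  assumes "ap f" shows "ap (\<lambda>x. f (x + t))" "ap (\<lambda>x. f (t + x))"
proof -
  have "dominated f (\<lambda>x. f (x + t))"
    unfolding dominated_def by (meson close_translatesD)
  then show "ap (\<lambda>x. f (x + t))" using assms ap_dominated by blast
  then show "ap (\<lambda>x. f (t + x))" by (simp add: add.commute)
qed

lemma ap_map2:
  fixes f :: "'a::real_normed_vector \<Rightarrow> 'b::{real_normed_vector,heine_borel}"
    and g :: "'a \<Rightarrow> 'c::{real_normed_vector,heine_borel}" and \<phi> :: "'b \<times> 'c \<Rightarrow> 'd::metric_space"
  assumes "ap f" "ap g" "continuous_on UNIV \<phi>"
  shows "ap (\<lambda>x. \<phi> (f x, g x))"
  by (rule ap_compose_UNIV[OF ap_Pair[OF assms(1,2)] assms(3)])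

context
  fixes f g :: "'a::real_normed_vector \<Rightarrow> complex"
begin

lemma ap_add [ap_intros]: "ap f \<Longrightarrow> ap g \<Longrightarrow> ap (\<lambda>x. f x + g x)"
  using ap_map2[of f g "\<lambda>(u,v). u + v"] by (simp add: case_prod_unfold continuous_intros)

lemma ap_mult [ap_intros]: "ap f \<Longrightarrow> ap g \<Longrightarrow> ap (\<lambda>x. f x * g x)"
  using ap_map2[of f g "\<lambda>(u,v). u * v"] by (simp add: case_prod_unfold continuous_intros)

lemma ap_diff [ap_intros]: "ap f \<Longrightarrow> ap g \<Longrightarrow> ap (\<lambda>x. f x - g x)"
  using ap_map2[of f g "\<lambda>(u,v). u - v"] by (simp add: case_prod_unfold continuous_intros)

lemma ap_minus [ap_intros]: "ap f \<Longrightarrow> ap (\<lambda>x. - f x)"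
  by (rule ap_compose_UNIV) (auto intro: continuous_intros)

lemma ap_cnj [ap_intros]: "ap f \<Longrightarrow> ap (\<lambda>x. cnj (f x))"
  by (rule ap_compose_UNIV) (auto intro: continuous_intros)

lemma ap_cmod [ap_intros]: "ap f \<Longrightarrow> ap (\<lambda>x. cmod (f x))"
  by (rule ap_compose_UNIV) (auto intro: continuous_intros)

lemma ap_of_real [ap_intros]: "ap (h::'a \<Rightarrow> real) \<Longrightarrow> ap (\<lambda>x. of_real (h x) :: complex)"
  by (rule ap_compose_UNIV) (auto intro: continuous_intros)

lemma ap_Re [ap_intros]: "ap f \<Longrightarrow> ap (\<lambda>x. Re (f x))"
  by (rule ap_compose_UNIV) (auto intro: continuous_intros)

lemma ap_exp [ap_intros]: "ap f \<Longrightarrow> ap (\<lambda>x. exp (f x))"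
  by (rule ap_compose_UNIV) (auto intro: continuous_intros)

lemma ap_power [ap_intros]: "ap f \<Longrightarrow> ap (\<lambda>x. f x ^ n)"
  by (rule ap_compose_UNIV) (auto intro: continuous_intros)

end

lemma ap_sum [ap_intros]:
  fixes f :: "'i \<Rightarrow> 'a::real_normed_vector \<Rightarrow> complex"
  shows "(\<And>i. i \<in> I \<Longrightarrow> ap (f i)) \<Longrightarrow> ap (\<lambda>x. \<Sum>i\<in>I. f i x)"
  by (induction I rule: infinite_finite_induct) (auto intro: ap_intros)

lemma ap_cis [ap_intros]: "ap (\<lambda>x::'a::real_inner. cis (x \<bullet> l))"
proof -
  have "\<exists>X. finite X \<and> (\<forall>x. \<exists>y\<in>X. close_translates (\<lambda>x. cis (x \<bullet> l)) e x y)" if e: "e > 0" for e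
  proof -
    let ?C = "range (\<lambda>x. cis (x \<bullet> l))"
    have "bounded ?C" by (auto simp: bounded_iff intro!: exI[of _ 1])
    then have "compact (closure ?C)" by (simp add: compact_closure)
    moreover have "closure ?C \<subseteq> (\<Union>c\<in>?C. ball c e)"
    proof
      fix z assume "z \<in> closure ?C"
      then obtain c where "c \<in> ?C" "dist c z < e" using \<open>e > 0\<close> closure_approachable by metis
      then show "z \<in> (\<Union>c\<in>?C. ball c e)" by auto
    qed
    ultimately obtain D where D: "D \<subseteq> ?C" "finite D" "closure ?C \<subseteq> (\<Union>c\<in>D. ball c e)"
      by (metis compactE_image open_ball)
    then obtain X where X: "finite X" "D = (\<lambda>x. cis (x \<bullet> l)) ` X"
      using finite_subset_image[of D "\<lambda>x. cis (x \<bullet> l)" UNIV] by auto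
    have "\<exists>y\<in>X. close_translates (\<lambda>x. cis (x \<bullet> l)) e x y" for x
    proof -
      have "cis (x \<bullet> l) \<in> (\<Union>c\<in>D. ball c e)" using D(3) closure_subset[of ?C] by blast
      then obtain y where y: "y \<in> X" "dist (cis (y \<bullet> l)) (cis (x \<bullet> l)) < e" using X by auto
      have "close_translates (\<lambda>x. cis (x \<bullet> l)) e x y"
        unfolding close_translates_def
      proof
        fix s
        have "dist (cis ((x + s) \<bullet> l)) (cis ((y + s) \<bullet> l)) = cmod ((cis (x \<bullet> l) - cis (y \<bullet> l)) * cis (s \<bullet> l))"
          by (simp add: dist_norm inner_add_left cis_mult[symmetric] algebra_simps)
        also have "\<dots> = dist (cis (y \<bullet> l)) (cis (x \<bullet> l))" by (simp add: norm_mult dist_norm norm_minus_commute)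
        finally show "dist (cis ((x + s) \<bullet> l)) (cis ((y + s) \<bullet> l)) \<le> e" using y(2) by simp
      qed
      with y show ?thesis by blast
    qed
    with X show ?thesis by blast
  qed
  moreover have "continuous_on UNIV (\<lambda>x::'a. cis (x \<bullet> l))" by (intro continuous_intros)
  ultimately show ?thesis by (simp add: ap_def)
qed

lemma ap_cis_minus [ap_intros]: "ap (\<lambda>x::'a::real_inner. cis (- (x \<bullet> l)))"
  using ap_cis[of "- l"] by simp

lemma ap_uniform_approx:
  fixes f :: "'a::real_normed_vector \<Rightarrow> 'b::metric_space"
  assumes "\<And>e. e > 0 \<Longrightarrow> \<exists>g. ap g \<and> (\<forall>x. dist (f x) (g x) \<le> e)"
  shows "ap f"
proof -
  have *: "\<exists>g::'a \<Rightarrow> 'b. ap g \<and> (\<forall>x y. close_translates g (e/3) x y \<longrightarrow> close_translates f e x y)" if e: "e > 0" for e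
  proof -
    obtain g :: "'a \<Rightarrow> 'b" where g: "ap g" "\<And>x. dist (f x) (g x) \<le> e/3" using assms[of "e/3"] e by auto
    have "close_translates f e x y" if "close_translates g (e/3) x y" for x y
      unfolding close_translates_def
    proof
      fix s
      show "dist (f (x + s)) (f (y + s)) \<le> e"
        using g(2)[of "x + s"] g(2)[of "y + s"] close_translatesD[OF that, of s]
          dist_triangle[of "f (x + s)" "f (y + s)" "g (x + s)"] dist_triangle[of "g (x + s)" "f (y + s)" "g (y + s)"]
        by (simp add: dist_commute)
    qed
    with g show ?thesis by blast
  qed
  have "continuous_on UNIV f"
  proof (rule continuous_on_UNIV_if_close)
    fix e :: real assume "e > 0"
    then obtain g :: "'a \<Rightarrow> 'b" where g: "ap g" "\<And>x y. close_translates g (e/3) x y \<Longrightarrow> close_translates f e x y"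
      using *[of e] by auto
    obtain d where d: "d > 0" "\<And>x y. dist x y < d \<Longrightarrow> close_translates g (e/3) x y"
      using ap_uniformly_close[OF g(1), of "e/3"] \<open>e > 0\<close> by auto
    show "\<exists>d>0. \<forall>x y. dist x y < d \<longrightarrow> dist (f x) (f y) \<le> e"
      using d close_translates_dist[OF g(2)[OF d(2)]] by blast
  qed
  moreover have "\<exists>X. finite X \<and> (\<forall>x. \<exists>y\<in>X. close_translates f e x y)" if e: "e > 0" for e
  proof -
    obtain g :: "'a \<Rightarrow> 'b" where g: "ap g" "\<And>x y. close_translates g (e/3) x y \<Longrightarrow> close_translates f e x y"
      using *[OF e] by auto
    show ?thesis using ap_net[OF g(1), of "e/3"] g(2) e by (meson divide_pos_pos zero_less_numeral)
  qed
  ultimately show ?thesis by (simp add: ap_def)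
qed

lemma cbox_translate_mem:
  fixes a x :: "real ^ 'p"
  shows "a \<in> cbox (\<chi> i. x $ i - L) (\<chi> i. x $ i - L + L) \<Longrightarrow> x - a \<in> cbox 0 (\<chi> i. L)"
  by (auto simp: mem_box_cart algebra_simps)

text \<open>By Bohr's condition every translate is close to a translate by a point of a fixed cube. Compactness
of the cube yields first uniform continuity and then finite nets.\<close>

lemma almost_periodic_imp_ap:
  fixes f :: "real ^ 'p \<Rightarrow> complex"
  assumes "almost_periodic f"
  shows "ap f"
proof -
  have cont: "continuous_on UNIV f" using assms by (simp add: almost_periodic_def)
  have *: "\<exists>L>0. \<forall>x. \<exists>y\<in>cbox 0 (\<chi> i. L). close_translates f e x y" if e: "e > 0" for e
  proof -
    obtain L where L: "L > 0" "\<And>a. \<exists>\<tau>\<in>cbox a (\<chi> i. a $ i + L). (SUP x. ereal (cmod (f (x + \<tau>) - f x))) < ereal e"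
      using assms e unfolding almost_periodic_def by blast
    have "\<exists>y\<in>cbox 0 (\<chi> i. L). close_translates f e x y" for x
    proof -
      obtain \<tau> where \<tau>: "\<tau> \<in> cbox (\<chi> i. x $ i - L) (\<chi> i. x $ i - L + L)" "(SUP x. ereal (cmod (f (x + \<tau>) - f x))) < ereal e"
        using L(2)[of "\<chi> i. x $ i - L"] by auto
      have "ereal (cmod (f (x + \<tau>) - f x)) < ereal e" for x
        using \<tau>(2) by (meson SUP_upper UNIV_I le_less_trans)
      then have **: "cmod (f (z + \<tau>) - f z) < e" for z by simp
      have "close_translates f e x (x - \<tau>)"
        unfolding close_translates_def
      proof
        fix s show "dist (f (x + s)) (f (x - \<tau> + s)) \<le> e"
          using **[of "x - \<tau> + s"] by (simp add: dist_norm algebra_simps)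
      qed
      then show ?thesis using cbox_translate_mem[OF \<tau>(1)] by blast
    qed
    with L(1) show ?thesis by blast
  qed
  have uc: "\<exists>d>0. \<forall>x y. dist x y < d \<longrightarrow> close_translates f e x y" if e: "e > 0" for e
  proof -
    obtain L where L: "L > 0" "\<And>x. \<exists>y\<in>cbox 0 (\<chi> i. L). close_translates f (e/3) x y"
      using *[of "e/3"] e by auto
    define K where "K = {y + h |y h. y \<in> cbox (0::real^'p) (\<chi> i. L) \<and> h \<in> cball 0 1}"
    have "compact K" unfolding K_def by (intro compact_sums) auto
    then have "uniformly_continuous_on K f"
      using compact_uniformly_continuous continuous_on_subset[OF cont] by blast
    then have "\<exists>d>0. \<forall>x\<in>K. \<forall>y\<in>K. dist y x < d \<longrightarrow> dist (f y) (f x) < e/3"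
      unfolding uniformly_continuous_on_def using e by (elim allE[of _ "e/3"]) auto
    then obtain d where d: "d > 0" "\<And>x y. x \<in> K \<Longrightarrow> y \<in> K \<Longrightarrow> dist y x < d \<Longrightarrow> dist (f y) (f x) < e/3"
      by blast
    have **: "dist (f (x + h)) (f x) \<le> e" if "norm h < min d 1" for x h
    proof -
      obtain y where y: "y \<in> cbox 0 (\<chi> i. L)" "close_translates f (e/3) x y" using L by blast
      have "y + k \<in> K" if "norm k \<le> 1" for k
        unfolding K_def using y(1) that by (intro CollectI exI[of _ y] exI[of _ k]) simp
      from this[of 0] this[of h] have "y + 0 \<in> K" "y + h \<in> K" using that by auto
      then have "dist (f (y + h)) (f y) < e/3" using d(2)[of y "y + h"] that by (simp add: dist_norm)
      then show ?thesis
        using close_translatesD[OF y(2), of h] close_translates_dist[OF y(2)]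
          dist_triangle[of "f (x + h)" "f x" "f (y + h)"] dist_triangle[of "f (y + h)" "f x" "f y"]
        by (simp add: dist_commute)
    qed
    show ?thesis
    proof (intro exI[of _ "min d 1"] conjI allI impI)
      fix x y :: "real ^ 'p" assume "dist x y < min d 1"
      then show "close_translates f e x y"
        unfolding close_translates_def using **[of "x - y" "y + s" for s]
        by (auto simp: dist_norm algebra_simps)
    qed (use d in auto)
  qed
  have "\<exists>X. finite X \<and> (\<forall>x. \<exists>y\<in>X. close_translates f e x y)" if e: "e > 0" for e
  proof -
    obtain L where L: "L > 0" "\<And>x. \<exists>y\<in>cbox 0 (\<chi> i. L). close_translates f (e/2) x y"
      using *[of "e/2"] e by auto
    obtain d where d: "d > 0" "\<And>x y. dist x y < d \<Longrightarrow> close_translates f (e/2) x y"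
      using uc[of "e/2"] e by auto
    obtain X where X: "finite X" "cbox (0::real^'p) (\<chi> i. L) \<subseteq> (\<Union>x\<in>X. ball x d)"
    proof -
      have "compact (cbox (0::real^'p) (\<chi> i. L))" by simp
      moreover have "cbox (0::real^'p) (\<chi> i. L) \<subseteq> (\<Union>x\<in>cbox 0 (\<chi> i. L). ball x d)" using d by auto
      ultimately show ?thesis using that by (metis compactE_image open_ball)
    qed
    have "\<exists>y\<in>X. close_translates f e x y" for x
    proof -
      obtain y where y: "y \<in> cbox 0 (\<chi> i. L)" "close_translates f (e/2) x y" using L by blast
      obtain z where z: "z \<in> X" "dist y z < d" using X y by (auto simp: dist_commute)
      show ?thesis using close_translates_trans[OF y(2) d(2)[OF z(2)]] z by auto
    qed
    with X show ?thesis by blast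
  qed
  with cont show ?thesis by (simp add: ap_def)
qed

text \<open>An Arzela-Ascoli theorem without compactness of the domain: a diagonal sequence converges on the
countable union of the nets of \<open>f\<close>, and equicontinuity for the pseudometric of \<open>f\<close> makes the
convergence uniform.\<close>

lemma ap_equicontinuous_subsequence:
  fixes f :: "'a::real_normed_vector \<Rightarrow> 'b::metric_space" and w :: "nat \<Rightarrow> 'a \<Rightarrow> complex"
  assumes f: "ap f" and bdd: "\<And>n x. cmod (w n x) \<le> B"
    and equi: "\<And>e. e > 0 \<Longrightarrow> \<exists>d>0. \<forall>n x y. close_translates f d x y \<longrightarrow> cmod (w n x - w n y) \<le> e"
  obtains r v where "strict_mono (r :: nat \<Rightarrow> nat)" "ap v"
    "\<And>e. e > 0 \<Longrightarrow> \<exists>N. \<forall>n\<ge>N. \<forall>x. cmod (w (r n) x - v x) \<le> e"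
proof -
  have "\<forall>k. \<exists>X. finite X \<and> (\<forall>x. \<exists>y\<in>X. close_translates f (1 / real (Suc k)) x y)"
    using ap_net[OF f] by simp
  then obtain X where X: "\<And>k. finite (X k)" "\<And>k x. \<exists>y\<in>X k. close_translates f (1 / real (Suc k)) x y"
    by metis
  have "countable (\<Union>k. X k)" using X(1) by (simp add: countable_finite)
  then obtain r where r: "strict_mono (r::nat\<Rightarrow>nat)" "\<And>x. x \<in> (\<Union>k. X k) \<Longrightarrow> \<exists>l. (\<lambda>n. w (r n) x) \<longlonglongrightarrow> l"
    using function_convergent_subsequence[of "\<Union>k. X k" w B] bdd by metis
  have cauchy: "\<exists>N. \<forall>m\<ge>N. \<forall>n\<ge>N. \<forall>x. cmod (w (r m) x - w (r n) x) \<le> e" if e: "e > 0" for e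
  proof -
    obtain d where d: "d > 0" "\<And>n x y. close_translates f d x y \<Longrightarrow> cmod (w n x - w n y) \<le> e/3"
      using equi[of "e/3"] e by auto
    obtain k where k: "1 / real (Suc k) < d" using d(1) nat_approx_posE by blast
    have "\<forall>y\<in>X k. \<exists>N. \<forall>m\<ge>N. \<forall>n\<ge>N. cmod (w (r m) y - w (r n) y) < e/3"
    proof
      fix y assume "y \<in> X k"
      then have "Cauchy (\<lambda>n. w (r n) y)" using r(2)[of y] by (meson LIMSEQ_imp_Cauchy UNIV_I UN_iff)
      then show "\<exists>N. \<forall>m\<ge>N. \<forall>n\<ge>N. cmod (w (r m) y - w (r n) y) < e/3"
        using e unfolding Cauchy_def dist_norm by (elim allE[of _ "e/3"]) auto
    qed
    then obtain N where N: "\<And>y m n. y \<in> X k \<Longrightarrow> m \<ge> N y \<Longrightarrow> n \<ge> N y \<Longrightarrow> cmod (w (r m) y - w (r n) y) < e/3"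
      by metis
    have "cmod (w (r m) x - w (r n) x) \<le> e" if mn: "m \<ge> Max (insert 0 (N ` X k))" "n \<ge> Max (insert 0 (N ` X k))" for m n x
    proof -
      obtain y where y: "y \<in> X k" "close_translates f d x y"
        using X(2)[of k x] close_translates_mono k by (metis less_imp_le)
      have "m \<ge> N y" "n \<ge> N y" using mn X(1)[of k] y(1) by auto
      then have a: "cmod (w (r m) y - w (r n) y) < e/3" using N y by blast
      have "w (r m) x - w (r n) x = (w (r m) x - w (r m) y) + (w (r m) y - w (r n) y) - (w (r n) x - w (r n) y)" by simp
      also have "cmod \<dots> \<le> cmod (w (r m) x - w (r m) y) + cmod (w (r m) y - w (r n) y) + cmod (w (r n) x - w (r n) y)"
        by (meson norm_triangle_ineq norm_triangle_ineq4 add_mono order_trans order_refl)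
      also have "\<dots> \<le> e/3 + e/3 + e/3"
        using a d(2)[OF y(2)] by (intro add_mono) auto
      finally show ?thesis by simp
    qed
    then show ?thesis by blast
  qed
  have conv: "\<exists>l. (\<lambda>n. w (r n) x) \<longlonglongrightarrow> l" for x
  proof -
    have "Cauchy (\<lambda>n. w (r n) x)"
    proof (rule CauchyI)
      fix e :: real assume "0 < e"
      then obtain N where N: "\<forall>m\<ge>N. \<forall>n\<ge>N. \<forall>x. cmod (w (r m) x - w (r n) x) \<le> e/2"
        using cauchy[of "e/2"] by auto
      have "cmod (w (r m) x - w (r n) x) < e" if "m \<ge> N" "n \<ge> N" for m n
        using N that \<open>0 < e\<close> by (smt (verit) field_sum_of_halves)
      then show "\<exists>M. \<forall>m\<ge>M. \<forall>n\<ge>M. norm (w (r m) x - w (r n) x) < e" by blast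
    qed
    then show ?thesis by (simp add: Cauchy_convergent_iff convergent_def)
  qed
  then obtain v where v: "\<And>x. (\<lambda>n. w (r n) x) \<longlonglongrightarrow> v x" by metis
  have lim: "\<exists>N. \<forall>n\<ge>N. \<forall>x. cmod (w (r n) x - v x) \<le> e" if e: "e > 0" for e
  proof -
    obtain N where N: "\<forall>m\<ge>N. \<forall>n\<ge>N. \<forall>x. cmod (w (r m) x - w (r n) x) \<le> e" using cauchy[OF e] by auto
    have "cmod (w (r n) x - v x) \<le> e" if "n \<ge> N" for n x
    proof (rule LIMSEQ_le_const2)
      show "(\<lambda>m. cmod (w (r n) x - w (r m) x)) \<longlonglongrightarrow> cmod (w (r n) x - v x)"
        using v[of x] by (intro tendsto_intros)
      show "\<exists>N. \<forall>m\<ge>N. cmod (w (r n) x - w (r m) x) \<le> e" using N that by blast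
    qed
    then show ?thesis by blast
  qed
  have "ap v"
  proof (rule ap_uniform_approx)
    fix e :: real assume "e > 0"
    then obtain N where "\<forall>n\<ge>N. \<forall>x. cmod (w (r n) x - v x) \<le> e" using lim by blast
    then have "\<forall>x. dist (v x) (w (r N) x) \<le> e" by (simp add: dist_norm norm_minus_commute)
    moreover have "ap (w (r N))"
    proof (rule ap_dominated[OF f], unfold dominated_def, intro allI impI)
      fix e :: real assume "e > 0"
      then show "\<exists>d>0. \<forall>x y. close_translates f d x y \<longrightarrow> dist (w (r N) x) (w (r N) y) \<le> e"
        using equi[of e] by (metis dist_norm)
    qed
    ultimately show "\<exists>g. ap g \<and> (\<forall>x. dist (v x) (g x) \<le> e)" by blast
  qed
  then show ?thesis using that r(1) lim by blast
qed

section \<open>The mean value\<close>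

abbreviation cube :: "real \<Rightarrow> 'a::euclidean_space set" where
  "cube S \<equiv> cbox (- (S *\<^sub>R One)) (S *\<^sub>R One)"

definition avg :: "real \<Rightarrow> ('a::euclidean_space \<Rightarrow> 'b::euclidean_space) \<Rightarrow> 'a \<Rightarrow> 'b" where
  "avg S f a = integral (cube S) (\<lambda>t. f (a + t)) /\<^sub>R (2 * S) ^ DIM('a)"

definition mean :: "('a::euclidean_space \<Rightarrow> 'b::euclidean_space) \<Rightarrow> 'b" where
  "mean f = Lim at_top (\<lambda>S. avg S f 0)"

lemma inner_One [simp]: "i \<in> Basis \<Longrightarrow> (One::'a::euclidean_space) \<bullet> i = 1"
  using inner_sum_left_Basis[of i "\<lambda>_. 1"] by simp

lemma measure_cube: "S \<ge> 0 \<Longrightarrow> measure lborel (cube S :: 'a::euclidean_space set) = (2 * S) ^ DIM('a)"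
  by (subst content_cbox) (auto simp: inner_minus_left)

lemma integrable_shift_cube:
  fixes f :: "'a::euclidean_space \<Rightarrow> 'b::euclidean_space"
  assumes "continuous_on UNIV f"
  shows "(\<lambda>t. f (a + t)) integrable_on (cube S)"
  by (intro integrable_continuous continuous_on_compose2[OF assms]) (auto intro: continuous_intros)

lemma norm_scaled_le:
  assumes "(K::real) > 0" "norm v \<le> e * K" shows "norm (v /\<^sub>R K) \<le> e"
  using assms by (simp add: field_simps)

lemma avg_close:
  fixes f g :: "'a::euclidean_space \<Rightarrow> 'b::euclidean_space"
  assumes f: "continuous_on UNIV f" and g: "continuous_on UNIV g" and S: "S > 0"
    and le: "\<And>t. norm (f (a + t) - g (b + t)) \<le> e"
  shows "norm (avg S f a - avg S g b) \<le> e"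
proof -
  have e: "e \<ge> 0" using le[of 0] norm_ge_zero order_trans by blast
  have "norm (integral (cube S) (\<lambda>t. f (a + t) - g (b + t))) \<le> e * measure lborel (cube S :: 'a set)"
    by (rule integrable_bound) (use e le in \<open>auto intro!: integrable_diff integrable_shift_cube f g\<close>)
  then have "norm (integral (cube S) (\<lambda>t. f (a + t)) - integral (cube S) (\<lambda>t. g (b + t))) \<le> e * (2 * S) ^ DIM('a)"
    unfolding measure_cube[OF less_imp_le[OF S]] by (simp add: integral_diff integrable_shift_cube f g)
  then show ?thesis
    unfolding avg_def scaleR_diff_right[symmetric] by (rule norm_scaled_le[rotated]) (use S in simp)
qed

lemma avg_const:
  assumes "S > 0" shows "avg S (\<lambda>x::'a::euclidean_space. c) a = c"
proof -
  have *: "(2 * S) ^ DIM('a) \<noteq> 0" using assms by simp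
  show ?thesis
    unfolding avg_def integral_const measure_cube[OF less_imp_le[OF assms]]
    by (simp only: scaleR_scaleR left_inverse[OF *] scaleR_one)
qed

lemma integral_subbox_diff:
  fixes f :: "'a::euclidean_space \<Rightarrow> 'b::euclidean_space"
  assumes f: "continuous_on UNIV f" and C: "\<And>x. norm (f x) \<le> C" and sub: "cbox c d \<subseteq> cbox a b"
  shows "norm (integral (cbox a b) f - integral (cbox c d) f) \<le> C * (measure lborel (cbox a b) - measure lborel (cbox c d))"
proof -
  have int: "f integrable_on cbox u v" for u v
    using f by (intro integrable_continuous) (auto intro: continuous_on_subset)
  have 1: "((\<lambda>x. f x - (if x \<in> cbox c d then f x else 0)) has_integral (integral (cbox a b) f - integral (cbox c d) f)) (cbox a b)"
    by (intro has_integral_diff integrable_integral int, subst has_integral_restrict[OF sub]) (rule integrable_integral[OF int])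
  have 2: "((\<lambda>x. C - (if x \<in> cbox c d then C else 0)) has_integral (measure lborel (cbox a b) *\<^sub>R C - measure lborel (cbox c d) *\<^sub>R C)) (cbox a b)"
    by (intro has_integral_diff has_integral_const, subst has_integral_restrict[OF sub]) (rule has_integral_const)
  have "norm (integral (cbox a b) (\<lambda>x. f x - (if x \<in> cbox c d then f x else 0)))
      \<le> integral (cbox a b) (\<lambda>x. C - (if x \<in> cbox c d then C else 0))"
    by (rule integral_norm_bound_integral) (use 1 2 C in \<open>auto simp: integrable_on_def\<close>)
  then show ?thesis using integral_unique[OF 1] integral_unique[OF 2] by (simp add: algebra_simps)
qed

text \<open>If \<open>R\<close> is the norm of \<open>a\<close>, the cubes of half-side \<open>S\<close> around \<open>0\<close> and \<open>a\<close> both contain the cube of half-side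
\<open>S - R\<close> around \<open>0\<close>, and the ratio of the volumes tends to 1.\<close>

lemma avg_shift_tendsto:
  fixes f :: "'a::euclidean_space \<Rightarrow> 'b::euclidean_space"
  assumes f: "continuous_on UNIV f" and C: "\<And>x. norm (f x) \<le> C"
  shows "((\<lambda>S. avg S f a - avg S f 0) \<longlongrightarrow> 0) at_top"
proof (rule Lim_null_comparison)
  define R where "R = norm a"
  show "\<forall>\<^sub>F S in at_top. norm (avg S f a - avg S f 0) \<le> 2 * C * (1 - (1 - R / S) ^ DIM('a))"
    using eventually_gt_at_top[of R] eventually_gt_at_top[of 0]
  proof eventually_elim
    fix S :: real assume S: "R < S" "0 < S"
    have aR: "\<bar>a \<bullet> i\<bar> \<le> R" if "i \<in> Basis" for i
      unfolding R_def by (rule Basis_le_norm[OF that])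
    have *: "norm (integral (cube S) (\<lambda>t. f (b + t)) - integral (cube (S - R)) f) \<le> C * ((2 * S) ^ DIM('a) - (2 * (S - R)) ^ DIM('a))"
      if b: "b = 0 \<or> b = a" for b
    proof -
      have "\<bar>b \<bullet> i\<bar> \<le> R" if "i \<in> Basis" for i using b aR[OF that] by (auto simp: R_def)
      then have sub: "(cube (S - R) :: 'a set) \<subseteq> cbox (b - S *\<^sub>R One) (b + S *\<^sub>R One)"
        by (auto simp: mem_box inner_diff_left inner_add_left abs_le_iff) (smt (verit))+
      have 1: "integral (cube S) (\<lambda>t. f (b + t)) = integral (cbox (b - S *\<^sub>R One) (b + S *\<^sub>R One)) f"
        using integral_shift_cbox_plus[of "- (S *\<^sub>R One)" "S *\<^sub>R One" f b] by (simp add: o_def add.commute)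
      have 2: "measure lborel (cbox (b - S *\<^sub>R One) (b + S *\<^sub>R One) :: 'a set) = (2 * S) ^ DIM('a)"
        using S by (subst content_cbox) (auto simp: inner_diff_left inner_add_left)
      have 3: "measure lborel (cube (S - R) :: 'a set) = (2 * (S - R)) ^ DIM('a)"
        by (rule measure_cube) (use S in simp)
      show ?thesis using integral_subbox_diff[OF f C sub] unfolding 1 2 3 .
    qed
    have "norm (integral (cube S) (\<lambda>t. f (a + t)) - integral (cube S) (\<lambda>t. f (0 + t)))
        \<le> C * ((2 * S) ^ DIM('a) - (2 * (S - R)) ^ DIM('a)) + C * ((2 * S) ^ DIM('a) - (2 * (S - R)) ^ DIM('a))"
      by (rule norm_diff_triangle_le[OF *]) (use *[of 0] in \<open>simp_all add: norm_minus_commute\<close>)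
    also have "\<dots> = 2 * C * (1 - (1 - R / S) ^ DIM('a)) * (2 * S) ^ DIM('a)"
    proof -
      have "(2 * (S - R)) ^ DIM('a) = (1 - R / S) ^ DIM('a) * (2 * S) ^ DIM('a)"
      proof -
        have "2 * (S - R) = (1 - R / S) * (2 * S)" using S by (simp add: field_simps)
        then show ?thesis by (simp only: power_mult_distrib)
      qed
      then have "C * ((2 * S) ^ DIM('a) - (2 * (S - R)) ^ DIM('a)) = C * (1 - (1 - R / S) ^ DIM('a)) * (2 * S) ^ DIM('a)"
        by (simp only: left_diff_distrib right_diff_distrib mult_1 mult.assoc)
      then show ?thesis by linarith
    qed
    finally show "norm (avg S f a - avg S f 0) \<le> 2 * C * (1 - (1 - R / S) ^ DIM('a))"
      unfolding avg_def scaleR_diff_right[symmetric] by (rule norm_scaled_le[rotated]) (use S in simp)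
  qed
  have "((\<lambda>S. R / S) \<longlongrightarrow> 0) at_top" 
    by (rule tendsto_divide_0[OF tendsto_const filterlim_at_top_imp_at_infinity[OF filterlim_ident]])
  then have "((\<lambda>S. 2 * C * (1 - (1 - R / S) ^ DIM('a))) \<longlongrightarrow> 2 * C * (1 - (1 - 0) ^ DIM('a))) at_top"
    by (intro tendsto_intros)
  then show "((\<lambda>S. 2 * C * (1 - (1 - R / S) ^ DIM('a))) \<longlongrightarrow> 0) at_top" by simp
qed

text \<open>It is enough to compare the centre \<open>0\<close> with the finitely many points of a net.\<close>

lemma avg_nearly_constant:
  fixes f :: "'a::euclidean_space \<Rightarrow> 'b::euclidean_space"
  assumes f: "ap f" and e: "e > 0"
  shows "\<forall>\<^sub>F S in at_top. \<forall>a. norm (avg S f a - avg S f 0) \<le> e"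
proof -
  obtain X where X: "finite X" "\<And>x. \<exists>y\<in>X. close_translates f (e/2) x y"
    using ap_net[OF f, of "e/2"] e by auto
  obtain C where C: "\<And>x. norm (f x) \<le> C" using ap_bounded[OF f] by blast
  have "\<forall>\<^sub>F S in at_top. norm (avg S f x - avg S f 0) < e/2" for x
    using tendstoD[OF avg_shift_tendsto[OF ap_continuous[OF f] C], of "e/2"] e by simp
  then have "\<forall>\<^sub>F S in at_top. \<forall>x\<in>X. norm (avg S f x - avg S f 0) < e/2"
    using X(1) by (simp add: eventually_ball_finite_distrib)
  then show ?thesis using eventually_gt_at_top[of 0]
  proof eventually_elim
    case (elim S)
    show ?case
    proof
      fix a
      obtain y where y: "y \<in> X" "close_translates f (e/2) a y" using X by blast
      have "norm (avg S f a - avg S f y) \<le> e/2"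
        by (rule avg_close) (use f elim close_translatesD[OF y(2)] in \<open>auto simp: dist_norm intro: ap_continuous\<close>)
      moreover have "norm (avg S f y - avg S f 0) \<le> e/2" using elim(1) y(1) by force
      ultimately show "norm (avg S f a - avg S f 0) \<le> e"
        using norm_diff_triangle_le[of "avg S f a" "avg S f y" "e/2" "avg S f 0" "e/2"] by simp
    qed
  qed
qed

lemma avg_swap:
  fixes f :: "'a::euclidean_space \<Rightarrow> 'b::euclidean_space"
  assumes f: "continuous_on UNIV f"
  shows "avg T (avg S f) 0 = avg S (avg T f) 0"
proof -
  have "integral (cube T) (\<lambda>a. integral (cube S) (\<lambda>t. f (a + t))) = integral (cube S) (\<lambda>t. integral (cube T) (\<lambda>a. f (a + t)))"
    by (rule integral_swap_continuous[where f = "\<lambda>a t. f (a + t)"])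
      (auto simp: case_prod_unfold intro!: continuous_on_compose2[OF f] continuous_intros)
  then show ?thesis
    unfolding avg_def by (simp add: integral_cmul add.commute mult.commute)
qed

lemma continuous_avg:
  fixes f :: "'a::euclidean_space \<Rightarrow> 'b::euclidean_space"
  assumes f: "ap f" and S: "S > 0"
  shows "continuous_on UNIV (avg S f)"
proof (rule continuous_on_UNIV_if_close)
  fix e :: real assume "e > 0"
  then obtain d where d: "d > 0" "\<And>x y. dist x y < d \<Longrightarrow> close_translates f e x y"
    using ap_uniformly_close[OF f] by blast
  have "dist (avg S f x) (avg S f y) \<le> e" if "dist x y < d" for x y
    unfolding dist_norm
    by (rule avg_close) (use f S close_translatesD[OF d(2)[OF that]] in \<open>auto simp: dist_norm intro: ap_continuous\<close>)
  with d(1) show "\<exists>d>0. \<forall>x y. dist x y < d \<longrightarrow> dist (avg S f x) (avg S f y) \<le> e" by blast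
qed

text \<open>For large \<open>S\<close> and \<open>T\<close> the iterated average is close to \<open>avg S f 0\<close> and, in the other order
of integration, to \<open>avg T f 0\<close>. So the averages satisfy Cauchy's criterion.\<close>

lemma mean_tendsto0:
  fixes f :: "'a::euclidean_space \<Rightarrow> 'b::euclidean_space"
  assumes f: "ap f"
  shows "((\<lambda>S. avg S f 0) \<longlongrightarrow> mean f) at_top"
proof -
  have *: "\<exists>S0>0. \<forall>S\<ge>S0. \<forall>T\<ge>S0. norm (avg S f 0 - avg T f 0) \<le> e" if e: "e > 0" for e
  proof -
    have "\<forall>\<^sub>F S in at_top. 0 < S \<and> (\<forall>a. norm (avg S f a - avg S f 0) \<le> e/2)"
      using e by (intro eventually_conj avg_nearly_constant f eventually_gt_at_top) auto
    then obtain S0 where S0: "\<And>S. S \<ge> S0 \<Longrightarrow> 0 < S \<and> (\<forall>a. norm (avg S f a - avg S f 0) \<le> e/2)"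
      unfolding eventually_at_top_linorder by blast
    have "norm (avg T (avg S f) 0 - avg S f 0) \<le> e/2" if "S \<ge> S0" "T \<ge> S0" for S T
    proof -
      have "norm (avg T (avg S f) 0 - avg T (\<lambda>x. avg S f 0) (0::'a)) \<le> e/2"
        by (rule avg_close) (use S0 that f in \<open>auto intro: continuous_avg\<close>)
      then show ?thesis using S0 that by (simp add: avg_const)
    qed
    then have "norm (avg S f 0 - avg T f 0) \<le> e" if "S \<ge> S0" "T \<ge> S0" for S T
      using that norm_diff_triangle_le[of "avg S f 0" "avg T (avg S f) 0" "e/2" "avg T f 0" "e/2"]
      unfolding avg_swap[OF ap_continuous[OF f], of T S]
      by (metis avg_swap[OF ap_continuous[OF f], of T S] norm_minus_commute field_sum_of_halves)
    with S0 show ?thesis by (intro exI[of _ "S0"]) auto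
  qed
  have "Cauchy (\<lambda>n. avg (real n) f 0)"
  proof (rule CauchyI)
    fix e :: real assume e: "0 < e"
    then obtain S0 where S0: "\<And>S T. S \<ge> S0 \<Longrightarrow> T \<ge> S0 \<Longrightarrow> norm (avg S f 0 - avg T f 0) \<le> e/2" using *[of "e/2"] by auto
    have "norm (avg (real m) f 0 - avg (real n) f 0) < e" if "m \<ge> nat \<lceil>S0\<rceil>" "n \<ge> nat \<lceil>S0\<rceil>" for m n
      using S0[of "real m" "real n"] e that by linarith
    then show "\<exists>M. \<forall>m\<ge>M. \<forall>n\<ge>M. norm (avg (real m) f 0 - avg (real n) f 0) < e" by blast
  qed
  then obtain l where l: "(\<lambda>n. avg (real n) f 0) \<longlonglongrightarrow> l" using Cauchy_convergent_iff convergent_def by blast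
  have "((\<lambda>S. avg S f 0) \<longlongrightarrow> l) at_top"
  proof (rule tendstoI)
    fix e :: real assume e: "0 < e"
    then obtain S0 where S0: "\<And>S T. S \<ge> S0 \<Longrightarrow> T \<ge> S0 \<Longrightarrow> norm (avg S f 0 - avg T f 0) \<le> e/2" using *[of "e/2"] by auto
    have "norm (avg S f 0 - l) \<le> e/2" if "S \<ge> S0" for S
    proof (rule LIMSEQ_le_const2)
      show "(\<lambda>n. norm (avg S f 0 - avg (real n) f 0)) \<longlonglongrightarrow> norm (avg S f 0 - l)" by (intro tendsto_intros l)
      have "norm (avg S f 0 - avg (real n) f 0) \<le> e/2" if "n \<ge> nat \<lceil>S0\<rceil>" for n
        using S0[OF \<open>S \<ge> S0\<close>, of "real n"] that by linarith
      then show "\<exists>N. \<forall>n\<ge>N. norm (avg S f 0 - avg (real n) f 0) \<le> e/2" by blast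
    qed
    then have "dist (avg S f 0) l < e" if "S \<ge> S0" for S using that e by (force simp: dist_norm)
    then show "\<forall>\<^sub>F S in at_top. dist (avg S f 0) l < e" unfolding eventually_at_top_linorder by blast
  qed
  then show ?thesis unfolding mean_def using tendsto_Lim[OF trivial_limit_at_top_linorder] by metis
qed

lemma mean_uniform:
  fixes f :: "'a::euclidean_space \<Rightarrow> 'b::euclidean_space"
  assumes f: "ap f" and e: "e > 0"
  shows "\<forall>\<^sub>F S in at_top. \<forall>a. norm (avg S f a - mean f) \<le> e"
proof -
  have "\<forall>\<^sub>F S in at_top. \<forall>a. norm (avg S f a - avg S f 0) \<le> e/2"
    using avg_nearly_constant[OF f, of "e/2"] e by simp
  moreover have "\<forall>\<^sub>F S in at_top. dist (avg S f 0) (mean f) < e/2"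
    using tendstoD[OF mean_tendsto0[OF f], of "e/2"] e by simp
  ultimately show ?thesis
  proof eventually_elim
    case (elim S)
    then show ?case
      using norm_diff_triangle_le[of "avg S f a" "avg S f 0" "e/2" "mean f" "e/2" for a] by (auto simp: dist_norm)
  qed
qed

lemma mean_tendsto:
  fixes f :: "'a::euclidean_space \<Rightarrow> 'b::euclidean_space"
  assumes f: "ap f"
  shows "((\<lambda>S. avg S f a) \<longlongrightarrow> mean f) at_top"
proof (rule tendstoI)
  fix e :: real assume e: "e > 0"
  then have "\<forall>\<^sub>F S in at_top. \<forall>a. norm (avg S f a - mean f) \<le> e/2" using mean_uniform[OF f, of "e/2"] by simp
  then show "\<forall>\<^sub>F S in at_top. dist (avg S f a) (mean f) < e"
  proof eventually_elim
    case (elim S)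
    have "norm (avg S f a - mean f) \<le> e/2" using elim by blast
    then show ?case using e by (simp add: dist_norm)
  qed
qed

lemma meanI:
  fixes f :: "'a::euclidean_space \<Rightarrow> 'b::euclidean_space"
  assumes "((\<lambda>S. avg S f 0) \<longlongrightarrow> l) at_top"
  shows "mean f = l"
  unfolding mean_def using tendsto_Lim[OF trivial_limit_at_top_linorder assms] .

lemma mean_const [simp]: "mean (\<lambda>x::'a::euclidean_space. c) = c"
  by (rule meanI, rule tendsto_eventually)
    (use eventually_gt_at_top[of 0] in \<open>rule eventually_mono\<close>, simp add: avg_const)

lemma mean_translate:
  fixes f :: "'a::euclidean_space \<Rightarrow> 'b::euclidean_space"
  assumes "ap f"
  shows "mean (\<lambda>x. f (s + x)) = mean f" "mean (\<lambda>x. f (x + s)) = mean f"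
proof -
  have "avg S (\<lambda>x. f (s + x)) 0 = avg S f s" for S by (simp add: avg_def)
  then show "mean (\<lambda>x. f (s + x)) = mean f"
    by (intro meanI) (simp add: mean_tendsto[OF assms])
  then show "mean (\<lambda>x. f (x + s)) = mean f" by (simp add: add.commute)
qed

lemma mean_linear:
  fixes f :: "'a::euclidean_space \<Rightarrow> 'b::euclidean_space" and h :: "'b \<Rightarrow> 'c::euclidean_space"
  assumes f: "ap f" and h: "bounded_linear h"
  shows "mean (\<lambda>x. h (f x)) = h (mean f)"
proof (rule meanI)
  have "avg S (\<lambda>x. h (f x)) 0 = h (avg S f 0)" for S
    using integral_linear[OF integrable_shift_cube[OF ap_continuous[OF f], of 0 S] h]
    by (simp add: avg_def o_def linear_simps(5)[OF h])
  then show "((\<lambda>S. avg S (\<lambda>x. h (f x)) 0) \<longlongrightarrow> h (mean f)) at_top"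
    using bounded_linear.tendsto[OF h mean_tendsto[OF f]] by simp
qed

lemma mean_add:
  fixes f g :: "'a::euclidean_space \<Rightarrow> 'b::euclidean_space"
  assumes f: "ap f" and g: "ap g"
  shows "mean (\<lambda>x. f x + g x) = mean f + mean g"
proof (rule meanI)
  have "avg S (\<lambda>x. f x + g x) 0 = avg S f 0 + avg S g 0" for S
    by (simp add: avg_def integral_add integrable_shift_cube[of _ 0, simplified] ap_continuous f g scaleR_add_right)
  then show "((\<lambda>S. avg S (\<lambda>x. f x + g x) 0) \<longlongrightarrow> mean f + mean g) at_top"
    using tendsto_add[OF mean_tendsto[OF f] mean_tendsto[OF g]] by simp
qed

lemma mean_mono:
  fixes f g :: "'a::euclidean_space \<Rightarrow> real"
  assumes f: "ap f" and g: "ap g" and le: "\<And>x. f x \<le> g x"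
  shows "mean f \<le> mean g"
proof (rule tendsto_le[OF trivial_limit_at_top_linorder mean_tendsto[OF g, of 0] mean_tendsto[OF f, of 0]])
  show "\<forall>\<^sub>F S in at_top. avg S f 0 \<le> avg S g 0"
    using eventually_gt_at_top[of 0]
  proof eventually_elim
    fix S :: real assume S: "S > 0"
    have "integral (cube S) (\<lambda>t. f (0 + t)) \<le> integral (cube S) (\<lambda>t. g (0 + t))"
      by (rule integral_le) (auto intro!: integrable_shift_cube[of _ 0, simplified] ap_continuous f g le)
    then show "avg S f 0 \<le> avg S g 0" unfolding avg_def using S by (simp add: divide_right_mono)
  qed
qed

lemma norm_mean_le:
  fixes f :: "'a::euclidean_space \<Rightarrow> complex"
  assumes f: "ap f"
  shows "cmod (mean f) \<le> mean (\<lambda>x. cmod (f x))"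
proof (rule tendsto_le[OF trivial_limit_at_top_linorder mean_tendsto[OF ap_cmod[OF f], of 0] tendsto_norm[OF mean_tendsto[OF f, of 0]]])
  show "\<forall>\<^sub>F S in at_top. cmod (avg S f 0) \<le> avg S (\<lambda>x. cmod (f x)) 0"
    using eventually_gt_at_top[of 0]
  proof eventually_elim
    fix S :: real assume S: "S > 0"
    have "cmod (integral (cube S) (\<lambda>t. f (0 + t))) \<le> integral (cube S) (\<lambda>t. cmod (f (0 + t)))"
      by (rule integral_norm_bound_integral) (auto intro!: integrable_shift_cube[of _ 0, simplified] ap_continuous f ap_cmod)
    then show "cmod (avg S f 0) \<le> avg S (\<lambda>x. cmod (f x)) 0" unfolding avg_def using S by (simp add: divide_right_mono)
  qed
qed

lemma norm_mean_bound:
  fixes f :: "'a::euclidean_space \<Rightarrow> complex"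
  assumes f: "ap f" and "\<And>x. cmod (f x) \<le> B"
  shows "cmod (mean f) \<le> B"
  using norm_mean_le[OF f] mean_mono[OF ap_cmod[OF f] ap_const[of B]] assms(2) by force

text \<open>Near \<open>x0\<close> the function is bounded below, and some translate by one of finitely many points brings any given
\<open>x\<close> close to \<open>x0\<close>. So a finite sum of translates of \<open>f\<close> has a positive lower bound, and all of these
translates have the mean of \<open>f\<close>.\<close>

lemma mean_pos:
  fixes f :: "'a::euclidean_space \<Rightarrow> real"
  assumes f: "ap f" and nonneg: "\<And>x. f x \<ge> 0" and x0: "f x0 > 0"
  shows "mean f > 0"
proof -
  define e where "e = f x0 / 2"
  have e: "e > 0" using x0 by (simp add: e_def)
  obtain X where X: "finite X" "\<And>x. \<exists>y\<in>X. close_translates f e x y"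
    using ap_net[OF f e] by auto
  have ge: "e \<le> (\<Sum>y\<in>X. f (x + (x0 - y)))" for x
  proof -
    obtain y where y: "y \<in> X" "close_translates f e x y" using X by blast
    have "\<bar>f (x + (x0 - y)) - f x0\<bar> \<le> e"
      using close_translatesD[OF y(2), of "x0 - y"] by (simp add: dist_real_def)
    then have "e \<le> f (x + (x0 - y))" unfolding e_def by linarith
    also have "\<dots> \<le> (\<Sum>y\<in>X. f (x + (x0 - y)))"
      by (rule member_le_sum) (use y X nonneg in auto)
    finally show ?thesis .
  qed
  have sum: "ap (\<lambda>x. \<Sum>y\<in>Y. f (x + (x0 - y))) \<and> mean (\<lambda>x. \<Sum>y\<in>Y. f (x + (x0 - y))) = card Y * mean f"
    if "finite Y" for Y
    using that
  proof induction
    case empty then show ?case by (simp add: ap_const)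
  next
    case (insert y Y)
    have a: "ap (\<lambda>x. f (x + (x0 - y)))" by (rule ap_translate[OF f])
    have "ap (\<lambda>x. f (x + (x0 - y)) + (\<Sum>y\<in>Y. f (x + (x0 - y))))"
      using ap_map2[OF a conjunct1[OF insert.IH], of "\<lambda>(u,v). u + v"]
      by (simp add: case_prod_unfold continuous_intros)
    moreover have "mean (\<lambda>x. f (x + (x0 - y)) + (\<Sum>y\<in>Y. f (x + (x0 - y)))) = mean f + card Y * mean f"
      using mean_add[OF a conjunct1[OF insert.IH]] insert.IH mean_translate(2)[OF f] by simp
    ultimately show ?case using insert by (simp add: algebra_simps)
  qed
  have "e \<le> card X * mean f"
    using mean_mono[OF ap_const[of e] conjunct1[OF sum[OF X(1)]]] ge sum[OF X(1)] by simp
  then have "0 < card X * mean f" using e by linarith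
  then show ?thesis by (simp add: zero_less_mult_iff)
qed

context
  fixes f :: "'a::euclidean_space \<Rightarrow> complex"
  assumes f: "ap f"
begin

lemma mean_cmult: "mean (\<lambda>x. c * f x) = c * mean f" "mean (\<lambda>x. f x * c) = mean f * c"
  using mean_linear[OF f bounded_linear_mult_right[of c]] mean_linear[OF f bounded_linear_mult_left[of c]] by auto

lemma mean_cnj: "mean (\<lambda>x. cnj (f x)) = cnj (mean f)"
  by (rule mean_linear[OF f bounded_linear_cnj])

lemma mean_minus: "mean (\<lambda>x. - f x) = - mean f"
  using mean_linear[OF f bounded_linear_minus[OF bounded_linear_ident]] by simp

lemma mean_Re: "mean (\<lambda>x. Re (f x)) = Re (mean f)"
  by (rule mean_linear[OF f bounded_linear_Re])

end

lemma mean_diff: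
  fixes f g :: "'a::euclidean_space \<Rightarrow> complex"
  assumes "ap f" "ap g" shows "mean (\<lambda>x. f x - g x) = mean f - mean g"
  using mean_add[OF assms(1) ap_minus[OF assms(2)]] mean_minus[OF assms(2)] by simp

lemma mean_of_real:
  fixes f :: "'a::euclidean_space \<Rightarrow> real"
  assumes "ap f" shows "mean (\<lambda>x. of_real (f x) :: complex) = of_real (mean f)"
  by (rule mean_linear[OF assms bounded_linear_of_real])

lemma mean_sum:
  fixes f :: "'i \<Rightarrow> 'a::euclidean_space \<Rightarrow> complex"
  assumes "\<And>i. i \<in> I \<Longrightarrow> ap (f i)"
  shows "mean (\<lambda>x. \<Sum>i\<in>I. f i x) = (\<Sum>i\<in>I. mean (f i))"
  using assms
  by (induction I rule: infinite_finite_induct) (simp_all add: mean_add ap_sum)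

lemma mean_close:
  fixes f g :: "'a::euclidean_space \<Rightarrow> complex"
  assumes "ap f" "ap g" "\<And>x. cmod (f x - g x) \<le> e"
  shows "cmod (mean f - mean g) \<le> e"
  using norm_mean_bound[OF ap_diff[OF assms(1,2)] assms(3)] mean_diff[OF assms(1,2)] by simp

text \<open>Total boundedness of a family of functions in the supremum norm.\<close>

definition finite_nets :: "('a \<Rightarrow> complex) set \<Rightarrow> bool" where
  "finite_nets H \<longleftrightarrow> (\<forall>e>0. \<exists>J. finite J \<and> J \<subseteq> H \<and> (\<forall>h\<in>H. \<exists>j\<in>J. \<forall>x. cmod (h x - j x) \<le> e))"

lemma sum_group_tags:
  fixes g :: "'x \<Rightarrow> 'z::real_vector"
  assumes "finite D"
  shows "(\<Sum>x\<in>fst ` D. ((\<Sum>p\<in>{p\<in>D. fst p = x}. w (snd p)) / K) *\<^sub>R g x) = (\<Sum>(x,k)\<in>D. w k *\<^sub>R g x) /\<^sub>R K"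
proof -
  have "(\<Sum>(x,k)\<in>D. w k *\<^sub>R g x) = (\<Sum>x\<in>fst ` D. \<Sum>p\<in>{p\<in>D. fst p = x}. w (snd p) *\<^sub>R g (fst p))"
    unfolding case_prod_unfold by (rule sum.image_gen[OF assms])
  also have "\<dots> = (\<Sum>x\<in>fst ` D. (\<Sum>p\<in>{p\<in>D. fst p = x}. w (snd p)) *\<^sub>R g x)"
    by (intro sum.cong refl) (simp add: scaleR_sum_left)
  finally show ?thesis by (simp add: scaleR_sum_right divide_inverse mult.commute)
qed

text \<open>The points are the tags of one division of a large cube, fine enough for all members of \<open>H\<close>; the weights are the relative
volumes of the cells.\<close>

lemma mean_finite_approx:
  fixes H :: "('a::euclidean_space \<Rightarrow> complex) set"
  assumes fin: "finite H" and ap: "\<And>h. h \<in> H \<Longrightarrow> ap h" and e: "e > 0"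
  shows "\<exists>X c. finite X \<and> (\<forall>x\<in>X. 0 \<le> c x) \<and> (\<Sum>x\<in>X. c x) = (1::real) \<and>
           (\<forall>h\<in>H. cmod (mean h - (\<Sum>x\<in>X. c x *\<^sub>R h x)) \<le> e)"
proof -
  have "\<forall>h\<in>H. \<forall>\<^sub>F S in at_top. \<forall>a. norm (avg S h a - mean h) \<le> e/2"
    using mean_uniform ap e by (metis half_gt_zero)
  then have "\<forall>\<^sub>F S in at_top. 0 < S \<and> (\<forall>h\<in>H. \<forall>a. norm (avg S h a - mean h) \<le> e/2)"
    by (intro eventually_conj eventually_gt_at_top) (simp add: eventually_ball_finite_distrib fin)
  then obtain S where S: "S > 0" "\<And>h. h \<in> H \<Longrightarrow> norm (avg S h 0 - mean h) \<le> e/2"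
    by (auto dest: eventually_happens'[OF trivial_limit_at_top_linorder])
  define K where "K = (2 * S) ^ DIM('a)"
  have K: "K > 0" "measure lborel (cube S :: 'a set) = K"
    using S(1) measure_cube[OF less_imp_le[OF S(1)], where 'a = 'a] by (simp add: K_def, simp only: K_def)
  have "\<exists>\<gamma>. gauge \<gamma> \<and> (\<forall>D. D tagged_division_of (cube S) \<and> \<gamma> fine D \<longrightarrow>
      norm ((\<Sum>(x,k)\<in>D. measure lborel k *\<^sub>R h x) - integral (cube S) h) < e/2 * K)" if "h \<in> H" for h
  proof -
    have "(h has_integral integral (cube S) h) (cube S)"
      using integrable_shift_cube[OF ap_continuous[OF ap[OF that]], of 0 S] by (simp add: integrable_integral)
    moreover have "e/2 * K > 0" using e K by simp
    ultimately show ?thesis unfolding has_integral by blast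
  qed
  then have "\<forall>h\<in>H. \<exists>\<gamma>. gauge \<gamma> \<and> (\<forall>D. D tagged_division_of (cube S) \<and> \<gamma> fine D \<longrightarrow>
      norm ((\<Sum>(x,k)\<in>D. measure lborel k *\<^sub>R h x) - integral (cube S) h) < e/2 * K)" by blast
  from bchoice[OF this] obtain \<gamma> where \<gamma>: "\<And>h. h \<in> H \<Longrightarrow> gauge (\<gamma> h)"
      "\<And>h D. h \<in> H \<Longrightarrow> D tagged_division_of (cube S) \<Longrightarrow> \<gamma> h fine D \<Longrightarrow>
        norm ((\<Sum>(x,k)\<in>D. measure lborel k *\<^sub>R h x) - integral (cube S) h) < e/2 * K"
    by blast
  obtain D where D: "D tagged_division_of (cube S)" "(\<lambda>x. \<Inter>{\<gamma> h x |h. h \<in> H}) fine D"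
    using fine_division_exists[OF gauge_Inter[OF fin, of \<gamma>], of "- (S *\<^sub>R One)" "S *\<^sub>R One"] \<gamma>(1) by blast
  have finD: "finite D" using D(1) by blast
  define c where "c x = (\<Sum>p\<in>{p\<in>D. fst p = x}. measure lborel (snd p)) / K" for x
  note sumc = sum_group_tags[OF finD, where w = "measure lborel" and K = K, folded c_def]
  show ?thesis
  proof (intro exI[of _ "fst ` D"] exI[of _ c] conjI ballI)
    show "finite (fst ` D)" using finD by simp
    show "0 \<le> c x" for x unfolding c_def using K by (intro divide_nonneg_pos sum_nonneg) auto
    show "(\<Sum>x\<in>fst ` D. c x) = 1"
      using sumc[of "\<lambda>x. 1::real"] additive_content_tagged_division[OF D(1), unfolded K(2)] K(1)
      by (simp add: case_prod_unfold)
    fix h assume h: "h \<in> H"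
    have "\<gamma> h fine D" using D(2) h unfolding fine_Inter by blast
    then have "norm ((\<Sum>(x,k)\<in>D. measure lborel k *\<^sub>R h x) - integral (cube S) h) \<le> e/2 * K"
      using \<gamma>(2)[OF h D(1)] by simp
    then have "norm (((\<Sum>(x,k)\<in>D. measure lborel k *\<^sub>R h x) - integral (cube S) h) /\<^sub>R K) \<le> e/2"
      by (rule norm_scaled_le[OF K(1)])
    then have "norm ((\<Sum>x\<in>fst ` D. c x *\<^sub>R h x) - avg S h 0) \<le> e/2"
      unfolding sumc avg_def K_def by (simp add: scaleR_diff_right)
    then show "cmod (mean h - (\<Sum>x\<in>fst ` D. c x *\<^sub>R h x)) \<le> e"
      using S(2)[OF h] norm_diff_triangle_le[of "\<Sum>x\<in>fst ` D. c x *\<^sub>R h x" "avg S h 0" "e/2" "mean h" "e/2"]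
      by (simp add: norm_minus_commute)
  qed
qed

text \<open>Finite convex combinations of point values commute with all linear operations and keep holomorphic
dependence on a parameter. This lemma transfers such properties to the mean.\<close>

lemma mean_uniform_approx:
  fixes H :: "('a::euclidean_space \<Rightarrow> complex) set"
  assumes nets: "finite_nets H" and ap: "\<And>h. h \<in> H \<Longrightarrow> ap h" and e: "e > 0"
  shows "\<exists>X c. finite X \<and> (\<forall>x\<in>X. 0 \<le> c x) \<and> (\<Sum>x\<in>X. c x) = (1::real) \<and>
           (\<forall>h\<in>H. cmod (mean h - (\<Sum>x\<in>X. c x *\<^sub>R h x)) \<le> e)"
proof -
  obtain J where J: "finite J" "J \<subseteq> H" "\<And>h. h \<in> H \<Longrightarrow> \<exists>j\<in>J. \<forall>x. cmod (h x - j x) \<le> e/3"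
    using nets e unfolding finite_nets_def by (elim allE[of _ "e/3"]) auto
  obtain X c where Xc: "finite X" "\<forall>x\<in>X. 0 \<le> c x" "(\<Sum>x\<in>X. c x) = (1::real)"
      "\<And>h. h \<in> J \<Longrightarrow> cmod (mean h - (\<Sum>x\<in>X. c x *\<^sub>R h x)) \<le> e/3"
  proof -
    have "e/3 > 0" "\<And>h. h \<in> J \<Longrightarrow> ap h" using e ap J(2) by auto
    from mean_finite_approx[OF J(1) this(2,1)] that show ?thesis by blast
  qed
  have "cmod (mean h - (\<Sum>x\<in>X. c x *\<^sub>R h x)) \<le> e" if h: "h \<in> H" for h
  proof -
    obtain j where j: "j \<in> J" "\<And>x. cmod (h x - j x) \<le> e/3" using J(3)[OF h] by blast
    have a: "cmod (mean h - mean j) \<le> e/3" by (rule mean_close) (use ap h j J(2) in auto)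
    have "cmod ((\<Sum>x\<in>X. c x *\<^sub>R j x) - (\<Sum>x\<in>X. c x *\<^sub>R h x)) \<le> (\<Sum>x\<in>X. c x * (e/3))"
      unfolding sum_subtractf[symmetric] scaleR_diff_right[symmetric]
    proof (rule sum_norm_le)
      fix x assume "x \<in> X"
      then have "c x * cmod (j x - h x) \<le> c x * (e/3)"
        using Xc(2) j(2)[of x] by (intro mult_left_mono) (auto simp: norm_minus_commute)
      then show "norm (c x *\<^sub>R (j x - h x)) \<le> c x * (e/3)" using Xc(2) \<open>x \<in> X\<close> by simp
    qed
    also have "\<dots> = e/3" using Xc(3) by (simp add: sum_distrib_right[symmetric] sum_divide_distrib[symmetric])
    finally show ?thesis
      using a Xc(4)[OF j(1)] norm_triangle_le[of "mean h - mean j" "mean j - (\<Sum>x\<in>X. c x *\<^sub>R j x)" "e/3 + e/3"]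
        norm_triangle_le[of "mean h - (\<Sum>x\<in>X. c x *\<^sub>R j x)" "(\<Sum>x\<in>X. c x *\<^sub>R j x) - (\<Sum>x\<in>X. c x *\<^sub>R h x)" e]
      by simp
  qed
  with Xc show ?thesis by blast
qed

text \<open>A convolution with the sign of one argument changed. In this form no reflections appear: the
adjoint of \<open>u \<mapsto> corr f u\<close> is again a correlation (\<open>corr_adjoint\<close>), and the product of the two
operators commutes with translations (\<open>corr_op_translate\<close>).\<close>

definition corr :: "('a::euclidean_space \<Rightarrow> complex) \<Rightarrow> ('a \<Rightarrow> complex) \<Rightarrow> 'a \<Rightarrow> complex" where
  "corr g b x = mean (\<lambda>t. g (x + t) * b t)"

lemma corr_close:
  assumes g: "ap g" and b: "ap b" and cl: "close_translates g d x y"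
  shows "cmod (corr g b x - corr g b y) \<le> d * mean (\<lambda>t. cmod (b t))"
proof -
  have "corr g b x - corr g b y = mean (\<lambda>t. g (x + t) * b t - g (y + t) * b t)"
    unfolding corr_def by (subst mean_diff) (auto intro!: ap_intros g b)
  also have "cmod \<dots> \<le> mean (\<lambda>t. cmod (g (x + t) * b t - g (y + t) * b t))"
    by (rule norm_mean_le) (auto intro!: ap_intros g b)
  also have "\<dots> \<le> mean (\<lambda>t. d * cmod (b t))"
  proof (rule mean_mono)
    show "ap (\<lambda>t. d * cmod (b t))"
      by (rule ap_compose_UNIV[OF ap_cmod[OF b]]) (intro continuous_intros)
    show "cmod (g (x + t) * b t - g (y + t) * b t) \<le> d * cmod (b t)" for t
      using close_translatesD[OF cl, of t]
      by (simp add: left_diff_distrib[symmetric] norm_mult dist_norm mult_right_mono)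
  qed (auto intro!: ap_intros g b)
  also have "\<dots> = d * mean (\<lambda>t. cmod (b t))"
    by (rule mean_linear[OF ap_cmod[OF b] bounded_linear_mult_right])
  finally show ?thesis .
qed

lemma corr_bound:
  assumes g: "ap g" and b: "ap b" and B: "\<And>x. cmod (g x) \<le> B"
  shows "cmod (corr g b x) \<le> B * mean (\<lambda>t. cmod (b t))"
proof -
  have "cmod (corr g b x) \<le> mean (\<lambda>t. cmod (g (x + t) * b t))"
    unfolding corr_def by (rule norm_mean_le) (auto intro!: ap_intros g b)
  also have "\<dots> \<le> mean (\<lambda>t. B * cmod (b t))"
  proof (rule mean_mono)
    show "ap (\<lambda>t. B * cmod (b t))"
      by (rule ap_compose_UNIV[OF ap_cmod[OF b]]) (intro continuous_intros)
    show "cmod (g (x + t) * b t) \<le> B * cmod (b t)" for t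
      using B by (simp add: norm_mult mult_right_mono)
  qed (auto intro!: ap_intros g b)
  also have "\<dots> = B * mean (\<lambda>t. cmod (b t))"
    by (rule mean_linear[OF ap_cmod[OF b] bounded_linear_mult_right])
  finally show ?thesis .
qed

lemma mean_cmod_nonneg: "ap b \<Longrightarrow> 0 \<le> mean (\<lambda>t::'a::euclidean_space. cmod (b t))"
  using mean_mono[OF ap_const[of 0] ap_cmod[of b]] by simp

lemma ap_corr [ap_intros]:
  assumes g: "ap g" and b: "ap b"
  shows "ap (corr g b)"
proof (rule ap_dominated[OF g], unfold dominated_def, intro allI impI)
  fix e :: real assume e: "e > 0"
  define m where "m = mean (\<lambda>t. cmod (b t)) + 1"
  have m: "m > 0" using mean_cmod_nonneg[OF b] by (simp add: m_def)
  show "\<exists>d>0. \<forall>x y. close_translates g d x y \<longrightarrow> dist (corr g b x) (corr g b y) \<le> e"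
  proof (intro exI[of _ "e/m"] conjI allI impI)
    fix x y assume "close_translates g (e/m) x y"
    then have "cmod (corr g b x - corr g b y) \<le> e/m * mean (\<lambda>t. cmod (b t))" by (rule corr_close[OF g b])
    also have "\<dots> \<le> e/m * m" using e m by (intro mult_left_mono) (auto simp: m_def)
    finally show "dist (corr g b x) (corr g b y) \<le> e" using m by (simp add: dist_norm)
  qed (use e m in auto)
qed

lemma finite_nets_translates:
  assumes g: "ap g" and b: "ap b"
  shows "finite_nets (range (\<lambda>x t. g (x + t) * b t))"
  unfolding finite_nets_def
proof (intro allI impI)
  fix e :: real assume e: "e > 0"
  obtain B where B: "B > 0" "\<And>x. cmod (b x) \<le> B" using ap_bounded[OF b] by blast
  obtain X where X: "finite X" "\<And>x. \<exists>y\<in>X. close_translates g (e/B) x y"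
    using ap_net[OF g, of "e/B"] e B(1) by auto
  have "\<exists>y\<in>X. \<forall>t. cmod (g (x + t) * b t - g (y + t) * b t) \<le> e" for x
  proof -
    obtain y where y: "y \<in> X" "close_translates g (e/B) x y" using X by blast
    have "cmod (g (x + t) * b t - g (y + t) * b t) \<le> e" for t
    proof -
      have "cmod (g (x + t) * b t - g (y + t) * b t) = cmod (g (x + t) - g (y + t)) * cmod (b t)"
        by (simp add: left_diff_distrib[symmetric] norm_mult)
      also have "\<dots> \<le> e/B * B" using close_translatesD[OF y(2), of t] B e
        by (intro mult_mono) (auto simp: dist_norm)
      finally show ?thesis using B by simp
    qed
    with y show ?thesis by blast
  qed
  then show "\<exists>J. finite J \<and> J \<subseteq> range (\<lambda>x t. g (x + t) * b t) \<and>
      (\<forall>h\<in>range (\<lambda>x t. g (x + t) * b t). \<exists>j\<in>J. \<forall>x. cmod (h x - j x) \<le> e)"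
    using X(1) by (intro exI[of _ "(\<lambda>x t. g (x + t) * b t) ` X"] conjI finite_imageI image_mono subset_UNIV) simp_all
qed

lemma finite_nets_insert:
  assumes "finite_nets H" shows "finite_nets (insert h H)"
  unfolding finite_nets_def
proof (intro allI impI)
  fix e :: real assume e: "e > 0"
  from assms[unfolded finite_nets_def, rule_format, OF e]
  obtain J where J: "finite J" "J \<subseteq> H" "\<forall>h\<in>H. \<exists>j\<in>J. \<forall>x. cmod (h x - j x) \<le> e"
    by (elim exE conjE)
  show "\<exists>J. finite J \<and> J \<subseteq> insert h H \<and> (\<forall>h\<in>insert h H. \<exists>j\<in>J. \<forall>x. cmod (h x - j x) \<le> e)"
  proof (intro exI conjI ballI)
    fix k assume "k \<in> insert h H"
    then consider "k = h" | "k \<in> H" by blast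
    then show "\<exists>j\<in>insert h J. \<forall>x. cmod (k x - j x) \<le> e"
    proof cases
      case 1
      then have "\<forall>x. cmod (k x - h x) \<le> e" using e by simp
      then show ?thesis by blast
    next
      case 2
      then show ?thesis using J(3) by blast
    qed
  qed (use J in auto)
qed

text \<open>An exchange of two means. One finite convex combination over \<open>t\<close> approximates \<open>corr g b s\<close> for all \<open>s\<close>
at once as well as the mean on the right; for the finite sum the exchange is
linearity of the mean.\<close>

lemma mean_corr_swap:
  assumes a: "ap a" and g: "ap g" and b: "ap b"
  shows "mean (\<lambda>s. a s * corr g b s) = mean (\<lambda>t. b t * corr g a t)"
proof -
  obtain A where A: "A > 0" "\<And>x. cmod (a x) \<le> A" using ap_bounded[OF a] by blast
  let ?h = "\<lambda>t. b t * corr g a t"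
  have *: "cmod (mean (\<lambda>s. a s * corr g b s) - mean ?h) \<le> e * (A + 1)" if e: "e > 0" for e
  proof -
    have "finite_nets (insert ?h (range (\<lambda>x t. g (x + t) * b t)))"
      by (intro finite_nets_insert finite_nets_translates g b)
    moreover have "\<And>h. h \<in> insert ?h (range (\<lambda>x t. g (x + t) * b t)) \<Longrightarrow> ap h"
      by (auto intro!: ap_intros a b g)
    ultimately obtain X c where Xc: "finite X" "\<forall>x\<in>X. 0 \<le> c x" "(\<Sum>x\<in>X. c x) = (1::real)"
      "\<And>h. h \<in> insert ?h (range (\<lambda>x t. g (x + t) * b t)) \<Longrightarrow> cmod (mean h - (\<Sum>x\<in>X. c x *\<^sub>R h x)) \<le> e"
      using mean_uniform_approx[OF _ _ e, of "insert ?h (range (\<lambda>x t. g (x + t) * b t))"] by blast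
    have 1: "cmod (mean ?h - (\<Sum>t\<in>X. c t *\<^sub>R ?h t)) \<le> e" using Xc(4)[of ?h] by simp
    have 2: "cmod (corr g b s - (\<Sum>t\<in>X. c t *\<^sub>R (g (s + t) * b t))) \<le> e" for s
      using Xc(4)[of "\<lambda>t. g (s + t) * b t"] unfolding corr_def by blast
    have api: "ap (\<lambda>s. a s * (c t *\<^sub>R (g (s + t) * b t)))" for t
      unfolding scaleR_conv_of_real by (intro ap_intros a g)
    have "mean (\<lambda>s. a s * (\<Sum>t\<in>X. c t *\<^sub>R (g (s + t) * b t))) = (\<Sum>t\<in>X. mean (\<lambda>s. a s * (c t *\<^sub>R (g (s + t) * b t))))"
      unfolding sum_distrib_left by (rule mean_sum[OF api])
    also have "\<dots> = (\<Sum>t\<in>X. c t *\<^sub>R ?h t)"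
    proof (intro sum.cong refl)
      fix t
      have "mean (\<lambda>s. a s * (c t *\<^sub>R (g (s + t) * b t))) = mean (\<lambda>s. (of_real (c t) * b t) * (g (t + s) * a s))"
        by (simp add: scaleR_conv_of_real algebra_simps)
      also have "\<dots> = (of_real (c t) * b t) * corr g a t"
        unfolding corr_def by (rule mean_cmult) (auto intro!: ap_intros g a)
      finally show "mean (\<lambda>s. a s * (c t *\<^sub>R (g (s + t) * b t))) = c t *\<^sub>R ?h t"
        by (simp add: scaleR_conv_of_real)
    qed
    finally have 3: "mean (\<lambda>s. a s * (\<Sum>t\<in>X. c t *\<^sub>R (g (s + t) * b t))) = (\<Sum>t\<in>X. c t *\<^sub>R ?h t)" .
    have "cmod (mean (\<lambda>s. a s * corr g b s) - mean (\<lambda>s. a s * (\<Sum>t\<in>X. c t *\<^sub>R (g (s + t) * b t)))) \<le> A * e"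
    proof (rule mean_close)
      show "ap (\<lambda>s. a s * (\<Sum>t\<in>X. c t *\<^sub>R (g (s + t) * b t)))"
        unfolding sum_distrib_left by (rule ap_sum[OF api])
      show "cmod (a x * corr g b x - a x * (\<Sum>t\<in>X. c t *\<^sub>R (g (x + t) * b t))) \<le> A * e" for x
        unfolding right_diff_distrib[symmetric] norm_mult by (intro mult_mono A 2) (use A in auto)
    qed (intro ap_intros a g b)
    then have "cmod (mean (\<lambda>s. a s * corr g b s) - mean ?h) \<le> A * e + e"
      unfolding 3 by (rule norm_diff_triangle_le) (use 1 in \<open>simp add: norm_minus_commute\<close>)
    then show ?thesis by (simp add: algebra_simps)
  qed
  have "cmod (mean (\<lambda>s. a s * corr g b s) - mean ?h) \<le> 0 + e" if "e > 0" for e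
  proof -
    have "e / (A + 1) > 0" using that A(1) by simp
    moreover have "e / (A + 1) * (A + 1) = 0 + e" using A(1) by simp
    ultimately show ?thesis using *[of "e / (A + 1)"] by simp
  qed
  then have "cmod (mean (\<lambda>s. a s * corr g b s) - mean ?h) \<le> 0" by (rule field_le_epsilon)
  then show ?thesis by simp
qed

section \<open>The mean square and Fourier coefficients\<close>

definition mean_sq :: "('a::euclidean_space \<Rightarrow> complex) \<Rightarrow> real" where
  "mean_sq u = mean (\<lambda>x. (cmod (u x))\<^sup>2)"

definition mean_inner :: "('a::euclidean_space \<Rightarrow> complex) \<Rightarrow> ('a \<Rightarrow> complex) \<Rightarrow> complex" where
  "mean_inner u v = mean (\<lambda>x. u x * cnj (v x))"

definition fourier :: "('a::euclidean_space \<Rightarrow> complex) \<Rightarrow> 'a \<Rightarrow> complex" where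
  "fourier f l = mean (\<lambda>x. f x * cis (- (x \<bullet> l)))"

lemma of_real_cmod_square: "(complex_of_real (cmod z))\<^sup>2 = z * cnj z"
  using complex_norm_square[of z] by simp

lemma ap_cmod_sq:
  fixes u :: "'a::euclidean_space \<Rightarrow> complex"
  assumes "ap u" shows "ap (\<lambda>x. (cmod (u x))\<^sup>2)"
  by (rule ap_compose_UNIV[OF assms]) (intro continuous_intros)

lemma mean_inner_self: "ap u \<Longrightarrow> mean_inner u u = of_real (mean_sq u)"
  unfolding mean_inner_def mean_sq_def
  by (subst mean_of_real[symmetric]) (auto intro: ap_cmod_sq simp: of_real_cmod_square)

lemma mean_sq_nonneg: "ap u \<Longrightarrow> mean_sq u \<ge> 0"
  unfolding mean_sq_def using mean_mono[OF ap_const[of 0] ap_cmod_sq[of u]] by simp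

lemma mean_sq_pos: "ap u \<Longrightarrow> u x \<noteq> 0 \<Longrightarrow> mean_sq u > 0"
  unfolding mean_sq_def by (rule mean_pos[where ?x0.0 = x]) (auto intro: ap_cmod_sq)

lemma mean_sq_bound:
  assumes "ap u" "\<And>x. cmod (u x) \<le> B" shows "mean_sq u \<le> B\<^sup>2"
  unfolding mean_sq_def using mean_mono[OF ap_cmod_sq[OF assms(1)] ap_const[of "B\<^sup>2"]] assms(2)
  by (simp add: power_mono)

lemma mean_sq_translate: "ap u \<Longrightarrow> mean_sq (\<lambda>x. u (x + s)) = mean_sq u"
  unfolding mean_sq_def using mean_translate(2)[OF ap_cmod_sq[of u], of s] by simp

lemma mean_inner_cnj: "ap u \<Longrightarrow> ap v \<Longrightarrow> mean_inner v u = cnj (mean_inner u v)"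
  unfolding mean_inner_def by (subst mean_cnj[symmetric]) (auto intro!: ap_intros simp: mult.commute)

lemma mean_sq_cmult:
  assumes "ap u" shows "mean_sq (\<lambda>x. c * u x) = (cmod c)\<^sup>2 * mean_sq u"
  unfolding mean_sq_def norm_mult power_mult_distrib
  by (rule mean_linear[OF ap_cmod_sq[OF assms] bounded_linear_mult_right])

lemma mean_sq_lincomb:
  assumes u: "ap u" and v: "ap v"
  shows "mean_sq (\<lambda>x. u x + c * v x) = mean_sq u + 2 * Re (cnj c * mean_inner u v) + (cmod c)\<^sup>2 * mean_sq v"
proof -
  have "of_real (mean_sq (\<lambda>x. u x + c * v x)) = mean (\<lambda>x. (u x + c * v x) * cnj (u x + c * v x))"
    by (subst mean_inner_self[symmetric]) (auto intro!: ap_intros u v simp: mean_inner_def)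
  also have "\<dots> = mean (\<lambda>x. u x * cnj (u x) + (cnj c * (u x * cnj (v x)) + (c * (v x * cnj (u x)) + c * cnj c * (v x * cnj (v x)))))"
    by (simp add: algebra_simps)
  also have "\<dots> = mean_inner u u + (cnj c * mean_inner u v + (c * mean_inner v u + c * cnj c * mean_inner v v))"
    unfolding mean_inner_def by (simp add: mean_add mean_cmult ap_intros u v)
  also have "\<dots> = of_real (mean_sq u) + (cnj c * mean_inner u v + cnj (cnj c * mean_inner u v)) + of_real ((cmod c)\<^sup>2) * of_real (mean_sq v)"
    using mean_inner_self[OF u] mean_inner_self[OF v] mean_inner_cnj[OF u v] by (simp add: of_real_cmod_square)
  also have "\<dots> = of_real (mean_sq u + 2 * Re (cnj c * mean_inner u v) + (cmod c)\<^sup>2 * mean_sq v)"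
    by (simp only: complex_add_cnj of_real_add of_real_mult)
  finally show ?thesis by (simp only: of_real_eq_iff)
qed

lemma mean_inner_Cauchy_Schwarz:
  assumes u: "ap u" and v: "ap v"
  shows "(cmod (mean_inner u v))\<^sup>2 \<le> mean_sq u * mean_sq v"
proof (cases "\<forall>x. v x = 0")
  case True
  then show ?thesis by (simp add: mean_inner_def mean_sq_def)
next
  case False
  then have pos: "mean_sq v > 0" using mean_sq_pos[OF v] by blast
  define c where "c = - (mean_inner u v / of_real (mean_sq v))"
  have c: "cnj c * mean_inner u v = of_real (- ((cmod (mean_inner u v))\<^sup>2 / mean_sq v))"
    by (simp add: c_def of_real_cmod_square mult.commute)
  have cc: "(cmod c)\<^sup>2 * mean_sq v = (cmod (mean_inner u v))\<^sup>2 / mean_sq v"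
    using pos by (simp add: c_def norm_divide power_divide power2_eq_square)
  have "0 \<le> mean_sq (\<lambda>x. u x + c * v x)" by (intro mean_sq_nonneg ap_intros u v)
  also have "\<dots> = mean_sq u - (cmod (mean_inner u v))\<^sup>2 / mean_sq v"
    unfolding mean_sq_lincomb[OF u v] c cc by simp
  finally show ?thesis using pos by (simp add: field_simps)
qed

lemma mean_cmod_le_sqrt_mean_sq:
  assumes u: "ap (u :: 'a::euclidean_space \<Rightarrow> complex)" shows "mean (\<lambda>x. cmod (u x)) \<le> sqrt (mean_sq u)"
proof (rule real_le_rsqrt)
  have a: "ap (\<lambda>x. of_real (cmod (u x)) :: complex)" by (intro ap_of_real ap_cmod u)
  have "mean_inner (\<lambda>x. of_real (cmod (u x))) (\<lambda>x. 1) = of_real (mean (\<lambda>x. cmod (u x)))"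
    unfolding mean_inner_def using mean_of_real[OF ap_cmod[OF u]] by simp
  moreover have "mean_sq (\<lambda>x. of_real (cmod (u x))) = mean_sq u" "mean_sq (\<lambda>x::'a. 1) = 1"
    by (simp_all add: mean_sq_def)
  ultimately show "(mean (\<lambda>x. cmod (u x)))\<^sup>2 \<le> mean_sq u"
    using mean_inner_Cauchy_Schwarz[OF a ap_const[of 1]] by simp
qed

lemma corr_bound_mean_sq:
  assumes g: "ap g" and b: "ap b" and B: "\<And>x. cmod (g x) \<le> B"
  shows "cmod (corr g b x) \<le> B * sqrt (mean_sq b)"
proof -
  have "0 \<le> B" using B[of 0] norm_ge_zero order_trans by blast
  then show ?thesis
    using corr_bound[OF g b B, of x] mean_cmod_le_sqrt_mean_sq[OF b] by (meson mult_left_mono order_trans)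
qed

lemma corr_close_mean_sq:
  assumes g: "ap g" and b: "ap b" and cl: "close_translates g d x y"
  shows "cmod (corr g b x - corr g b y) \<le> d * sqrt (mean_sq b)"
proof -
  have "0 \<le> d" using close_translatesD[OF cl, of 0] zero_le_dist order_trans by blast
  then show ?thesis
    using corr_close[OF g b cl] mean_cmod_le_sqrt_mean_sq[OF b] by (meson mult_left_mono order_trans)
qed

lemma corr_lincomb:
  assumes g: "ap g" and u: "ap u" and v: "ap v"
  shows "corr g (\<lambda>t. u t + c * v t) x = corr g u x + c * corr g v x"
proof -
  have "corr g (\<lambda>t. u t + c * v t) x = mean (\<lambda>t. g (x + t) * u t + c * (g (x + t) * v t))"
    unfolding corr_def by (simp add: algebra_simps)
  also have "\<dots> = corr g u x + c * corr g v x"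
    unfolding corr_def by (simp add: mean_add mean_cmult ap_intros g u v)
  finally show ?thesis .
qed

lemma corr_translate:
  assumes g: "ap g" and u: "ap u"
  shows "corr g (\<lambda>t. u (t + s)) x = corr g u (x - s)"
proof -
  have "ap (\<lambda>t. g (x - s + t) * u t)" by (intro ap_intros g u)
  from mean_translate(2)[OF this, of s] show ?thesis
    unfolding corr_def by (simp add: algebra_simps)
qed

lemma corr_adjoint:
  assumes f: "ap f" and u: "ap u" and v: "ap v"
  shows "mean_inner (corr f u) v = mean_inner u (corr (\<lambda>x. cnj (f x)) v)"
proof -
  have c: "corr f (\<lambda>x. cnj (v x)) t = cnj (corr (\<lambda>x. cnj (f x)) v t)" for t
    unfolding corr_def by (subst mean_cnj[symmetric]) (auto intro!: ap_intros f v)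
  have "mean_inner (corr f u) v = mean (\<lambda>s. cnj (v s) * corr f u s)"
    unfolding mean_inner_def by (simp add: mult.commute)
  also have "\<dots> = mean (\<lambda>t. u t * corr f (\<lambda>x. cnj (v x)) t)"
    by (rule mean_corr_swap[OF ap_cnj[OF v] f u])
  finally show ?thesis unfolding c mean_inner_def .
qed

lemma corr_cis:
  assumes g: "ap g"
  shows "corr g (\<lambda>x. cis (- (x \<bullet> l))) t = cis (t \<bullet> l) * fourier g l"
proof -
  have "corr g (\<lambda>x. cis (- (x \<bullet> l))) t = mean (\<lambda>x. cis (t \<bullet> l) * (g (t + x) * cis (- ((t + x) \<bullet> l))))"
    unfolding corr_def
  proof (intro arg_cong[where f = mean] ext)
    fix x
    have "cis (- (x \<bullet> l)) = cis (t \<bullet> l) * cis (- ((t + x) \<bullet> l))"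
      by (simp add: cis_mult inner_add_left)
    then show "g (t + x) * cis (- (x \<bullet> l)) = cis (t \<bullet> l) * (g (t + x) * cis (- ((t + x) \<bullet> l)))" by simp
  qed
  also have "\<dots> = cis (t \<bullet> l) * mean (\<lambda>x. g (t + x) * cis (- ((t + x) \<bullet> l)))"
    by (rule mean_cmult) (rule ap_translate(2)[of "\<lambda>x. g x * cis (- (x \<bullet> l))"], intro ap_intros g)
  also have "mean (\<lambda>x. g (t + x) * cis (- ((t + x) \<bullet> l))) = fourier g l"
    unfolding fourier_def by (rule mean_translate(1)) (intro ap_intros g)
  finally show ?thesis .
qed

lemma fourier_corr:
  assumes g: "ap g" and b: "ap b"
  shows "fourier (corr g b) l = fourier g l * fourier b (- l)"
proof -
  have "fourier (corr g b) l = mean (\<lambda>s. cis (- (s \<bullet> l)) * corr g b s)"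
    unfolding fourier_def by (simp add: mult.commute)
  also have "\<dots> = mean (\<lambda>t. b t * corr g (\<lambda>x. cis (- (x \<bullet> l))) t)"
    by (rule mean_corr_swap[OF ap_cis_minus g b])
  also have "\<dots> = mean (\<lambda>t. (b t * cis (t \<bullet> l)) * fourier g l)"
    unfolding corr_cis[OF g] by (simp add: mult.assoc)
  also have "\<dots> = mean (\<lambda>t. b t * cis (t \<bullet> l)) * fourier g l"
    by (rule mean_cmult) (intro ap_intros b)
  finally show ?thesis by (simp add: fourier_def mult.commute)
qed

section \<open>Compactness and uniform limits\<close>

lemma ap_uniform_subsequence:
  fixes f :: "'a::euclidean_space \<Rightarrow> complex" and w :: "nat \<Rightarrow> 'a \<Rightarrow> complex"
  assumes f: "ap f" and bdd: "\<And>n x. cmod (w n x) \<le> B"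
    and equi: "\<And>n x y d. close_translates f d x y \<Longrightarrow> cmod (w n x - w n y) \<le> d * K"
  obtains r v where "strict_mono (r :: nat \<Rightarrow> nat)" "ap v" "uniform_limit UNIV (\<lambda>n. w (r n)) v sequentially"
proof -
  \<comment> \<open>a positive constant, so that \<open>e/L\<close> can serve as a modulus of continuity\<close>
  define L where "L = max K 1"
  have L: "L > 0" "K \<le> L" by (auto simp: L_def)
  have e: "\<exists>d>0. \<forall>n x y. close_translates f d x y \<longrightarrow> cmod (w n x - w n y) \<le> e" if "e > 0" for e
  proof (intro exI[of _ "e/L"] conjI allI impI)
    fix n x y assume "close_translates f (e/L) x y"
    then have "cmod (w n x - w n y) \<le> e/L * K" by (rule equi)
    also have "\<dots> \<le> e/L * L" using L that by (intro mult_left_mono) auto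
    finally show "cmod (w n x - w n y) \<le> e" using L by simp
  qed (use that L in auto)
  show ?thesis
  proof (rule ap_equicontinuous_subsequence[OF f bdd e])
    fix r v
    assume r: "strict_mono (r :: nat \<Rightarrow> nat)" "ap v"
      "\<And>e. e > 0 \<Longrightarrow> \<exists>N. \<forall>n\<ge>N. \<forall>x. cmod (w (r n) x - v x) \<le> e"
    have "uniform_limit UNIV (\<lambda>n. w (r n)) v sequentially"
      unfolding uniform_limit_sequentially_iff
    proof (intro allI impI)
      fix e :: real assume e: "e > 0"
      then have "e/2 > 0" by simp
      from r(3)[OF this] obtain N where "\<forall>n\<ge>N. \<forall>x. cmod (w (r n) x - v x) \<le> e/2" ..
      moreover have "a \<le> e/2 \<Longrightarrow> a < e" for a using e by simp
      ultimately show "\<exists>N. \<forall>n\<ge>N. \<forall>x\<in>UNIV. dist (w (r n) x) (v x) < e"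
        unfolding dist_norm by (intro exI[of _ N]) simp
    qed
    with r(1,2) show thesis by (rule that)
  qed auto
qed

lemma mean_uniform_limit:
  fixes w :: "'i \<Rightarrow> 'a::euclidean_space \<Rightarrow> complex"
  assumes lim: "uniform_limit UNIV w v F" and w: "\<And>n. ap (w n)" and v: "ap v"
  shows "((\<lambda>n. mean (w n)) \<longlongrightarrow> mean v) F"
proof (rule tendstoI)
  fix e :: real assume e: "e > 0"
  then have "\<forall>\<^sub>F n in F. \<forall>x\<in>UNIV. dist (w n x) (v x) < e/2"
    using lim unfolding uniform_limit_iff by (elim allE[of _ "e/2"]) simp
  then show "\<forall>\<^sub>F n in F. dist (mean (w n)) (mean v) < e"
  proof eventually_elim
    case (elim n)
    have "cmod (mean (w n) - mean v) \<le> e/2"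
      by (rule mean_close[OF w v]) (use elim in \<open>simp add: dist_norm less_imp_le\<close>)
    then show ?case using e by (simp add: dist_norm)
  qed
qed

lemma bounded_ap_range: "ap (f::'a::real_normed_vector \<Rightarrow> complex) \<Longrightarrow> bounded (range f)"
  using ap_bounded[of f] unfolding bounded_iff by (metis rangeE)

lemma uniform_limit_cnj:
  "uniform_limit S w v F \<Longrightarrow> uniform_limit S (\<lambda>n x. cnj (w n x)) (\<lambda>x. cnj (v x)) F"
  unfolding uniform_limit_iff by (simp add: dist_norm flip: complex_cnj_diff)

lemma mean_sq_uniform_limit:
  fixes w :: "'i \<Rightarrow> 'a::euclidean_space \<Rightarrow> complex"
  assumes "uniform_limit UNIV w v F" "\<And>n. ap (w n)" "ap v"
  shows "((\<lambda>n. mean_sq (w n)) \<longlongrightarrow> mean_sq v) F"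
proof -
  have "uniform_limit UNIV (\<lambda>n x. w n x * cnj (w n x)) (\<lambda>x. v x * cnj (v x)) F"
    by (intro uniform_lim_mult assms uniform_limit_cnj bounded_ap_range ap_intros)
  then have "((\<lambda>n. mean (\<lambda>x. w n x * cnj (w n x))) \<longlongrightarrow> mean (\<lambda>x. v x * cnj (v x))) F"
    by (rule mean_uniform_limit) (intro ap_intros assms)+
  then have "((\<lambda>n. of_real (mean_sq (w n)) :: complex) \<longlongrightarrow> of_real (mean_sq v)) F"
    unfolding mean_inner_def[symmetric] by (simp add: mean_inner_self assms)
  then show ?thesis by (simp only: tendsto_of_real_iff)
qed

lemma uniform_limit_reindex:
  assumes "uniform_limit UNIV g g' F"
  shows "uniform_limit UNIV (\<lambda>n p. g n (h p)) (\<lambda>p. g' (h p)) F"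
  unfolding uniform_limit_iff
proof (intro allI impI)
  fix e :: real assume "e > 0"
  with assms have "\<forall>\<^sub>F n in F. \<forall>x\<in>UNIV. dist (g n x) (g' x) < e" by (simp add: uniform_limit_iff)
  then show "\<forall>\<^sub>F n in F. \<forall>p\<in>UNIV. dist (g n (h p)) (g' (h p)) < e" by eventually_elim simp
qed

lemma corr_uniform_limit:
  fixes g b :: "'i \<Rightarrow> 'a::euclidean_space \<Rightarrow> complex"
  assumes g: "uniform_limit UNIV g g' F" "\<And>n. ap (g n)" "ap g'"
    and b: "uniform_limit UNIV b b' F" "\<And>n. ap (b n)" "ap b'"
  shows "uniform_limit UNIV (\<lambda>n. corr (g n) (b n)) (corr g' b') F"
  unfolding uniform_limit_iff
proof (intro allI impI)
  fix e :: real assume e: "e > 0"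
  have "uniform_limit UNIV (\<lambda>n p. g n (fst p + snd p)) (\<lambda>p. g' (fst p + snd p)) F"
    using g(1) by (rule uniform_limit_reindex)
  moreover have "uniform_limit UNIV (\<lambda>n p::'a\<times>'a. b n (snd p)) (\<lambda>p. b' (snd p)) F"
    using b(1) by (rule uniform_limit_reindex)
  moreover have "bounded (range (\<lambda>p. g' (fst p + snd p)))"
    by (rule bounded_subset[OF bounded_ap_range[OF g(3)]]) blast
  moreover have "bounded (range (\<lambda>p::'a\<times>'a. b' (snd p)))"
    by (rule bounded_subset[OF bounded_ap_range[OF b(3)]]) blast
  ultimately have "uniform_limit UNIV (\<lambda>n p. g n (fst p + snd p) * b n (snd p)) (\<lambda>p. g' (fst p + snd p) * b' (snd p)) F"
    by (rule uniform_lim_mult)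
  then have "\<forall>\<^sub>F n in F. \<forall>p\<in>UNIV. dist (g n (fst p + snd p) * b n (snd p)) (g' (fst p + snd p) * b' (snd p)) < e/2"
    unfolding uniform_limit_iff using e by (elim allE[of _ "e/2"]) simp
  then show "\<forall>\<^sub>F n in F. \<forall>x\<in>UNIV. dist (corr (g n) (b n) x) (corr g' b' x) < e"
  proof eventually_elim
    case (elim n)
    show ?case
    proof
      fix x
      have "cmod (corr (g n) (b n) x - corr g' b' x) \<le> e/2"
        unfolding corr_def
      proof (rule mean_close)
        show "cmod (g n (x + t) * b n t - g' (x + t) * b' t) \<le> e/2" for t
          using bspec[OF elim, of "(x, t)"] by (simp add: dist_norm)
      qed (intro ap_intros g b)+
      then show "dist (corr (g n) (b n) x) (corr g' b' x) < e" using e by (simp add: dist_norm)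
    qed
  qed
qed

section \<open>Continuous characters\<close>

text \<open>The deviation from homogeneity along a line is additive and vanishes at 1, so it is periodic and, by
continuity, bounded; a bounded additive function is zero.\<close>

lemma continuous_additive_scaleR:
  fixes g :: "'a::real_normed_vector \<Rightarrow> 'b::real_normed_vector"
  assumes add: "\<And>x y. g (x + y) = g x + g y" and cont: "continuous_on UNIV g"
  shows "g (r *\<^sub>R x) = r *\<^sub>R g x"
proof -
  define h where "h r = g (r *\<^sub>R x) - r *\<^sub>R g x" for r
  have hadd: "h (r + s) = h r + h s" for r s
    by (simp add: h_def add scaleR_add_left)
  have h0: "h 0 = 0" using hadd[of 0 0] by simp
  have h1: "h 1 = 0" by (simp add: h_def)
  have hn: "h (real n * r) = real n *\<^sub>R h r" for n r
    by (induction n) (simp_all add: h0 hadd distrib_right scaleR_add_left)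
  have hneg: "h (- r) = - h r" for r using hadd[of r "-r"] h0 by (simp add: eq_neg_iff_add_eq_0 add.commute)
  have hint: "h (of_int k) = 0" for k
  proof (cases k)
    case (nonneg n) then show ?thesis using hn[of n 1] h1 by simp
  next
    case (neg n) then show ?thesis using hn[of "Suc n" 1] h1 hneg[of "real (Suc n)"] by simp
  qed
  have "continuous_on {0..1} h"
    unfolding h_def by (intro continuous_intros continuous_on_compose2[OF cont]) auto
  then have "bounded (h ` {0..1})" by (intro compact_imp_bounded compact_continuous_image) auto
  then obtain B where B: "\<And>s. s \<in> {0..1} \<Longrightarrow> norm (h s) \<le> B" unfolding bounded_iff by blast
  have bdd: "norm (h s) \<le> B" for s
  proof -
    have "h s = h (frac s)" using hadd[of "of_int \<lfloor>s\<rfloor>" "frac s"] hint[of "\<lfloor>s\<rfloor>"] by (simp add: frac_def)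
    then show ?thesis using B[of "frac s"] by (simp add: frac_lt_1 less_imp_le)
  qed
  have "h r = 0"
  proof (rule ccontr)
    assume "h r \<noteq> 0"
    then obtain n where "real n * norm (h r) > B" using reals_Archimedean3[of "norm (h r)"] by auto
    then show False using bdd[of "real n * r"] hn[of n r] by simp
  qed
  then show ?thesis by (simp add: h_def)
qed

text \<open>The values are integral multiples of \<open>2\<pi>\<i>\<close>.\<close>

lemma continuous_exp_eq_1_constant:
  assumes S: "connected S" and cont: "continuous_on S h" and one: "\<And>x. x \<in> S \<Longrightarrow> exp (h x) = (1::complex)"
  shows "h constant_on S"
proof (rule continuous_discrete_range_constant[OF S cont])
  fix x assume x: "x \<in> S"
  show "\<exists>e>0. \<forall>y. y \<in> S \<and> h y \<noteq> h x \<longrightarrow> e \<le> norm (h y - h x)"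
  proof (intro exI[of _ "2 * pi"] conjI allI impI)
    fix y assume y: "y \<in> S \<and> h y \<noteq> h x"
    have "exp (h y - h x) = 1" using one x y by (simp add: exp_diff)
    then obtain n :: int where n: "Re (h y - h x) = 0" "Im (h y - h x) = of_int (2 * n) * pi"
      unfolding exp_eq_1 by blast
    then have "n \<noteq> 0" using y by (auto simp: complex_eq_iff)
    then have "1 \<le> \<bar>real_of_int n\<bar>" by (metis of_int_1_le_iff of_int_abs zero_less_abs_iff int_one_le_iff_zero_less)
    then have "2 * pi * 1 \<le> 2 * pi * \<bar>real_of_int n\<bar>" by (intro mult_left_mono) auto
    also have "\<dots> = \<bar>Im (h y - h x)\<bar>" unfolding n(2) by (simp add: abs_mult)
    also have "\<dots> \<le> norm (h y - h x)" by (rule abs_Im_le_cmod)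
    finally show "2 * pi \<le> norm (h y - h x)" by simp
  qed auto
qed

lemma additive_imaginary_representation:
  fixes c :: "'a::euclidean_space \<Rightarrow> complex"
  assumes add: "\<And>x y. c (x + y) = c x + c y" and cont: "continuous_on UNIV c" and bdd: "\<And>x. \<bar>Re (c x)\<bar> \<le> B"
  obtains l where "\<And>x. c x = \<i> * of_real (x \<bullet> l)"
proof -
  have sc: "c (r *\<^sub>R x) = r *\<^sub>R c x" for r x by (rule continuous_additive_scaleR[OF add cont])
  have re: "Re (c x) = 0" for x
  proof (rule ccontr)
    assume "Re (c x) \<noteq> 0"
    then obtain n where "real n * \<bar>Re (c x)\<bar> > B" using reals_Archimedean3[of "\<bar>Re (c x)\<bar>"] by auto
    then show False using bdd[of "real n *\<^sub>R x"] sc[of "real n" x] by (simp add: abs_mult)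
  qed
  have lin: "linear (\<lambda>x. Im (c x))" by (intro linearI) (simp_all add: add sc)
  define l where "l = (\<Sum>b\<in>Basis. Im (c b) *\<^sub>R b)"
  have "Im (c x) = x \<bullet> l" for x
  proof -
    have "Im (c x) = (\<Sum>b\<in>Basis. (x \<bullet> b) *\<^sub>R Im (c b))"
      using Linear_Algebra.linear_componentwise[OF lin, of x 1] by simp
    then show ?thesis unfolding l_def inner_sum_right by (simp add: mult.commute)
  qed
  then have "c x = \<i> * of_real (x \<bullet> l)" for x using re by (simp add: complex_eq_iff)
  then show ?thesis by (rule that)
qed

text \<open>The continuous logarithm that vanishes at 0 is additive: for fixed \<open>y\<close> its additivity defect is continuous in \<open>x\<close>, has
exponential 1 and vanishes for \<open>x = 0\<close>.\<close>

lemma continuous_character: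
  fixes \<psi> :: "'a::euclidean_space \<Rightarrow> complex"
  assumes cont: "continuous_on UNIV \<psi>" and mult: "\<And>x y. \<psi> (x + y) = \<psi> x * \<psi> y" and unit: "\<And>x. cmod (\<psi> x) = 1"
  obtains l where "\<And>x. \<psi> x = cis (x \<bullet> l)"
proof -
  have ne: "\<psi> x \<noteq> 0" for x using unit[of x] by auto
  obtain L where L: "continuous_on UNIV L" "\<And>x. \<psi> x = exp (L x)"
    using continuous_logarithm_on_contractible[OF cont contractible_UNIV] ne by (metis UNIV_I)
  have one: "\<psi> 0 = 1" using mult[of 0 0] ne[of 0] by simp
  define c where "c x = L x - L 0" for x
  have c: "continuous_on UNIV c" "\<And>x. \<psi> x = exp (c x)" "c 0 = 0"
    using L one by (auto simp: c_def exp_diff intro!: continuous_intros)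
  have "c (x + y) = c x + c y" for x y
  proof -
    have "(\<lambda>x. c (x + y) - c x - c y) constant_on UNIV"
    proof (rule continuous_exp_eq_1_constant)
      show "continuous_on UNIV (\<lambda>x. c (x + y) - c x - c y)"
        by (intro continuous_intros c continuous_on_compose2[OF c(1)]) auto
      show "exp (c (x + y) - c x - c y) = 1" for x
        using mult[of x y] ne[of x] ne[of y] by (simp add: exp_diff c(2)[symmetric])
    qed auto
    then obtain k where "\<And>x. c (x + y) - c x - c y = k" unfolding constant_on_def by blast
    from this[of x] this[of 0] show ?thesis using c(3) by (simp add: algebra_simps)
  qed
  moreover have "\<bar>Re (c x)\<bar> \<le> 0" for x
    using unit[of x] unfolding c(2) norm_exp_eq_Re by simp
  ultimately obtain l where l: "\<And>x. c x = \<i> * of_real (x \<bullet> l)"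
    using additive_imaginary_representation[OF _ c(1)] by blast
  have "\<psi> x = cis (x \<bullet> l)" for x unfolding c(2) l cis_conv_exp ..
  then show ?thesis by (rule that)
qed

section \<open>The uniqueness theorem for Fourier coefficients\<close>

text \<open>The positive operator \<open>S\<^sup>*S\<close> for \<open>S u = corr f u\<close>. It maps sequences that are bounded in mean square
to equicontinuous ones, by \<open>corr_close_mean_sq\<close>.\<close>

definition corr_op :: "('a::euclidean_space \<Rightarrow> complex) \<Rightarrow> ('a \<Rightarrow> complex) \<Rightarrow> 'a \<Rightarrow> complex" where
  "corr_op f u = corr (\<lambda>x. cnj (f x)) (corr f u)"

lemma close_translates_cnj: "close_translates (\<lambda>x. cnj (f x)) d x y \<longleftrightarrow> close_translates f d x y"
  unfolding close_translates_def by (simp add: dist_norm flip: complex_cnj_diff)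

lemma ap_corr_op [ap_intros]: "ap f \<Longrightarrow> ap u \<Longrightarrow> ap (corr_op f u)"
  unfolding corr_op_def by (intro ap_intros)

lemma corr_op_lincomb:
  assumes "ap f" "ap u" "ap v"
  shows "corr_op f (\<lambda>t. u t + c * v t) x = corr_op f u x + c * corr_op f v x"
proof -
  have "corr f (\<lambda>t. u t + c * v t) = (\<lambda>x. corr f u x + c * corr f v x)"
    by (rule ext) (rule corr_lincomb[OF assms])
  then show ?thesis unfolding corr_op_def by (simp add: corr_lincomb ap_intros assms)
qed

lemma corr_op_translate:
  assumes f: "ap f" and u: "ap u"
  shows "corr_op f (\<lambda>t. u (t + s)) x = corr_op f u (x + s)"
proof -
  have "corr f (\<lambda>t. u (t + s)) = (\<lambda>x. corr f u (x + - s))"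
    by (rule ext) (simp add: corr_translate[OF f u])
  then show ?thesis
    unfolding corr_op_def using corr_translate[OF ap_cnj[OF f] ap_corr[OF f u], of "- s" x] by simp
qed

lemma mean_inner_corr_op:
  assumes f: "ap f" and u: "ap u"
  shows "mean_inner u (corr_op f u) = of_real (mean_sq (corr f u))"
  using corr_adjoint[OF f u ap_corr[OF f u]] mean_inner_self[OF ap_corr[OF f u]] by (simp add: corr_op_def)

lemma corr_op_uniform_limit:
  fixes u :: "'i \<Rightarrow> 'a::euclidean_space \<Rightarrow> complex"
  assumes f: "ap f" and u: "uniform_limit UNIV u u' F" "\<And>n. ap (u n)" "ap u'"
  shows "uniform_limit UNIV (\<lambda>n. corr_op f (u n)) (corr_op f u') F"
  unfolding corr_op_def
  by (intro corr_uniform_limit u ap_intros f uniform_limit_const)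

lemma mean_sq_eq_0_imp: "ap u \<Longrightarrow> mean_sq u = 0 \<Longrightarrow> u = (\<lambda>x. 0)"
  using mean_sq_pos[of u] by force

text \<open>Let \<open>m\<close> be the supremum of the mean square of \<open>S u\<close> over all \<open>u\<close> of mean square at most 1. Along a maximising sequence,
\<open>S\<^sup>*S u - m u\<close> tends to 0 in mean square. By compactness \<open>S\<^sup>*S u\<close> converges uniformly along a
subsequence, and the limit is an eigenfunction with eigenvalue \<open>m\<close>. It is not zero because the mean square of \<open>S\<^sup>*S u\<close>
has lower limit at least \<open>m\<^sup>2\<close>.\<close>

lemma corr_op_eigenfunction:
  fixes f :: "'a::euclidean_space \<Rightarrow> complex"
  assumes f: "ap f" and f0: "f x0 \<noteq> 0"
  obtains m v where "m > 0" "ap v" "mean_sq v > 0" "corr_op f v = (\<lambda>x. of_real m * v x)"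
proof -
  obtain B where B: "B > 0" "\<And>x. cmod (f x) \<le> B" using ap_bounded[OF f] by blast
  note ic = ap_corr[OF f] ap_corr_op[OF f]
  have bound: "cmod (corr f u x) \<le> B * sqrt (mean_sq u)" if "ap u" for u x
    by (rule corr_bound_mean_sq[OF f that B(2)])
  have bound': "cmod (corr (\<lambda>x. cnj (f x)) u x) \<le> B * sqrt (mean_sq u)" if "ap u" for u x
    by (rule corr_bound_mean_sq[OF ap_cnj[OF f] that]) (use B in simp)
  define Q where "Q = (\<lambda>u. mean_sq (corr f u)) ` {u. ap u \<and> mean_sq u \<le> 1}"
  have le_B: "mean_sq (corr f u) \<le> B\<^sup>2" if u: "ap u" "mean_sq u \<le> 1" for u
  proof (rule mean_sq_bound[OF ic(1)[OF u(1)]])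
    fix x
    have "B * sqrt (mean_sq u) \<le> B * 1" using B u by (intro mult_left_mono) auto
    then show "cmod (corr f u x) \<le> B" using bound[OF u(1), of x] by simp
  qed
  have bdd: "bdd_above Q" unfolding Q_def using le_B by (intro bdd_aboveI[of _ "B\<^sup>2"]) auto
  define m where "m = Sup Q"
  have m_upper: "mean_sq (corr f u) \<le> m" if "ap u" "mean_sq u \<le> 1" for u
    unfolding m_def by (rule cSup_upper[OF _ bdd]) (use that in \<open>auto simp: Q_def\<close>)
  have mean_sq_scale: "mean_sq (corr f (\<lambda>x. c * u x)) = (cmod c)\<^sup>2 * mean_sq (corr f u)" if "ap u" for c u
  proof -
    have "corr f (\<lambda>x. c * u x) = (\<lambda>x. c * corr f u x)"
      unfolding corr_def using mean_cmult(1)[of "\<lambda>t. f (x + t) * u t" c for x]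
      by (simp add: ap_intros f that mult.left_commute)
    then show ?thesis by (simp add: mean_sq_cmult ic that)
  qed
  have m_le: "mean_sq (corr f u) \<le> m * mean_sq u" if u: "ap u" for u
  proof (cases "mean_sq u = 0")
    case True
    then have "u = (\<lambda>x. 0)" using mean_sq_eq_0_imp[OF u] by simp
    then show ?thesis by (simp add: corr_def mean_sq_def)
  next
    case False
    then have pos: "mean_sq u > 0" using mean_sq_nonneg[OF u] by simp
    define c where "c = complex_of_real (1 / sqrt (mean_sq u))"
    have c2: "(cmod c)\<^sup>2 = 1 / mean_sq u" using pos by (simp add: c_def norm_divide power_divide)
    have "mean_sq (corr f (\<lambda>x. c * u x)) \<le> m"
      by (rule m_upper) (use pos c2 in \<open>auto simp: mean_sq_cmult u intro!: ap_intros\<close>)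
    then show ?thesis using pos c2 by (simp add: mean_sq_scale u field_simps)
  qed
  have fpos: "mean_sq f > 0" using mean_sq_pos[OF f f0] .
  have m: "m > 0"
  proof -
    have "corr f (\<lambda>x. cnj (f x)) 0 = of_real (mean_sq f)" using mean_inner_self[OF f] by (simp add: corr_def mean_inner_def)
    then have "corr f (\<lambda>x. cnj (f x)) 0 \<noteq> 0" using fpos by simp
    then have "0 < mean_sq (corr f (\<lambda>x. cnj (f x)))" by (rule mean_sq_pos[OF ic(1)[OF ap_cnj[OF f]]])
    also have "\<dots> \<le> m * mean_sq (\<lambda>x. cnj (f x))" by (rule m_le[OF ap_cnj[OF f]])
    finally have "0 < m * mean_sq f" by (simp add: mean_sq_def)
    then show ?thesis using fpos by (simp add: zero_less_mult_iff)
  qed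
  have adj_le: "mean_sq (corr (\<lambda>x. cnj (f x)) w) \<le> m * mean_sq w" if w: "ap w" for w
  proof -
    define a where "a = corr (\<lambda>x. cnj (f x)) w"
    have a: "ap a" unfolding a_def by (intro ap_intros f w)
    have "mean_inner (corr f a) w = of_real (mean_sq a)"
      using corr_adjoint[OF f a w] mean_inner_self[OF a] by (simp add: a_def)
    then have "(mean_sq a)\<^sup>2 \<le> mean_sq (corr f a) * mean_sq w"
      using mean_inner_Cauchy_Schwarz[OF ic(1)[OF a] w] by simp
    also have "\<dots> \<le> (m * mean_sq a) * mean_sq w" by (intro mult_right_mono m_le a mean_sq_nonneg w)
    finally have "mean_sq a * mean_sq a \<le> mean_sq a * (m * mean_sq w)" by (simp add: power2_eq_square mult_ac)
    then have "mean_sq a \<le> m * mean_sq w"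
      using mean_sq_nonneg[OF a] mean_sq_nonneg[OF w] m by (cases "mean_sq a = 0") (auto simp: mult_le_cancel_left)
    then show ?thesis by (simp add: a_def)
  qed
  have op_bound: "cmod (corr_op f u x) \<le> B * sqrt (m * mean_sq u)" if u: "ap u" for u x
  proof -
    have "cmod (corr_op f u x) \<le> B * sqrt (mean_sq (corr f u))" unfolding corr_op_def by (rule bound'[OF ic(1)[OF u]])
    also have "\<dots> \<le> B * sqrt (m * mean_sq u)" using B m_le[OF u] by simp
    finally show ?thesis .
  qed
  have "\<exists>u. (ap u \<and> mean_sq u \<le> 1) \<and> m - 1 / real (Suc n) < mean_sq (corr f u)" for n
  proof -
    have "m - 1 / real (Suc n) < Sup Q" by (simp add: m_def)
    moreover have "mean_sq (\<lambda>x::'a. 0) = 0" by (simp add: mean_sq_def)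
    then have "Q \<noteq> {}" unfolding Q_def using ap_const[of 0] by (auto intro!: exI[of _ "\<lambda>x. 0"])
    ultimately obtain q where "q \<in> Q" "m - 1 / real (Suc n) < q" using less_cSup_iff[OF _ bdd] by metis
    then show ?thesis by (auto simp: Q_def)
  qed
  then obtain u where u: "\<And>n. ap (u n)" "\<And>n. mean_sq (u n) \<le> 1" "\<And>n. m - 1 / real (Suc n) < mean_sq (corr f (u n))"
    by metis
  define w where "w n = corr_op f (u n)" for n
  have apw: "ap (w n)" for n unfolding w_def by (rule ic(2)[OF u(1)])
  have w_bound: "cmod (w n x) \<le> B * sqrt (m * 1)" for n x
  proof -
    have "B * sqrt (m * mean_sq (u n)) \<le> B * sqrt (m * 1)" using B m u(2) by (intro mult_left_mono real_sqrt_le_mono) auto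
    then show ?thesis using op_bound[OF u(1), of n x] unfolding w_def by linarith
  qed
  have w_equi: "cmod (w n x - w n y) \<le> d * B" if cl: "close_translates f d x y" for n x y d
  proof -
    have d: "0 \<le> d" using close_translatesD[OF cl, of 0] zero_le_dist order_trans by blast
    have "cmod (w n x - w n y) \<le> d * sqrt (mean_sq (corr f (u n)))"
      unfolding w_def corr_op_def
      by (rule corr_close_mean_sq) (use cl in \<open>auto simp: close_translates_cnj intro!: ap_intros f u\<close>)
    also have "\<dots> \<le> d * B"
      using le_B[OF u(1,2), of n] B d by (intro mult_left_mono real_le_lsqrt mean_sq_nonneg ic u) auto
    finally show ?thesis .
  qed
  obtain r v where rv: "strict_mono (r :: nat \<Rightarrow> nat)" "ap v" "uniform_limit UNIV (\<lambda>n. w (r n)) v sequentially"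
    by (rule ap_uniform_subsequence[OF f w_bound w_equi])
  \<comment> \<open>the maximising sequence consists of approximate eigenfunctions\<close>
  have defect: "mean_sq (\<lambda>x. w n x + (- of_real m) * u n x) \<le> m / real (Suc n)" for n
  proof -
    have re: "Re (mean_inner (w n) (u n)) = mean_sq (corr f (u n))"
      using mean_inner_corr_op[OF f u(1), of n] mean_inner_cnj[OF u(1) apw, of n n] by (simp add: w_def)
    have "mean_sq (\<lambda>x. w n x + (- of_real m) * u n x) = mean_sq (w n) - 2 * m * mean_sq (corr f (u n)) + m\<^sup>2 * mean_sq (u n)"
      unfolding mean_sq_lincomb[OF apw u(1)] by (simp add: re)
    also have "mean_sq (w n) \<le> m * mean_sq (corr f (u n))"
      unfolding w_def corr_op_def by (rule adj_le[OF ic(1)[OF u(1)]])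
    also have "m\<^sup>2 * mean_sq (u n) \<le> m\<^sup>2 * 1" using u(2) by (intro mult_left_mono) auto
    finally have "mean_sq (\<lambda>x. w n x + (- of_real m) * u n x) \<le> m * (m - mean_sq (corr f (u n)))"
      by (simp add: power2_eq_square algebra_simps)
    also have "\<dots> \<le> m * (1 / real (Suc n))" using m u(3)[of n] by (intro mult_left_mono) auto
    finally show ?thesis by simp
  qed
  have eigen: "corr_op f v x = of_real m * v x" for x
  proof -
    have lim0: "(\<lambda>n. B * sqrt (m * (m / real (Suc (r n))))) \<longlonglongrightarrow> 0"
    proof -
      have "(\<lambda>n. B * sqrt (m * (m / real (Suc n)))) \<longlonglongrightarrow> B * sqrt (m * 0)"
        by (intro tendsto_intros) (use LIMSEQ_Suc[OF lim_const_over_n[of m]] in simp)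
      from LIMSEQ_subseq_LIMSEQ[OF this rv(1)] show ?thesis by (simp add: o_def)
    qed
    have lim: "(\<lambda>n. corr_op f (w (r n)) x - of_real m * w (r n) x) \<longlonglongrightarrow> corr_op f v x - of_real m * v x"
      by (intro tendsto_intros tendsto_uniform_limitI[OF corr_op_uniform_limit[OF f rv(3) apw rv(2)]]
          tendsto_uniform_limitI[OF rv(3)]) auto
    have "(\<lambda>n. corr_op f (w (r n)) x - of_real m * w (r n) x) \<longlonglongrightarrow> 0"
    proof (rule Lim_null_comparison[OF always_eventually lim0], rule allI)
      fix n
      let ?h = "\<lambda>x. w (r n) x + (- of_real m) * u (r n) x"
      have aph: "ap ?h" by (intro ap_intros apw u)
      have "corr_op f (w (r n)) x - of_real m * w (r n) x = corr_op f ?h x"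
        unfolding corr_op_lincomb[OF f apw u(1)] by (simp add: w_def)
      also have "cmod \<dots> \<le> B * sqrt (m * mean_sq ?h)" by (rule op_bound[OF aph])
      also have "\<dots> \<le> B * sqrt (m * (m / real (Suc (r n))))"
        using B m by (intro mult_left_mono real_sqrt_le_mono defect) auto
      finally show "cmod (corr_op f (w (r n)) x - of_real m * w (r n) x) \<le> B * sqrt (m * (m / real (Suc (r n))))" .
    qed
    from LIMSEQ_unique[OF lim this] show ?thesis by simp
  qed
  have "mean_sq v > 0"
  proof -
    have low: "(m - 1 / real (Suc (r n)))\<^sup>2 \<le> mean_sq (w (r n))" if n: "1 / real (Suc (r n)) \<le> m" for n
    proof -
      have "cmod (mean_inner (u (r n)) (w (r n))) = mean_sq (corr f (u (r n)))"
        using mean_sq_nonneg[OF ic(1)[OF u(1)]] by (simp add: w_def mean_inner_corr_op f u)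
      then have "(mean_sq (corr f (u (r n))))\<^sup>2 \<le> mean_sq (u (r n)) * mean_sq (w (r n))"
        using mean_inner_Cauchy_Schwarz[OF u(1) apw, of "r n" "r n"] by simp
      also have "\<dots> \<le> 1 * mean_sq (w (r n))" by (intro mult_right_mono u mean_sq_nonneg apw)
      finally have "(mean_sq (corr f (u (r n))))\<^sup>2 \<le> mean_sq (w (r n))" by simp
      moreover have "(m - 1 / real (Suc (r n)))\<^sup>2 \<le> (mean_sq (corr f (u (r n))))\<^sup>2"
        by (rule power_mono) (use n u(3)[of "r n"] in auto)
      ultimately show ?thesis by linarith
    qed
    have l0: "(\<lambda>n. 1 / real (Suc (r n))) \<longlonglongrightarrow> 0"
      using LIMSEQ_subseq_LIMSEQ[OF LIMSEQ_Suc[OF lim_const_over_n[of 1]] rv(1)] by (simp add: o_def)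
    then have "\<forall>\<^sub>F n in sequentially. 1 / real (Suc (r n)) < m" using m by (rule order_tendstoD)
    then have ev: "\<forall>\<^sub>F n in sequentially. (m - 1 / real (Suc (r n)))\<^sup>2 \<le> mean_sq (w (r n))"
      by eventually_elim (use low in auto)
    have "(\<lambda>n. (m - 1 / real (Suc (r n)))\<^sup>2) \<longlonglongrightarrow> (m - 0)\<^sup>2" by (intro tendsto_intros l0)
    then have "(m - 0)\<^sup>2 \<le> mean_sq v"
      by (rule tendsto_le[OF sequentially_bot mean_sq_uniform_limit[OF rv(3) apw rv(2)] _ ev])
    moreover have "0 < (m - 0)\<^sup>2" using m by simp
    ultimately show ?thesis by linarith
  qed
  moreover have "corr_op f v = (\<lambda>x. of_real m * v x)" using eigen by blast
  ultimately show ?thesis using m rv(2) by (intro that)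
qed

text \<open>The inner product of the translate of \<open>u\<close> by \<open>x\<close> with \<open>u\<close>, as a function of \<open>x\<close>. For
\<open>u = \<Sum> u\<^sub>l e\<^sub>l\<close> its Fourier coefficients are the numbers \<open>\<bar>u\<^sub>l\<bar>\<^sup>2\<close>.\<close>

definition autocorr :: "('a::euclidean_space \<Rightarrow> complex) \<Rightarrow> 'a \<Rightarrow> complex" where
  "autocorr u = corr u (\<lambda>t. cnj (u t))"

lemma ap_autocorr [ap_intros]: "ap u \<Longrightarrow> ap (autocorr u)"
  unfolding autocorr_def by (intro ap_intros)

lemma autocorr_0: "ap u \<Longrightarrow> autocorr u 0 = of_real (mean_sq u)"
  using mean_inner_self[of u] by (simp add: autocorr_def corr_def mean_inner_def)

lemma autocorr_le:
  assumes u: "ap u" shows "cmod (autocorr u x) \<le> mean_sq u"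
proof -
  have "autocorr u x = mean_inner (\<lambda>t. u (t + x)) u"
    by (simp add: autocorr_def corr_def mean_inner_def add.commute)
  then have "(cmod (autocorr u x))\<^sup>2 \<le> (mean_sq u)\<^sup>2"
    using mean_inner_Cauchy_Schwarz[OF ap_translate(1)[OF u] u, of x] by (simp add: mean_sq_translate[OF u] power2_eq_square)
  then show ?thesis using mean_sq_nonneg[OF u] by (rule power2_le_imp_le)
qed

lemma autocorr_minus:
  assumes u: "ap u" shows "autocorr u (- x) = cnj (autocorr u x)"
proof -
  have "cnj (autocorr u x) = mean (\<lambda>t. u t * cnj (u (x + t)))"
    unfolding autocorr_def corr_def by (subst mean_cnj[symmetric]) (auto intro!: ap_intros u simp: mult.commute)
  also have "\<dots> = mean (\<lambda>t. u (t + - x) * cnj (u (x + (t + - x))))"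
    by (rule mean_translate(2)[symmetric]) (intro ap_intros u)
  finally show ?thesis by (simp add: autocorr_def corr_def add.commute)
qed

text \<open>In terms of coefficients, \<open>\<bar>u\<^sub>l\<bar>\<^sup>2\<close> is multiplied by \<open>\<bar>1 + c e\<^sub>l(s)\<bar>\<^sup>2\<close>.\<close>

lemma autocorr_translate_lincomb:
  assumes u: "ap u" and c: "cmod c = 1"
  shows "autocorr (\<lambda>x. u x + c * u (x + s)) x = 2 * autocorr u x + (c * autocorr u (x + s) + cnj c * autocorr u (x - s))"
proof -
  have cc: "c * cnj c = 1" using c by (metis complex_norm_square of_real_1 one_power2)
  have t: "autocorr u (x - s) = mean (\<lambda>t. u (x + t) * cnj (u (t + s)))"
  proof -
    have "mean (\<lambda>t. u (x - s + (t + s)) * cnj (u (t + s))) = autocorr u (x - s)"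
      unfolding autocorr_def corr_def
      by (rule mean_translate(2)[of "\<lambda>t. u (x - s + t) * cnj (u t)"]) (intro ap_intros u)
    then show ?thesis by (simp add: algebra_simps)
  qed
  have t': "mean (\<lambda>t. u (x + t + s) * cnj (u (t + s))) = autocorr u x"
  proof -
    have "mean (\<lambda>t. u (x + (t + s)) * cnj (u (t + s))) = autocorr u x"
      unfolding autocorr_def corr_def
      by (rule mean_translate(2)[of "\<lambda>t. u (x + t) * cnj (u t)"]) (intro ap_intros u)
    then show ?thesis by (simp add: algebra_simps)
  qed
  have as: "ap (\<lambda>t. u (x + t + s))" "ap (\<lambda>t. u (t + s))" "ap (\<lambda>t. u (x + t))"
    using ap_translate[OF u] ap_translate(2)[OF ap_translate(1)[OF u]] by auto
  have "autocorr (\<lambda>x. u x + c * u (x + s)) x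
     = mean (\<lambda>t. u (x + t) * cnj (u t) + (cnj c * (u (x + t) * cnj (u (t + s))) + (c * (u (x + t + s) * cnj (u t))
        + (c * cnj c) * (u (x + t + s) * cnj (u (t + s))))))"
    unfolding autocorr_def corr_def by (simp add: algebra_simps)
  also have "\<dots> = autocorr u x + (cnj c * autocorr u (x - s) + (c * mean (\<lambda>t. u (x + t + s) * cnj (u t)) + 1 * autocorr u x))"
    unfolding cc t
    by (simp add: mean_add mean_cmult ap_intros u as t') (simp add: autocorr_def corr_def)
  also have "mean (\<lambda>t. u (x + t + s) * cnj (u t)) = autocorr u (x + s)"
    by (simp add: autocorr_def corr_def add_ac)
  finally show ?thesis by simp
qed

lemma autocorr_uniform_limit:
  fixes u :: "'i \<Rightarrow> 'a::euclidean_space \<Rightarrow> complex"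
  assumes "uniform_limit UNIV u u' F" "\<And>n. ap (u n)" "ap u'"
  shows "uniform_limit UNIV (\<lambda>n. autocorr (u n)) (autocorr u') F"
  unfolding autocorr_def by (intro corr_uniform_limit uniform_limit_cnj ap_intros assms)

text \<open>Add the first bound with weight \<open>1 - r\<close> to the second one with weight \<open>1 + r\<close>. In the application the left-hand side of the
conclusion is a mean square, which therefore vanishes.\<close>

lemma weighted_square_bounds:
  fixes N p q r :: real
  assumes a: "2 * p + q \<le> N * (2 * r + r\<^sup>2)" and b: "- 2 * p + q \<le> N * (- 2 * r + r\<^sup>2)" and r: "\<bar>r\<bar> \<le> 1"
  shows "q - 2 * r * p + r\<^sup>2 * N \<le> 0"
proof -
  have "(1 - r) * (2 * p + q) \<le> (1 - r) * (N * (2 * r + r\<^sup>2))" using a r by (intro mult_left_mono) auto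
  moreover have "(1 + r) * (- 2 * p + q) \<le> (1 + r) * (N * (- 2 * r + r\<^sup>2))" using b r by (intro mult_left_mono) auto
  ultimately have "(1 - r) * (2 * p + q) + (1 + r) * (- 2 * p + q)
      \<le> (1 - r) * (N * (2 * r + r\<^sup>2)) + (1 + r) * (N * (- 2 * r + r\<^sup>2))" by (rule add_mono)
  moreover have "(1 - r) * (2 * p + q) + (1 + r) * (- 2 * p + q) = 2 * q - 4 * r * p" by (simp add: algebra_simps)
  moreover have "(1 - r) * (N * (2 * r + r\<^sup>2)) + (1 + r) * (N * (- 2 * r + r\<^sup>2)) = - 2 * r\<^sup>2 * N"
    by (simp add: algebra_simps power2_eq_square)
  ultimately show ?thesis by simp
qed

text \<open>If the autocorrelation \<open>\<psi>\<close> of a normalised eigenfunction \<open>u\<close> is \<open>\<Sum> p\<^sub>l e\<^sub>l\<close> with nonnegative \<open>p\<^sub>l\<close> of sum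
1, its mean square \<open>\<Sum> p\<^sub>l\<^sup>2\<close> is largest when there is only one frequency. Such expansions are not yet known,
but the conclusion can be reached without them. By compactness a maximiser \<open>u\<close> exists. For \<open>\<bar>c\<bar> = 1\<close> the functions
\<open>u(x) \<plusminus> c u(x + s)\<close> are eigenfunctions with autocorrelations \<open>2(\<psi> \<plusminus> E)\<close>, where
\<open>E(x) = (c \<psi>(x + s) + cnj c \<psi>(x - s))/2\<close>, and maximality for both signs gives \<open>E = r \<psi>\<close> with a real \<open>r\<close>.
The cases \<open>c = 1\<close> and \<open>c = \<i>\<close> together say that \<open>\<psi>\<close> is multiplicative. So \<open>\<psi>\<close> is a
character, and its frequency is one of \<open>u\<close>.\<close>

lemma eigenfunction_frequency:
  fixes f v :: "'a::euclidean_space \<Rightarrow> complex"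
  assumes f: "ap f" and m: "m > 0" and v: "ap v" "mean_sq v > 0" "corr_op f v = (\<lambda>x. of_real m * v x)"
  obtains l u where "ap u" "corr_op f u = (\<lambda>x. of_real m * u x)" "fourier u l \<noteq> 0"
proof -
  define V where "V u \<longleftrightarrow> ap u \<and> (\<forall>x. corr_op f u x = of_real m * u x)" for u
  have apV: "ap u" if "V u" for u using that by (simp add: V_def)
  have V_cmult: "V (\<lambda>x. c * u x)" if "V u" for c u
  proof -
    have "corr_op f (\<lambda>x. (\<lambda>x. 0) x + c * u x) x = corr_op f (\<lambda>x. 0) x + c * corr_op f u x" for x
      by (rule corr_op_lincomb[OF f ap_const apV[OF that]])
    moreover have "corr_op f (\<lambda>x. 0) x = 0" for x by (simp add: corr_op_def corr_def)
    ultimately show ?thesis using that by (auto simp: V_def intro!: ap_intros)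
  qed
  have V_pert: "V (\<lambda>x. u x + c * u (x + s))" if "V u" for u c s
    using that corr_op_lincomb[OF f apV[OF that] ap_translate(1)[OF apV[OF that], of s], of c]
      corr_op_translate[OF f apV[OF that], of s]
    by (auto simp: V_def algebra_simps intro!: ap_intros)
  have ac_scale: "autocorr (\<lambda>x. c * u x) = (\<lambda>x. of_real ((cmod c)\<^sup>2) * autocorr u x)" if "ap u" for c u
  proof
    fix x
    have "autocorr (\<lambda>x. c * u x) x = mean (\<lambda>t. (c * cnj c) * (u (x + t) * cnj (u t)))"
      unfolding autocorr_def corr_def by (simp add: algebra_simps)
    also have "\<dots> = (c * cnj c) * autocorr u x"
      unfolding autocorr_def corr_def by (rule mean_cmult) (intro ap_intros that)
    finally show "autocorr (\<lambda>x. c * u x) x = of_real ((cmod c)\<^sup>2) * autocorr u x" by (simp add: of_real_cmod_square)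
  qed
  define Q where "Q = (\<lambda>u. mean_sq (autocorr u)) ` {u. V u \<and> mean_sq u = 1}"
  have le1: "mean_sq (autocorr u) \<le> 1" if "V u" "mean_sq u = 1" for u
    using mean_sq_bound[OF ap_autocorr[OF apV[OF that(1)]], of 1] autocorr_le[OF apV[OF that(1)]] that(2) by simp
  have bdd: "bdd_above Q" unfolding Q_def using le1 by (intro bdd_aboveI[of _ 1]) auto
  define M where "M = Sup Q"
  have M_upper: "mean_sq (autocorr u) \<le> M" if "V u" "mean_sq u = 1" for u
    unfolding M_def by (rule cSup_upper[OF _ bdd]) (use that in \<open>auto simp: Q_def\<close>)
  have norm1: "\<exists>c. mean_sq (\<lambda>x. c * u x) = 1 \<and> (cmod c)\<^sup>2 = 1 / mean_sq u" if u: "ap u" "mean_sq u > 0" for u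
  proof (intro exI conjI)
    show "(cmod (complex_of_real (1 / sqrt (mean_sq u))))\<^sup>2 = 1 / mean_sq u"
      using u by (simp add: norm_divide power_divide)
    then show "mean_sq (\<lambda>x. complex_of_real (1 / sqrt (mean_sq u)) * u x) = 1"
      unfolding mean_sq_cmult[OF u(1)] using u by simp
  qed
  have M_le: "mean_sq (autocorr u) \<le> M * (mean_sq u)\<^sup>2" if u: "V u" for u
  proof (cases "mean_sq u = 0")
    case True
    then have "u = (\<lambda>x. 0)" using mean_sq_eq_0_imp apV[OF u] by blast
    then show ?thesis by (simp add: autocorr_def corr_def mean_sq_def)
  next
    case False
    then have pos: "mean_sq u > 0" using mean_sq_nonneg[OF apV[OF u]] by simp
    obtain c where c: "mean_sq (\<lambda>x. c * u x) = 1" "(cmod c)\<^sup>2 = 1 / mean_sq u" using norm1[OF apV[OF u] pos] by auto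
    have "mean_sq (autocorr (\<lambda>x. c * u x)) \<le> M" by (rule M_upper[OF V_cmult[OF u] c(1)])
    moreover have "mean_sq (autocorr (\<lambda>x. c * u x)) = (1 / mean_sq u)\<^sup>2 * mean_sq (autocorr u)"
      unfolding ac_scale[OF apV[OF u]] mean_sq_cmult[OF ap_autocorr[OF apV[OF u]]] using c(2) pos by (simp add: norm_divide)
    ultimately show ?thesis using pos by (simp add: field_simps)
  qed
  obtain B where B: "B > 0" "\<And>x. cmod (f x) \<le> B" using ap_bounded[OF f] by blast
  have nB: "sqrt (mean_sq (corr f u)) \<le> B" if "V u" "mean_sq u = 1" for u
  proof -
    have "mean_sq (corr f u) \<le> B\<^sup>2"
      using mean_sq_bound[OF ap_corr[OF f apV[OF that(1)]]] corr_bound_mean_sq[OF f apV[OF that(1)] B(2)] that(2) by simp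
    then show ?thesis using B by (intro real_le_lsqrt) auto
  qed
  have V_val: "cmod (u x - c * u y) = cmod (corr_op f u x - c * corr_op f u y) / m" if "V u" for u x y c
  proof -
    have "corr_op f u x - c * corr_op f u y = of_real m * (u x - c * u y)"
      using that by (simp add: V_def algebra_simps)
    then show ?thesis using m by (simp add: norm_mult)
  qed
  have V_bound: "cmod (u x) \<le> B * B / m" if u: "V u" "mean_sq u = 1" for u x
  proof -
    have "cmod (corr_op f u x) \<le> B * sqrt (mean_sq (corr f u))"
      unfolding corr_op_def by (rule corr_bound_mean_sq) (use B in \<open>auto intro!: ap_intros f apV[OF u(1)]\<close>)
    also have "\<dots> \<le> B * B" using B nB[OF u] by (intro mult_left_mono) auto
    finally show ?thesis using V_val[OF u(1), of x 0 x] m by (simp add: divide_right_mono)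
  qed
  have V_equi: "cmod (u x - u y) \<le> d * (B / m)" if u: "V u" "mean_sq u = 1" and cl: "close_translates f d x y" for u x y d
  proof -
    have d: "0 \<le> d" using close_translatesD[OF cl, of 0] zero_le_dist order_trans by blast
    have "cmod (corr_op f u x - corr_op f u y) \<le> d * sqrt (mean_sq (corr f u))"
      unfolding corr_op_def
      by (rule corr_close_mean_sq) (use cl in \<open>auto simp: close_translates_cnj intro!: ap_intros f apV[OF u(1)]\<close>)
    also have "\<dots> \<le> d * B" using d nB[OF u] by (intro mult_left_mono) auto
    finally show ?thesis using V_val[OF u(1), of x 1 y] m by (simp add: divide_right_mono)
  qed
  have "\<exists>u. (V u \<and> mean_sq u = 1) \<and> M - 1 / real (Suc n) < mean_sq (autocorr u)" for n
  proof -
    obtain c where "mean_sq (\<lambda>x. c * v x) = 1" using norm1[OF v(1,2)] by auto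
    moreover have "V v" using v by (simp add: V_def)
    ultimately have "Q \<noteq> {}" unfolding Q_def using V_cmult[of v c] by blast
    moreover have "M - 1 / real (Suc n) < Sup Q" by (simp add: M_def)
    ultimately obtain q where "q \<in> Q" "M - 1 / real (Suc n) < q" using less_cSup_iff[OF _ bdd] by metis
    then show ?thesis by (auto simp: Q_def)
  qed
  then obtain w where w: "\<And>n. V (w n)" "\<And>n. mean_sq (w n) = 1" "\<And>n. M - 1 / real (Suc n) < mean_sq (autocorr (w n))"
    by metis
  obtain r u where ru: "strict_mono (r :: nat \<Rightarrow> nat)" "ap u" "uniform_limit UNIV (\<lambda>n. w (r n)) u sequentially"
    by (rule ap_uniform_subsequence[OF f V_bound[OF w(1,2)] V_equi[OF w(1,2)]])
  note apw = apV[OF w(1)]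
  have Vu: "V u"
  proof -
    have "corr_op f u x = of_real m * u x" for x
    proof (rule LIMSEQ_unique)
      show "(\<lambda>n. corr_op f (w (r n)) x) \<longlonglongrightarrow> corr_op f u x"
        by (rule tendsto_uniform_limitI[OF corr_op_uniform_limit[OF f ru(3) apw ru(2)]]) simp
      have "(\<lambda>n. of_real m * w (r n) x) \<longlonglongrightarrow> of_real m * u x"
        by (intro tendsto_intros tendsto_uniform_limitI[OF ru(3)]) simp
      then show "(\<lambda>n. corr_op f (w (r n)) x) \<longlonglongrightarrow> of_real m * u x" using w(1) by (simp add: V_def)
    qed
    then show ?thesis using ru(2) by (simp add: V_def)
  qed
  have n2u: "mean_sq u = 1"
    using mean_sq_uniform_limit[OF ru(3) apw ru(2)] w(2) by (simp add: LIMSEQ_const_iff)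
  define \<psi> where "\<psi> = autocorr u"
  have ap\<psi>: "ap \<psi>" unfolding \<psi>_def by (intro ap_intros ru)
  have mean_sq\<psi>: "mean_sq \<psi> = M"
  proof (rule antisym)
    show "mean_sq \<psi> \<le> M" unfolding \<psi>_def by (rule M_upper[OF Vu n2u])
    have L1: "(\<lambda>n. mean_sq (autocorr (w (r n)))) \<longlonglongrightarrow> mean_sq \<psi>"
      unfolding \<psi>_def by (rule mean_sq_uniform_limit[OF autocorr_uniform_limit[OF ru(3) apw ru(2)]]) (intro ap_intros apw ru)+
    have L2: "(\<lambda>n. M - 1 / real (Suc (r n))) \<longlonglongrightarrow> M - 0"
      using LIMSEQ_subseq_LIMSEQ[OF LIMSEQ_Suc[OF lim_const_over_n[of 1]] ru(1)]
      by (intro tendsto_intros) (simp add: o_def)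
    have "M - 0 \<le> mean_sq \<psi>"
      by (rule LIMSEQ_le[OF L2 L1]) (use w(3) in \<open>auto intro: less_imp_le\<close>)
    then show "M \<le> mean_sq \<psi>" by simp
  qed
  have \<psi>0: "\<psi> 0 = 1" unfolding \<psi>_def using autocorr_0[OF ru(2)] n2u by simp
  have \<psi>m: "\<psi> (- x) = cnj (\<psi> x)" for x unfolding \<psi>_def by (rule autocorr_minus[OF ru(2)])
  have \<psi>1: "cmod (\<psi> x) \<le> 1" for x unfolding \<psi>_def using autocorr_le[OF ru(2), of x] n2u by simp
  define E where "E c s x = (c * \<psi> (x + s) + cnj c * \<psi> (x - s)) / 2" for c s x
  have apE: "ap (E c s)" for c s
  proof -
    have "ap (\<lambda>x. (1/2) * (c * \<psi> (x + s) + cnj c * \<psi> (x + - s)))" by (intro ap_intros ap\<psi>)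
    then show ?thesis by (simp add: E_def[abs_def])
  qed
  have pert: "mean_sq (\<lambda>x. \<psi> x + 1 * E c s x) \<le> M * (1 + Re (c * \<psi> s))\<^sup>2" if c: "cmod c = 1" for c s
  proof -
    define z where "z = (\<lambda>x. u x + c * u (x + s))"
    have Vz: "V z" unfolding z_def by (rule V_pert[OF Vu])
    have ac: "autocorr z x = 2 * (\<psi> x + 1 * E c s x)" for x
      unfolding z_def E_def \<psi>_def using autocorr_translate_lincomb[OF ru(2) c, of s x] by simp
    have "of_real (mean_sq z) = autocorr z 0" by (rule autocorr_0[OF apV[OF Vz], symmetric])
    also have "\<dots> = 2 + (c * \<psi> s + cnj (c * \<psi> s))" unfolding ac E_def using \<psi>0 \<psi>m[of s] by (simp add: algebra_simps)
    also have "\<dots> = of_real (2 + 2 * Re (c * \<psi> s))" by (simp only: complex_add_cnj of_real_add of_real_numeral)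
    finally have n2z: "mean_sq z = 2 + 2 * Re (c * \<psi> s)" by (simp only: of_real_eq_iff)
    have "4 * mean_sq (\<lambda>x. \<psi> x + 1 * E c s x) = mean_sq (autocorr z)"
      unfolding ac[abs_def] by (subst mean_sq_cmult) (auto intro!: ap_intros ap\<psi> apE)
    also have "\<dots> \<le> M * (mean_sq z)\<^sup>2" by (rule M_le[OF Vz])
    also have "\<dots> = 4 * (M * (1 + Re (c * \<psi> s))\<^sup>2)" unfolding n2z by (simp add: power2_eq_square algebra_simps)
    finally show ?thesis by simp
  qed
  \<comment> \<open>maximality of \<open>u\<close> forces the perturbation to be a multiple of the autocorrelation itself\<close>
  have eq: "E c s x = of_real (Re (c * \<psi> s)) * \<psi> x" if c: "cmod c = 1" for c s x
  proof -
    define r where "r = Re (c * \<psi> s)"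
    define p where "p = Re (mean_inner \<psi> (E c s))"
    have r1: "\<bar>r\<bar> \<le> 1"
      unfolding r_def using abs_Re_le_cmod[of "c * \<psi> s"] \<psi>1[of s] c by (simp add: norm_mult)
    have a: "2 * p + mean_sq (E c s) \<le> M * (2 * r + r\<^sup>2)"
      using pert[OF c, of s] unfolding mean_sq_lincomb[OF ap\<psi> apE] mean_sq\<psi> by (simp add: p_def r_def power2_eq_square algebra_simps)
    have e2: "1 + Re (- c * \<psi> s) = 1 - r" by (simp add: r_def)
    have "mean_sq (\<lambda>x. \<psi> x + 1 * E (- c) s x) \<le> M * (1 - r)\<^sup>2"
      using pert[of "- c" s, unfolded e2] c by simp
    moreover have "E (- c) s = (\<lambda>x. (- 1) * E c s x)" by (rule ext) (simp add: E_def field_simps)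
    ultimately have "mean_sq (\<lambda>x. \<psi> x + (- 1) * E c s x) \<le> M * (1 - r)\<^sup>2" by simp
    then have b: "- 2 * p + mean_sq (E c s) \<le> M * (- 2 * r + r\<^sup>2)"
      unfolding mean_sq_lincomb[OF ap\<psi> apE] mean_sq\<psi> by (simp add: p_def power2_eq_square algebra_simps)
    have "Re (mean_inner (E c s) \<psi>) = p" unfolding p_def using mean_inner_cnj[OF ap\<psi> apE] by simp
    then have "mean_sq (\<lambda>x. E c s x + (- of_real r) * \<psi> x) = mean_sq (E c s) - 2 * r * p + r\<^sup>2 * M"
      unfolding mean_sq_lincomb[OF apE ap\<psi>] mean_sq\<psi> by simp
    also have "\<dots> \<le> 0" by (rule weighted_square_bounds[OF a b r1])
    finally have le0: "mean_sq (\<lambda>x. E c s x + (- of_real r) * \<psi> x) \<le> 0" .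
    have "ap (\<lambda>x. E c s x + (- of_real r) * \<psi> x)" by (intro ap_intros apE ap\<psi>)
    from mean_sq_pos[OF this, of x] le0 have "E c s x + (- of_real r) * \<psi> x = 0" by linarith
    then show ?thesis unfolding r_def[symmetric] by simp
  qed
  have mult: "\<psi> (x + s) = \<psi> x * \<psi> s" for x s
  proof -
    have 1: "\<psi> (x + s) + \<psi> (x - s) = of_real (2 * Re (\<psi> s)) * \<psi> x"
      using eq[of 1 s x] by (simp add: E_def field_simps)
    have "\<i> * \<psi> (x + s) - \<i> * \<psi> (x - s) = of_real (2 * Re (\<i> * \<psi> s)) * \<psi> x"
      using eq[of \<i> s x] by (simp add: E_def field_simps)
    then have "\<i> * (\<i> * \<psi> (x + s) - \<i> * \<psi> (x - s)) = \<i> * (of_real (2 * Re (\<i> * \<psi> s)) * \<psi> x)" by (rule arg_cong)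
    then have 2: "\<psi> (x + s) - \<psi> (x - s) = \<i> * of_real (2 * Im (\<psi> s)) * \<psi> x"
      by (simp add: right_diff_distrib mult.assoc[symmetric]) (simp add: algebra_simps)
    have "2 * \<psi> (x + s) = (\<psi> (x + s) + \<psi> (x - s)) + (\<psi> (x + s) - \<psi> (x - s))" by simp
    also have "\<dots> = 2 * ((of_real (Re (\<psi> s)) + \<i> * of_real (Im (\<psi> s))) * \<psi> x)"
      unfolding 1 2 by (simp add: algebra_simps)
    also have "of_real (Re (\<psi> s)) + \<i> * of_real (Im (\<psi> s)) = \<psi> s" by (simp add: complex_eq_iff)
    finally show ?thesis by simp
  qed
  have unit: "cmod (\<psi> x) = 1" for x
  proof -
    have "cmod (\<psi> x) * cmod (\<psi> (- x)) = 1" using mult[of x "- x"] \<psi>0 by (simp flip: norm_mult)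
    then have "1 \<le> cmod (\<psi> x)" using \<psi>1[of "- x"] mult_left_mono[of "cmod (\<psi> (- x))" 1 "cmod (\<psi> x)"] by simp
    then show ?thesis using \<psi>1[of x] by simp
  qed
  obtain l where l: "\<And>x. \<psi> x = cis (x \<bullet> l)"
    using continuous_character[OF ap_continuous[OF ap\<psi>] mult unit] by blast
  have "(1::complex) = mean (\<lambda>x. cis (- (x \<bullet> l)) * \<psi> x)" unfolding l by (simp add: cis_mult)
  also have "\<dots> = mean (\<lambda>t. cnj (u t) * corr u (\<lambda>x. cis (- (x \<bullet> l))) t)"
    unfolding \<psi>_def autocorr_def by (intro mean_corr_swap ap_intros ru)
  also have "\<dots> = mean (\<lambda>t. (cnj (u t) * cis (t \<bullet> l)) * fourier u l)"
    unfolding corr_cis[OF ru(2)] by (simp add: mult.assoc)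
  also have "\<dots> = mean (\<lambda>t. cnj (u t) * cis (t \<bullet> l)) * fourier u l"
    by (rule mean_cmult) (intro ap_intros ru)
  finally have "fourier u l \<noteq> 0" by auto
  with Vu show ?thesis unfolding V_def by (intro that) auto
qed

text \<open>Taking Fourier coefficients at \<open>l\<close> in the eigenvalue equation for \<open>u\<close> yields a product that contains the coefficient of \<open>f\<close> at
\<open>-l\<close>; so this coefficient is not zero if \<open>l\<close> is a frequency of \<open>u\<close>.\<close>

theorem fourier_uniqueness:
  fixes f :: "'a::euclidean_space \<Rightarrow> complex"
  assumes f: "ap f" and zero: "\<And>l. fourier f l = 0"
  shows "f x = 0"
proof (rule ccontr)
  assume "f x \<noteq> 0"
  then obtain m v where mv: "m > 0" "ap v" "mean_sq v > 0" "corr_op f v = (\<lambda>x. of_real m * v x)"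
    by (rule corr_op_eigenfunction[OF f])
  obtain l u where u: "ap u" "corr_op f u = (\<lambda>x. of_real m * u x)" "fourier u l \<noteq> 0"
    by (rule eigenfunction_frequency[OF f mv])
  have "fourier (corr_op f u) l = fourier (\<lambda>x. cnj (f x)) l * (fourier f (- l) * fourier u l)"
    unfolding corr_op_def by (simp add: fourier_corr ap_intros f u(1))
  then have "fourier (corr_op f u) l = 0" using zero by simp
  moreover have "fourier (corr_op f u) l = of_real m * fourier u l"
    unfolding fourier_def u(2) mult.assoc by (rule mean_cmult) (intro ap_intros u)
  ultimately show False using u(3) mv(1) by simp
qed

section \<open>Approximation by trigonometric polynomials\<close>

context
  fixes f :: "'a::euclidean_space \<Rightarrow> complex"
  assumes f: "ap f"
begin

lemma fourier_cmult: "fourier (\<lambda>x. c * f x) l = c * fourier f l"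
  unfolding fourier_def mult.assoc by (rule mean_cmult) (intro ap_intros f)

lemma fourier_add: "ap g \<Longrightarrow> fourier (\<lambda>x. f x + g x) l = fourier f l + fourier g l"
  unfolding fourier_def by (simp add: distrib_right mean_add ap_intros f)

lemma fourier_diff: "ap g \<Longrightarrow> fourier (\<lambda>x. f x - g x) l = fourier f l - fourier g l"
  unfolding fourier_def by (simp add: left_diff_distrib mean_diff ap_intros f)

lemma fourier_bound: "(\<And>x. cmod (f x) \<le> B) \<Longrightarrow> cmod (fourier f l) \<le> B"
  unfolding fourier_def by (rule norm_mean_bound) (auto intro!: ap_intros f simp: norm_mult)

lemma fourier_close: "ap g \<Longrightarrow> (\<And>x. cmod (f x - g x) \<le> e) \<Longrightarrow> cmod (fourier f l - fourier g l) \<le> e"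
  unfolding fourier_def
  by (rule mean_close) (auto intro!: ap_intros f simp: norm_mult left_diff_distrib[symmetric])

lemma fourier_cis_mult: "fourier (\<lambda>x. cis (x \<bullet> k) * f x) l = fourier f (l - k)"
proof -
  have eq: "cis (x \<bullet> k) * f x * cis (- (x \<bullet> l)) = f x * cis (- (x \<bullet> (l - k)))" for x
  proof -
    have "cis (x \<bullet> k) * cis (- (x \<bullet> l)) = cis (- (x \<bullet> (l - k)))" by (simp add: cis_mult inner_diff_right)
    then show ?thesis by (metis mult.assoc mult.commute)
  qed
  show ?thesis by (simp only: fourier_def eq)
qed

lemma fourier_translate: "fourier (\<lambda>x. f (x + s)) l = cis (s \<bullet> l) * fourier f l"
proof -
  have "fourier (\<lambda>x. f (x + s)) l = mean (\<lambda>x. cis (s \<bullet> l) * (f (x + s) * cis (- ((x + s) \<bullet> l))))"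
    unfolding fourier_def
  proof (intro arg_cong[where f = mean] ext)
    fix x
    have "cis (- (x \<bullet> l)) = cis (s \<bullet> l) * cis (- ((x + s) \<bullet> l))"
      by (simp add: cis_mult inner_add_left)
    then show "f (x + s) * cis (- (x \<bullet> l)) = cis (s \<bullet> l) * (f (x + s) * cis (- ((x + s) \<bullet> l)))" by simp
  qed
  also have "\<dots> = cis (s \<bullet> l) * mean (\<lambda>x. f (x + s) * cis (- ((x + s) \<bullet> l)))"
    by (rule mean_cmult) (rule ap_translate(1)[of "\<lambda>x. f x * cis (- (x \<bullet> l))"], intro ap_intros f)
  also have "mean (\<lambda>x. f (x + s) * cis (- ((x + s) \<bullet> l))) = fourier f l"
    unfolding fourier_def by (rule mean_translate(2)) (intro ap_intros f)
  finally show ?thesis .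
qed

end

lemma fourier_sum:
  fixes f :: "'i \<Rightarrow> 'a::euclidean_space \<Rightarrow> complex"
  assumes "\<And>i. i \<in> I \<Longrightarrow> ap (f i)"
  shows "fourier (\<lambda>x. \<Sum>i\<in>I. f i x) l = (\<Sum>i\<in>I. fourier (f i) l)"
  unfolding fourier_def sum_distrib_right by (rule mean_sum) (intro ap_intros assms)

lemma fourier_const: "fourier (\<lambda>x. c) l = (if l = 0 then c else 0)" for l :: "'a::euclidean_space"
proof (cases "l = 0")
  case False
  define s where "s = (pi / (l \<bullet> l)) *\<^sub>R l"
  have s: "cis (s \<bullet> l) = - 1" using False by (simp add: s_def)
  have "fourier (\<lambda>x. c) l = cis (s \<bullet> l) * fourier (\<lambda>x. c) l"
    using fourier_translate[OF ap_const[of c], where s = s and l = l] by simp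
  then have "fourier (\<lambda>x. c) l = - fourier (\<lambda>x. c) l" by (simp add: s)
  then show ?thesis using False by (simp add: equal_neg_zero)
qed (simp add: fourier_def)

lemma fourier_cis: "fourier (\<lambda>x. cis (x \<bullet> k)) l = (if l = k then 1 else 0)"
  using fourier_cis_mult[OF ap_const[of 1], of k l] by (simp add: fourier_const)

lemma ap_trig_poly [ap_intros]: "ap (\<lambda>x::'a::euclidean_space. \<Sum>l\<in>A. c l * cis (x \<bullet> l))"
  by (intro ap_intros)

lemma fourier_trig_poly:
  assumes "finite A"
  shows "fourier (\<lambda>x. \<Sum>l\<in>A. c l * cis (x \<bullet> l)) k = (if k \<in> A then c k else 0)"
proof -
  have "fourier (\<lambda>x. \<Sum>l\<in>A. c l * cis (x \<bullet> l)) k = (\<Sum>l\<in>A. if l = k then c k else 0)"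
    by (subst fourier_sum) (auto simp: fourier_cmult ap_intros fourier_cis intro!: ap_intros sum.cong)
  then show ?thesis using assms by simp
qed

lemma Bessel_inequality:
  fixes f :: "'a::euclidean_space \<Rightarrow> complex"
  assumes f: "ap f" and A: "finite A"
  shows "(\<Sum>l\<in>A. (cmod (fourier f l))\<^sup>2) \<le> mean_sq f"
proof -
  have eq: "mean_sq (\<lambda>x. f x + (\<Sum>l\<in>A. - fourier f l * cis (x \<bullet> l))) = mean_sq f - (\<Sum>l\<in>A. (cmod (fourier f l))\<^sup>2)"
    using A
  proof (induction A rule: finite_induct)
    case empty
    then show ?case by simp
  next
    case (insert k A)
    let ?g = "\<lambda>x. f x + (\<Sum>l\<in>A. - fourier f l * cis (x \<bullet> l))"
    have g: "ap ?g" by (intro ap_intros f)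
    have "fourier ?g k = fourier f k + fourier (\<lambda>x. \<Sum>l\<in>A. - fourier f l * cis (x \<bullet> l)) k"
      by (rule fourier_add[OF f]) (intro ap_intros)
    then have "fourier ?g k = fourier f k" using insert by (subst (asm) fourier_trig_poly) auto
    then have mean_inner: "mean_inner ?g (\<lambda>x. cis (x \<bullet> k)) = fourier f k" by (simp add: mean_inner_def fourier_def cis_cnj)
    have "mean_sq (\<lambda>x. f x + (\<Sum>l\<in>insert k A. - fourier f l * cis (x \<bullet> l))) = mean_sq (\<lambda>x. ?g x + (- fourier f k) * cis (x \<bullet> k))"
      using insert by (simp add: algebra_simps)
    also have "\<dots> = mean_sq ?g + 2 * Re (cnj (- fourier f k) * fourier f k) + (cmod (- fourier f k))\<^sup>2 * mean_sq (\<lambda>x::'a. cis (x \<bullet> k))"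
      unfolding mean_sq_lincomb[OF g ap_cis] mean_inner ..
    also have "cnj (- fourier f k) * fourier f k = - of_real ((cmod (fourier f k))\<^sup>2)"
      by (simp add: of_real_cmod_square mult.commute)
    also have "mean_sq (\<lambda>x::'a. cis (x \<bullet> k)) = 1" by (simp add: mean_sq_def)
    finally show ?case using insert by simp
  qed
  have "0 \<le> mean_sq (\<lambda>x. f x + (\<Sum>l\<in>A. - fourier f l * cis (x \<bullet> l)))" by (intro mean_sq_nonneg ap_intros f)
  then show ?thesis using eq by simp
qed

text \<open>By Bessel's inequality for \<open>f\<close> and \<open>k\<close>, the Fourier series of \<open>corr f k\<close> converges absolutely; its sum has
the same Fourier coefficients and hence equals \<open>corr f k\<close>.\<close>

lemma corr_trig_approx:
  fixes f k :: "'a::euclidean_space \<Rightarrow> complex"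
  assumes f: "ap f" and k: "ap k" and e: "e > 0"
  shows "\<exists>A c. finite A \<and> (\<forall>l\<in>A. fourier f l \<noteq> 0) \<and> (\<forall>x. cmod (corr f k x - (\<Sum>l\<in>A. c l * cis (x \<bullet> l))) \<le> e)"
proof -
  define b where "b l = fourier f l * fourier k (- l)" for l
  have sum_le: "(\<Sum>l\<in>A. cmod (b l)) \<le> mean_sq f + mean_sq k" if A: "finite A" for A
  proof -
    have le: "cmod (b l) \<le> (cmod (fourier f l))\<^sup>2 + (cmod (fourier k (- l)))\<^sup>2" for l
    proof -
      have "x * y \<le> x\<^sup>2 + y\<^sup>2" if "0 \<le> x" "0 \<le> y" for x y :: real
      proof -
        have "x * y \<le> 2 * x * y" using mult_nonneg_nonneg[OF that] by simp
        then show ?thesis using sum_squares_bound[of x y] by linarith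
      qed
      then show ?thesis unfolding b_def norm_mult by simp
    qed
    have "(\<Sum>l\<in>A. cmod (b l)) \<le> (\<Sum>l\<in>A. (cmod (fourier f l))\<^sup>2) + (\<Sum>l\<in>A. (cmod (fourier k (- l)))\<^sup>2)"
      unfolding sum.distrib[symmetric] by (intro sum_mono le)
    also have "(\<Sum>l\<in>A. (cmod (fourier k (- l)))\<^sup>2) = (\<Sum>l\<in>uminus ` A. (cmod (fourier k l))\<^sup>2)"
      by (subst sum.reindex) auto
    finally show ?thesis using Bessel_inequality[OF f A] Bessel_inequality[OF k, of "uminus ` A"] A by simp
  qed
  have abs: "(\<lambda>l. cmod (b l)) summable_on UNIV"
    unfolding abs_summable_iff_bdd_above using sum_le by (intro bdd_aboveI[of _ "mean_sq f + mean_sq k"]) auto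
  define g where "g x = (\<Sum>\<^sub>\<infinity>l. b l * cis (x \<bullet> l))" for x
  have tail: "\<exists>A. finite A \<and> L \<subseteq> A \<and> (\<forall>x. cmod (g x - (\<Sum>l\<in>A. b l * cis (x \<bullet> l))) \<le> e)"
    if e: "e > 0" and L: "finite L" for e L
  proof -
    have "((\<lambda>l. cmod (b l)) has_sum infsum (\<lambda>l. cmod (b l)) UNIV) UNIV" using abs by simp
    then have "\<forall>\<^sub>F A in finite_subsets_at_top UNIV. dist (\<Sum>l\<in>A. cmod (b l)) (infsum (\<lambda>l. cmod (b l)) UNIV) < e"
      using e unfolding has_sum_def by (rule tendstoD)
    then obtain A0 where A0: "finite A0"
      "\<And>A. finite A \<Longrightarrow> A0 \<subseteq> A \<Longrightarrow> dist (\<Sum>l\<in>A. cmod (b l)) (infsum (\<lambda>l. cmod (b l)) UNIV) < e"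
      unfolding eventually_finite_subsets_at_top by auto
    define A where "A = A0 \<union> L"
    have A: "finite A" "L \<subseteq> A" using A0 L by (auto simp: A_def)
    have small: "infsum (\<lambda>l. cmod (b l)) (UNIV - A) \<le> e"
    proof -
      have "infsum (\<lambda>l. cmod (b l)) (UNIV - A) = infsum (\<lambda>l. cmod (b l)) UNIV - (\<Sum>l\<in>A. cmod (b l))"
        using abs A by (subst infsum_Diff) auto
      then show ?thesis using A0(2)[of A] A by (simp add: A_def dist_real_def)
    qed
    have "cmod (g x - (\<Sum>l\<in>A. b l * cis (x \<bullet> l))) \<le> e" for x
    proof -
      have ab: "(\<lambda>l. cmod (b l * cis (x \<bullet> l))) summable_on X" for X
        using abs summable_on_subset_banach[of "\<lambda>l. cmod (b l)" UNIV X] by (simp add: norm_mult)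
      have "g x - (\<Sum>l\<in>A. b l * cis (x \<bullet> l)) = infsum (\<lambda>l. b l * cis (x \<bullet> l)) (UNIV - A)"
        unfolding g_def using A abs_summable_summable[OF ab] by (subst infsum_Diff) auto
      also have "cmod \<dots> \<le> infsum (\<lambda>l. cmod (b l * cis (x \<bullet> l))) (UNIV - A)"
        by (rule norm_infsum_bound[OF ab])
      finally show ?thesis using small by (simp add: norm_mult)
    qed
    with A show ?thesis by blast
  qed
  have g: "ap g"
  proof (rule ap_uniform_approx)
    fix e :: real assume "e > 0"
    from tail[OF this finite.emptyI] obtain A where "\<forall>x. cmod (g x - (\<Sum>l\<in>A. b l * cis (x \<bullet> l))) \<le> e" by blast
    then show "\<exists>h. ap h \<and> (\<forall>x. dist (g x) (h x) \<le> e)"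
      by (intro exI[of _ "\<lambda>x. \<Sum>l\<in>A. b l * cis (x \<bullet> l)"] conjI ap_intros) (simp add: dist_norm)
  qed
  have fcg: "fourier g l = b l" for l
  proof -
    have "cmod (fourier g l - b l) \<le> 0 + e" if e: "e > 0" for e
    proof -
      obtain A where A: "finite A" "{l} \<subseteq> A" "\<And>x. cmod (g x - (\<Sum>l\<in>A. b l * cis (x \<bullet> l))) \<le> e"
        using tail[OF e, of "{l}"] by auto
      have "cmod (fourier g l - fourier (\<lambda>x. \<Sum>l\<in>A. b l * cis (x \<bullet> l)) l) \<le> e"
        by (rule fourier_close[OF g]) (intro ap_intros A)+
      then show ?thesis using A by (simp add: fourier_trig_poly)
    qed
    then have "cmod (fourier g l - b l) \<le> 0" by (rule field_le_epsilon)
    then show ?thesis by simp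
  qed
  have "corr f k x - g x = 0" for x
  proof (rule fourier_uniqueness[where f = "\<lambda>x. corr f k x - g x"])
    show "ap (\<lambda>x. corr f k x - g x)" by (intro ap_intros f k g)
    show "fourier (\<lambda>x. corr f k x - g x) l = 0" for l
      by (subst fourier_diff) (auto intro!: ap_intros f k g simp: fcg fourier_corr f k b_def)
  qed
  then have eq: "corr f k x = g x" for x by simp
  obtain A where A: "finite A" "\<And>x. cmod (g x - (\<Sum>l\<in>A. b l * cis (x \<bullet> l))) \<le> e"
    using tail[OF e finite.emptyI] by blast
  have "(\<Sum>l\<in>A. b l * cis (x \<bullet> l)) = (\<Sum>l\<in>{l\<in>A. fourier f l \<noteq> 0}. b l * cis (x \<bullet> l))" for x
    by (rule sum.mono_neutral_right) (use A in \<open>auto simp: b_def\<close>)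
  then show ?thesis using A unfolding eq by (intro exI[of _ "{l\<in>A. fourier f l \<noteq> 0}"] exI[of _ b]) auto
qed

text \<open>A weighted average of \<open>f(x + t)\<close> over almost periods \<open>t\<close> of \<open>f\<close> is close to \<open>f(x)\<close>. The weight
\<open>k t = max 0 (e/2 - d t)\<close>, where \<open>d t\<close> is the distance between \<open>f\<close> and its translate by \<open>t\<close>, is almost
periodic itself, so that the average is a correlation of almost periodic functions.\<close>

theorem trig_approx:
  fixes f :: "'a::euclidean_space \<Rightarrow> complex"
  assumes f: "ap f" and e: "e > 0"
  shows "\<exists>A c. finite A \<and> (\<forall>l\<in>A. fourier f l \<noteq> 0) \<and> (\<forall>x. cmod (f x - (\<Sum>l\<in>A. c l * cis (x \<bullet> l))) \<le> e)"
proof -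
  obtain B where B: "\<And>x. cmod (f x) \<le> B" using ap_bounded[OF f] by blast
  define d where "d x = (SUP s. cmod (f (x + s) - f s))" for x
  have bdd: "bdd_above (range (\<lambda>s. cmod (f (x + s) - f s)))" for x
    by (rule bdd_aboveI2[of _ _ "B + B"]) (meson B add_mono norm_triangle_ineq4 order_trans)
  have d_upper: "cmod (f (x + s) - f s) \<le> d x" for x s
    unfolding d_def by (rule cSUP_upper[OF _ bdd]) simp
  have d0: "d 0 = 0" by (simp add: d_def)
  have d_close: "d x \<le> d y + \<delta>" if "close_translates f \<delta> x y" for x y \<delta>
    unfolding d_def[of x]
  proof (rule cSUP_least)
    fix s
    have "cmod (f (x + s) - f s) \<le> cmod (f (x + s) - f (y + s)) + cmod (f (y + s) - f s)"
      using norm_triangle_ineq[of "f (x + s) - f (y + s)" "f (y + s) - f s"] by simp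
    then show "cmod (f (x + s) - f s) \<le> d y + \<delta>"
      using d_upper[of y s] close_translatesD[OF that, of s] by (simp add: dist_norm)
  qed simp
  define k where "k x = max 0 (e/2 - d x)" for x
  have apk: "ap k"
  proof (rule ap_dominated[OF f], unfold dominated_def, intro allI impI)
    fix \<delta> :: real assume "\<delta> > 0"
    have "dist (k x) (k y) \<le> \<delta>" if cl: "close_translates f \<delta> x y" for x y
      using d_close[OF cl] d_close[of \<delta> y x] cl \<open>\<delta> > 0\<close>
      unfolding close_translates_sym[of f \<delta> y x] k_def dist_real_def by (auto simp: max_def)
    with \<open>\<delta> > 0\<close> show "\<exists>d>0. \<forall>x y. close_translates f d x y \<longrightarrow> dist (k x) (k y) \<le> \<delta>" by blast
  qed
  have M: "mean k > 0"
    by (rule mean_pos[OF apk, of 0]) (use e d0 in \<open>auto simp: k_def\<close>)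
  define M where "M = mean k"
  have apk': "ap (\<lambda>t. complex_of_real (k t))" by (intro ap_intros apk)
  \<comment> \<open>where \<open>k\<close> does not vanish, \<open>t\<close> is an \<open>e/2\<close>-almost period of \<open>f\<close>\<close>
  have near: "cmod (corr f (\<lambda>t. of_real (k t)) x - of_real M * f x) \<le> e/2 * M" for x
  proof -
    have "corr f (\<lambda>t. of_real (k t)) x - of_real M * f x = mean (\<lambda>t. f (x + t) * of_real (k t) - f x * of_real (k t))"
      unfolding corr_def M_def by (simp add: mean_diff mean_cmult mean_of_real ap_intros f apk mult.commute)
    also have "cmod \<dots> \<le> mean (\<lambda>t. cmod (f (x + t) * of_real (k t) - f x * of_real (k t)))"
      by (rule norm_mean_le) (intro ap_intros f apk)
    also have "\<dots> \<le> mean (\<lambda>t. e/2 * k t)"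
    proof (rule mean_mono)
      show "ap (\<lambda>t. cmod (f (x + t) * of_real (k t) - f x * of_real (k t)))" by (intro ap_intros f apk)
      show "ap (\<lambda>t. e/2 * k t)" by (rule ap_compose_UNIV[OF apk]) (intro continuous_intros)
      fix t
      have "cmod (f (x + t) - f x) * k t \<le> e/2 * k t"
      proof (cases "k t = 0")
        case False
        then have "d t \<le> e/2" by (auto simp: k_def)
        then have "cmod (f (x + t) - f x) \<le> e/2" using d_upper[of t x] by (simp add: add.commute)
        then show ?thesis by (rule mult_right_mono) (simp add: k_def)
      qed simp
      then show "cmod (f (x + t) * of_real (k t) - f x * of_real (k t)) \<le> e/2 * k t"
        by (simp add: left_diff_distrib[symmetric] norm_mult) (simp add: k_def)
    qed
    also have "\<dots> = e/2 * M" unfolding M_def by (rule mean_linear[OF apk bounded_linear_mult_right])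
    finally show ?thesis .
  qed
  have M0: "M > 0" using M by (simp add: M_def)
  obtain A c where A: "finite A" "\<forall>l\<in>A. fourier f l \<noteq> 0"
      "\<And>x. cmod (corr f (\<lambda>t. of_real (k t)) x - (\<Sum>l\<in>A. c l * cis (x \<bullet> l))) \<le> e/2 * M"
    using corr_trig_approx[OF f apk', of "e/2 * M"] e M0 by auto
  have "cmod (f x - (\<Sum>l\<in>A. (c l / of_real M) * cis (x \<bullet> l))) \<le> e" for x
  proof -
    let ?P = "\<Sum>l\<in>A. (c l / of_real M) * cis (x \<bullet> l)"
    have "M * cmod (f x - ?P) = cmod (of_real M * (f x - ?P))" using M0 by (simp add: norm_mult)
    also have "of_real M * (f x - ?P) = of_real M * f x - (\<Sum>l\<in>A. c l * cis (x \<bullet> l))"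
      using M0 by (simp add: right_diff_distrib sum_distrib_left)
    also have "cmod \<dots> \<le> e/2 * M + e/2 * M"
      by (rule norm_diff_triangle_le[OF _ A(3)]) (use near[of x] in \<open>simp add: norm_minus_commute\<close>)
    also have "\<dots> = M * e" by simp
    finally show ?thesis using M0 by simp
  qed
  with A(1,2) show ?thesis by (intro exI[of _ A] exI[of _ "\<lambda>l. c l / of_real M"]) blast
qed

section \<open>Spectra in a pointed semigroup\<close>

text \<open>When \<open>f\<close> is a trigonometric polynomial, the coefficient of the product at \<open>l\<close> is a finite sum over frequencies \<open>k\<close> of \<open>f\<close> and
involves the coefficient of \<open>g\<close> at \<open>l - k\<close>. It vanishes unless \<open>l \<in> S\<close>, and for \<open>l = 0\<close> only \<open>k = 0\<close>
contributes. The general case follows by approximation.\<close>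

lemma fourier_mult_semigroup:
  fixes f g :: "'a::euclidean_space \<Rightarrow> complex"
  assumes f: "ap f" and g: "ap g"
    and S: "\<And>x y. x \<in> S \<Longrightarrow> y \<in> S \<Longrightarrow> x + y \<in> S"
    and fS: "\<And>l. l \<notin> S \<Longrightarrow> fourier f l = 0" and gS: "\<And>l. l \<notin> S \<Longrightarrow> fourier g l = 0"
  shows "l \<notin> S \<Longrightarrow> fourier (\<lambda>x. f x * g x) l = 0"
    and "(\<And>x. x \<in> S \<Longrightarrow> - x \<in> S \<Longrightarrow> x = 0) \<Longrightarrow> fourier (\<lambda>x. f x * g x) 0 = fourier f 0 * fourier g 0"
proof -
  obtain G where G: "G > 0" "\<And>x. cmod (g x) \<le> G" using ap_bounded[OF g] by blast
  have approx: "\<exists>A c. finite A \<and> A \<subseteq> S \<and> cmod (fourier f 0 - (if 0 \<in> A then c 0 else 0)) \<le> e / G \<and>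
      (\<forall>l. cmod (fourier (\<lambda>x. f x * g x) l - (\<Sum>k\<in>A. c k * fourier g (l - k))) \<le> e)" if e: "e > 0" for e
  proof -
    have "e / G > 0" using e G by simp
    from trig_approx[OF f this] obtain A c where A: "finite A" "\<And>l. l \<in> A \<Longrightarrow> fourier f l \<noteq> 0"
        "\<And>x. cmod (f x - (\<Sum>l\<in>A. c l * cis (x \<bullet> l))) \<le> e / G" by blast
    have "cmod (fourier (\<lambda>x. f x * g x) l - (\<Sum>k\<in>A. c k * fourier g (l - k))) \<le> e" for l
    proof -
      have "fourier (\<lambda>x. (\<Sum>k\<in>A. c k * cis (x \<bullet> k)) * g x) l = (\<Sum>k\<in>A. c k * fourier g (l - k))"
        unfolding sum_distrib_right mult.assoc
        by (subst fourier_sum) (auto intro!: ap_intros g sum.cong simp: fourier_cmult fourier_cis_mult ap_intros g)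
      moreover have "cmod (fourier (\<lambda>x. f x * g x) l - fourier (\<lambda>x. (\<Sum>k\<in>A. c k * cis (x \<bullet> k)) * g x) l) \<le> e"
      proof (rule fourier_close)
        fix x
        have "cmod (f x * g x - (\<Sum>k\<in>A. c k * cis (x \<bullet> k)) * g x) = cmod (f x - (\<Sum>k\<in>A. c k * cis (x \<bullet> k))) * cmod (g x)"
          by (simp add: left_diff_distrib[symmetric] norm_mult)
        also have "\<dots> \<le> e / G * G" using A(3) G e by (intro mult_mono) auto
        finally show "cmod (f x * g x - (\<Sum>k\<in>A. c k * cis (x \<bullet> k)) * g x) \<le> e" using G by simp
      qed (intro ap_intros f g)+
      ultimately show ?thesis by simp
    qed
    moreover have "cmod (fourier f 0 - fourier (\<lambda>x. \<Sum>k\<in>A. c k * cis (x \<bullet> k)) 0) \<le> e / G"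
      by (rule fourier_close[OF f]) (intro ap_intros A)+
    then have "cmod (fourier f 0 - (if 0 \<in> A then c 0 else 0)) \<le> e / G" by (simp only: fourier_trig_poly[OF A(1)])
    moreover have "A \<subseteq> S" using A(2) fS by blast
    ultimately show ?thesis using A(1) by blast
  qed
  show "fourier (\<lambda>x. f x * g x) l = 0" if l: "l \<notin> S"
  proof -
    have "cmod (fourier (\<lambda>x. f x * g x) l) \<le> 0 + e" if e: "e > 0" for e
    proof -
      obtain A c where A: "A \<subseteq> S" "cmod (fourier (\<lambda>x. f x * g x) l - (\<Sum>k\<in>A. c k * fourier g (l - k))) \<le> e"
        using approx[OF e] by blast
      have "fourier g (l - k) = 0" if "k \<in> A" for k
        by (rule gS) (use S[of k "l - k"] A(1) l that in auto)
      then show ?thesis using A(2) by simp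
    qed
    then have "cmod (fourier (\<lambda>x. f x * g x) l) \<le> 0" by (rule field_le_epsilon)
    then show ?thesis by simp
  qed
  show "fourier (\<lambda>x. f x * g x) 0 = fourier f 0 * fourier g 0" if pointed: "\<And>x. x \<in> S \<Longrightarrow> - x \<in> S \<Longrightarrow> x = 0"
  proof -
    have "cmod (fourier (\<lambda>x. f x * g x) 0 - fourier f 0 * fourier g 0) \<le> 0 + e" if e: "e > 0" for e
    proof -
      have "e/2 > 0" using e by simp
      from approx[OF this] obtain A c where A: "finite A" "A \<subseteq> S" "cmod (fourier f 0 - (if 0 \<in> A then c 0 else 0)) \<le> e/2 / G"
          "cmod (fourier (\<lambda>x. f x * g x) 0 - (\<Sum>k\<in>A. c k * fourier g (0 - k))) \<le> e/2"
        by blast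
      have "fourier g (0 - k) = 0" if "k \<in> A" "k \<noteq> 0" for k
        by (rule gS) (use pointed[of k] A(2) that in auto)
      then have "(\<Sum>k\<in>A. c k * fourier g (0 - k)) = (\<Sum>k\<in>A. if k = 0 then c 0 * fourier g 0 else 0)"
        by (intro sum.cong) auto
      also have "\<dots> = (if 0 \<in> A then c 0 else 0) * fourier g 0" using A(1) by simp
      finally have eq: "(\<Sum>k\<in>A. c k * fourier g (0 - k)) = (if 0 \<in> A then c 0 else 0) * fourier g 0" .
      have "cmod ((if 0 \<in> A then c 0 else 0) * fourier g 0 - fourier f 0 * fourier g 0) = cmod (fourier f 0 - (if 0 \<in> A then c 0 else 0)) * cmod (fourier g 0)"
        by (simp only: left_diff_distrib[symmetric] norm_mult norm_minus_commute)
      also have "\<dots> \<le> e/2 / G * G" using A(3) G e by (intro mult_mono fourier_bound g) auto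
      finally have "cmod ((if 0 \<in> A then c 0 else 0) * fourier g 0 - fourier f 0 * fourier g 0) \<le> e/2" using G by simp
      from norm_diff_triangle_le[OF A(4)[unfolded eq] this] show ?thesis by simp
    qed
    then have "cmod (fourier (\<lambda>x. f x * g x) 0 - fourier f 0 * fourier g 0) \<le> 0" by (rule field_le_epsilon)
    then show ?thesis by simp
  qed
qed

lemma fourier_uniform_limit:
  fixes w :: "'i \<Rightarrow> 'a::euclidean_space \<Rightarrow> complex"
  assumes lim: "uniform_limit UNIV w v F" and w: "\<And>n. ap (w n)" and v: "ap v"
  shows "((\<lambda>n. fourier (w n) l) \<longlongrightarrow> fourier v l) F"
proof (rule tendstoI)
  fix e :: real assume e: "e > 0"
  then have "\<forall>\<^sub>F n in F. \<forall>x\<in>UNIV. dist (w n x) (v x) < e/2"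
    using lim unfolding uniform_limit_iff by (elim allE[of _ "e/2"]) simp
  then show "\<forall>\<^sub>F n in F. dist (fourier (w n) l) (fourier v l) < e"
  proof eventually_elim
    case (elim n)
    have "cmod (fourier (w n) l - fourier v l) \<le> e/2"
      by (rule fourier_close[OF w v]) (use elim in \<open>simp add: dist_norm less_imp_le\<close>)
    then show ?case using e by (simp add: dist_norm)
  qed
qed

text \<open>Taking the constant term is multiplicative on functions with spectrum in \<open>S\<close>, hence compatible with
the exponential series.\<close>

lemma fourier_exp_semigroup:
  fixes f :: "'a::euclidean_space \<Rightarrow> complex"
  assumes f: "ap f" and S: "0 \<in> S" "\<And>x y. x \<in> S \<Longrightarrow> y \<in> S \<Longrightarrow> x + y \<in> S"
    and pointed: "\<And>x. x \<in> S \<Longrightarrow> - x \<in> S \<Longrightarrow> x = 0"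
    and fS: "\<And>l. l \<notin> S \<Longrightarrow> fourier f l = 0"
  shows "l \<notin> S \<Longrightarrow> fourier (\<lambda>x. exp (f x)) l = 0" and "fourier (\<lambda>x. exp (f x)) 0 = exp (fourier f 0)"
proof -
  have pow: "(\<forall>l. l \<notin> S \<longrightarrow> fourier (\<lambda>x. f x ^ n) l = 0) \<and> fourier (\<lambda>x. f x ^ n) 0 = fourier f 0 ^ n" for n
  proof (induction n)
    case 0
    then show ?case using S(1) by (auto simp: fourier_const)
  next
    case (Suc n)
    show ?case
    proof (intro conjI allI impI)
      fix l assume "l \<notin> S"
      have "fourier (\<lambda>x. f x * f x ^ n) l = 0"
        by (rule fourier_mult_semigroup(1)[OF f ap_power[OF f], where S = S]) (use S fS Suc \<open>l \<notin> S\<close> in auto)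
      then show "fourier (\<lambda>x. f x ^ Suc n) l = 0" by simp
    next
      have "fourier (\<lambda>x. f x * f x ^ n) 0 = fourier f 0 * fourier (\<lambda>x. f x ^ n) 0"
        by (rule fourier_mult_semigroup(2)[OF f ap_power[OF f], where S = S]) (use S fS Suc pointed in auto)
      then show "fourier (\<lambda>x. f x ^ Suc n) 0 = fourier f 0 ^ Suc n" using Suc by simp
    qed
  qed
  obtain B where B: "\<And>x. cmod (f x) \<le> B" using ap_bounded[OF f] by blast
  define p where "p N x = (\<Sum>n<N. f x ^ n /\<^sub>R fact n)" for N :: nat and x
  have "uniform_limit UNIV (\<lambda>N x. \<Sum>n<N. f x ^ n /\<^sub>R fact n) (\<lambda>x. \<Sum>n. f x ^ n /\<^sub>R fact n) sequentially"
  proof (rule Weierstrass_m_test)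
    show "norm (f x ^ n /\<^sub>R fact n) \<le> B ^ n /\<^sub>R fact n" for n x
      using B[of x] by (simp add: norm_power divide_right_mono power_mono mult_left_mono)
    show "summable (\<lambda>n. B ^ n /\<^sub>R fact n)" by (rule summable_exp_generic)
  qed
  then have lim: "uniform_limit UNIV p (\<lambda>x. exp (f x)) sequentially"
    by (simp add: p_def[abs_def] exp_def)
  have app: "ap (p N)" for N unfolding p_def[abs_def] scaleR_conv_of_real by (intro ap_intros f)
  have fcp: "fourier (p N) l = (\<Sum>n<N. fourier (\<lambda>x. f x ^ n) l /\<^sub>R fact n)" for N l
    unfolding p_def[abs_def] scaleR_conv_of_real
    by (subst fourier_sum) (auto intro!: ap_intros f sum.cong simp: fourier_cmult ap_intros f)
  note l = fourier_uniform_limit[OF lim app ap_exp[OF f]]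
  show "fourier (\<lambda>x. exp (f x)) l = 0" if "l \<notin> S"
  proof -
    have "fourier (p N) l = 0" for N using pow that by (simp add: fcp)
    then show ?thesis using l[of l] by (simp add: LIMSEQ_const_iff)
  qed
  have "(\<lambda>N. \<Sum>n<N. fourier f 0 ^ n /\<^sub>R fact n) \<longlonglongrightarrow> exp (fourier f 0)"
    using exp_converges[of "fourier f 0"] by (simp add: sums_def)
  then show "fourier (\<lambda>x. exp (f x)) 0 = exp (fourier f 0)"
    using l[of 0] pow LIMSEQ_unique by (simp add: fcp)
qed

section \<open>Holomorphic functions on tubes\<close>

text \<open>The value at \<open>x + iy\<close> is written \<open>\<Phi> x y\<close>. Holomorphy is required only on complex lines with a real direction
\<open>v\<close>; all arguments below are about one complex variable on such a line.\<close>

definition tube_holomorphic :: "('a::euclidean_space \<Rightarrow> 'a \<Rightarrow> complex) \<Rightarrow> 'a set \<Rightarrow> bool" where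
  "tube_holomorphic \<Phi> C \<longleftrightarrow> continuous_on (UNIV \<times> C) (\<lambda>p. \<Phi> (fst p) (snd p)) \<and>
     (\<forall>x y v. (\<lambda>w. \<Phi> (x + Re w *\<^sub>R v) (y + Im w *\<^sub>R v)) holomorphic_on {w. y + Im w *\<^sub>R v \<in> C})"

lemma open_slice:
  fixes C :: "'a::euclidean_space set"
  assumes "open C" shows "open {w. y + Im w *\<^sub>R v \<in> C}"
proof -
  have "{w. y + Im w *\<^sub>R v \<in> C} = (\<lambda>w. y + Im w *\<^sub>R v) -` C" by auto
  then show ?thesis using assms by (simp add: open_vimage continuous_intros)
qed

lemma convex_slice:
  fixes C :: "'a::euclidean_space set"
  assumes "convex C" shows "convex {w. y + Im w *\<^sub>R v \<in> C}"
  unfolding convex_alt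
proof (intro ballI allI impI, clarsimp)
  fix w w' and u :: real
  assume a: "y + Im w *\<^sub>R v \<in> C" "y + Im w' *\<^sub>R v \<in> C" "0 \<le> u" "u \<le> 1"
  have "(1 - u) *\<^sub>R (y + Im w *\<^sub>R v) + u *\<^sub>R (y + Im w' *\<^sub>R v) \<in> C"
    using assms a unfolding convex_alt by blast
  then show "y + ((1 - u) * Im w + u * Im w') *\<^sub>R v \<in> C" by (simp add: algebra_simps)
qed

text \<open>The bound may depend on the ray through \<open>y\<close>; by \<open>bounded_tube_maximum\<close> it can afterwards be chosen
uniformly.\<close>

definition bounded_tube :: "('a::euclidean_space \<Rightarrow> 'a \<Rightarrow> complex) \<Rightarrow> 'a set \<Rightarrow> bool" where
  "bounded_tube \<Phi> C \<longleftrightarrow> tube_holomorphic \<Phi> C \<and>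
     (\<forall>y\<in>C. continuous_on (UNIV \<times> {0..}) (\<lambda>p. \<Phi> (fst p) (snd p *\<^sub>R y)) \<and>
        (\<exists>B. \<forall>x. \<forall>t\<ge>0. cmod (\<Phi> x (t *\<^sub>R y)) \<le> B))"

lemma pos_coneD: "pos_cone C \<Longrightarrow> y \<in> C \<Longrightarrow> t > 0 \<Longrightarrow> t *\<^sub>R y \<in> C"
  by (simp add: pos_cone_def)

text \<open>The Phragmen-Lindelof argument: dividing by \<open>1 - \<i>\<epsilon>w\<close>, which has modulus at least \<open>max 1 (\<epsilon>\<bar>w\<bar>)\<close> in the half
plane, makes the function small on large half circles, so that the maximum principle applies; then \<open>\<epsilon>\<close> tends
to 0.\<close>

lemma half_plane_maximum:
  fixes h :: "complex \<Rightarrow> complex"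
  assumes cont: "continuous_on {w. Im w \<ge> 0} h" and hol: "h holomorphic_on {w. Im w > 0}"
    and bdd: "\<And>w. Im w \<ge> 0 \<Longrightarrow> cmod (h w) \<le> B" and real: "\<And>t. cmod (h (of_real t)) \<le> M" and w: "Im w > 0"
  shows "cmod (h w) \<le> M"
proof (rule field_le_epsilon)
  fix \<eta> :: real assume \<eta>: "\<eta> > 0"
  define M' where "M' = M + \<eta>"
  have M: "M' > 0" using real[of 0] \<eta> norm_ge_zero[of "h (of_real 0)"] by (simp add: M'_def add_nonneg_pos order_trans[OF norm_ge_zero])
  have B: "B \<ge> 0" using bdd[of 0] order_trans[OF norm_ge_zero] by simp
  have den: "cmod (1 - \<i> * of_real \<epsilon> * z) \<ge> 1" "cmod (1 - \<i> * of_real \<epsilon> * z) \<ge> \<epsilon> * cmod z"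
    if "\<epsilon> > 0" "Im z \<ge> 0" for \<epsilon> z
  proof -
    have n: "(cmod (1 - \<i> * of_real \<epsilon> * z))\<^sup>2 = (1 + \<epsilon> * Im z)\<^sup>2 + (\<epsilon> * Re z)\<^sup>2"
      by (simp add: cmod_power2)
    have "0 \<le> \<epsilon> * Im z" using that by simp
    then have "1\<^sup>2 \<le> (1 + \<epsilon> * Im z)\<^sup>2" "(\<epsilon> * Im z)\<^sup>2 \<le> (1 + \<epsilon> * Im z)\<^sup>2"
      by (intro power_mono; simp)+
    then have "1\<^sup>2 \<le> (cmod (1 - \<i> * of_real \<epsilon> * z))\<^sup>2" "(\<epsilon> * cmod z)\<^sup>2 \<le> (cmod (1 - \<i> * of_real \<epsilon> * z))\<^sup>2"
      unfolding n power_mult_distrib[of \<epsilon> "cmod z"] cmod_power2 by (auto simp: power_mult_distrib algebra_simps add_increasing2)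
    then show "cmod (1 - \<i> * of_real \<epsilon> * z) \<ge> 1" "cmod (1 - \<i> * of_real \<epsilon> * z) \<ge> \<epsilon> * cmod z"
      by (auto intro: power2_le_imp_le)
  qed
  have main: "cmod (h w) \<le> M' * cmod (1 - \<i> * of_real \<epsilon> * w)" if \<epsilon>: "\<epsilon> > 0" for \<epsilon>
  proof -
    define R where "R = max (cmod w + 1) (B / (\<epsilon> * M'))"
    define k where "k z = h z / (1 - \<i> * of_real \<epsilon> * z)" for z
    define S where "S = ball (0::complex) R \<inter> {z. Im z > 0}"
    have S: "open S" unfolding S_def by (intro open_Int open_ball open_halfspace_Im_gt)
    have clS: "closure S \<subseteq> cball 0 R \<inter> {z. Im z \<ge> 0}"
      by (rule closure_minimal) (auto simp: S_def intro!: closed_Int closed_halfspace_Im_ge)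
    have nz: "1 - \<i> * of_real \<epsilon> * z \<noteq> 0" if "Im z \<ge> 0" for z
      using den(1)[OF \<epsilon> that] by (metis norm_zero not_one_le_zero)
    have "cmod (k w) \<le> M'"
    proof (rule maximum_modulus_frontier[where S = S and f = k and \<xi> = w])
      show "k holomorphic_on interior S"
        unfolding k_def interior_open[OF S]
        by (intro holomorphic_intros holomorphic_on_subset[OF hol] nz) (auto simp: S_def)
      show "continuous_on (closure S) k"
        unfolding k_def by (intro continuous_intros continuous_on_subset[OF cont]) (use clS nz in auto)
      show "bounded S" unfolding S_def by (simp add: bounded_Int)
      have "cmod w < R" by (simp add: R_def less_max_iff_disj)
      then show "w \<in> S" using w by (simp add: S_def)
      fix z assume "z \<in> frontier S"
      then have z: "z \<in> closure S" "z \<notin> S" using S by (auto simp: frontier_def interior_open)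
      then have z': "cmod z \<le> R" "Im z \<ge> 0" using clS by auto
      have n1: "cmod (k z) = cmod (h z) / cmod (1 - \<i> * of_real \<epsilon> * z)" by (simp add: k_def norm_divide)
      consider "Im z = 0" | "cmod z = R" using z z' by (force simp: S_def)
      then show "cmod (k z) \<le> M'"
      proof cases
        case 1
        then have "z = of_real (Re z)" by (simp add: complex_eq_iff)
        then have hz: "cmod (h z) \<le> M'" using real[of "Re z"] \<eta> by (simp add: M'_def)
        have "cmod (h z) / cmod (1 - \<i> * of_real \<epsilon> * z) \<le> cmod (h z) / 1"
          using den(1)[OF \<epsilon> z'(2)] by (intro divide_left_mono) auto
        then show ?thesis using hz n1 by simp
      next
        case 2
        have "B / (\<epsilon> * M') \<le> R" by (simp add: R_def)
        then have "B \<le> M' * (\<epsilon> * cmod z)" using \<epsilon> M 2 by (simp add: field_simps)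
        also have "\<dots> \<le> M' * cmod (1 - \<i> * of_real \<epsilon> * z)" using den(2)[OF \<epsilon> z'(2)] M by (intro mult_left_mono) auto
        finally have "cmod (h z) \<le> M' * cmod (1 - \<i> * of_real \<epsilon> * z)" using bdd[OF z'(2)] by linarith
        moreover have "0 < cmod (1 - \<i> * of_real \<epsilon> * z)" using nz[OF z'(2)] by simp
        ultimately show ?thesis unfolding n1 by (simp add: field_simps)
      qed
    qed
    moreover have "0 < cmod (1 - \<i> * of_real \<epsilon> * w)" using nz[of w] w by simp
    ultimately show ?thesis by (simp add: k_def norm_divide field_simps)
  qed
  have "((\<lambda>\<epsilon>. M' * cmod (1 - \<i> * of_real \<epsilon> * w)) \<longlongrightarrow> M' * cmod (1 - \<i> * of_real 0 * w)) (at_right 0)"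
    by (intro tendsto_intros)
  moreover have "\<forall>\<^sub>F \<epsilon> in at_right 0. cmod (h w) \<le> M' * cmod (1 - \<i> * of_real \<epsilon> * w)"
    using main by (simp add: eventually_at_right_less eventually_mono[OF eventually_at_right_less])
  ultimately have "cmod (h w) \<le> M' * cmod (1 - \<i> * of_real 0 * w)"
    by (rule tendsto_lowerbound) simp
  then show "cmod (h w) \<le> M + \<eta>" by (simp add: M'_def)
qed

lemma bounded_tube_maximum:
  assumes T: "bounded_tube \<Phi> C" and cone: "pos_cone C"
    and M: "\<And>x. cmod (\<Phi> x 0) \<le> M" and y: "y \<in> C"
  shows "cmod (\<Phi> x y) \<le> M"
proof -
  define h where "h w = \<Phi> (x + Re w *\<^sub>R y) (Im w *\<^sub>R y)" for w
  obtain B where B: "\<And>x t. t \<ge> 0 \<Longrightarrow> cmod (\<Phi> x (t *\<^sub>R y)) \<le> B" using T y unfolding bounded_tube_def by blast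
  have "cmod (h \<i>) \<le> M"
  proof (rule half_plane_maximum[where h = h and w = \<i>])
    have c: "continuous_on (UNIV \<times> {0..}) (\<lambda>p. \<Phi> (fst p) (snd p *\<^sub>R y))" using T y unfolding bounded_tube_def by blast
    have "continuous_on {w. Im w \<ge> 0} (\<lambda>w. (\<lambda>p. \<Phi> (fst p) (snd p *\<^sub>R y)) (x + Re w *\<^sub>R y, Im w))"
      by (rule continuous_on_compose2[OF c]) (auto intro!: continuous_intros)
    then show "continuous_on {w. Im w \<ge> 0} h" by (simp add: h_def[abs_def])
    have hh: "(\<lambda>w. \<Phi> (x + Re w *\<^sub>R y) (0 + Im w *\<^sub>R y)) holomorphic_on {w. 0 + Im w *\<^sub>R y \<in> C}"
      using T unfolding bounded_tube_def tube_holomorphic_def by blast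
    show "h holomorphic_on {w. Im w > 0}"
      using holomorphic_on_subset[OF hh, of "{w. Im w > 0}"] pos_coneD[OF cone y] by (auto simp: h_def[abs_def])
    show "cmod (h w) \<le> B" if "Im w \<ge> 0" for w unfolding h_def by (rule B[OF that])
    show "cmod (h (of_real t)) \<le> M" for t unfolding h_def using M by simp
  qed simp
  then show ?thesis by (simp add: h_def)
qed

lemma tube_holomorphic_continuous_y:
  assumes "tube_holomorphic \<Phi> C" shows "continuous_on C (\<lambda>y. \<Phi> x y)"
proof -
  have "continuous_on C (\<lambda>y. (\<lambda>p. \<Phi> (fst p) (snd p)) (x, y))"
    by (rule continuous_on_compose2[where t = "UNIV \<times> C"]) (use assms in \<open>auto simp: tube_holomorphic_def intro!: continuous_intros\<close>)
  then show ?thesis by simp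
qed

lemma tube_holomorphic_diff:
  "tube_holomorphic \<Phi> C \<Longrightarrow> tube_holomorphic \<Psi> C \<Longrightarrow> tube_holomorphic (\<lambda>x y. \<Phi> x y - \<Psi> x y) C"
  unfolding tube_holomorphic_def by (auto intro!: continuous_intros holomorphic_intros)

lemma tube_holomorphic_mult:
  "tube_holomorphic \<Phi> C \<Longrightarrow> tube_holomorphic \<Psi> C \<Longrightarrow> tube_holomorphic (\<lambda>x y. \<Phi> x y * \<Psi> x y) C"
  unfolding tube_holomorphic_def by (auto intro!: continuous_intros holomorphic_intros)

lemma tube_holomorphic_subset:
  assumes "tube_holomorphic \<Phi> C" "D \<subseteq> C" shows "tube_holomorphic \<Phi> D"
  unfolding tube_holomorphic_def
proof (intro conjI allI)
  show "continuous_on (UNIV \<times> D) (\<lambda>p. \<Phi> (fst p) (snd p))"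
    by (rule continuous_on_subset[where s = "UNIV \<times> C"]) (use assms in \<open>auto simp: tube_holomorphic_def\<close>)
  show "(\<lambda>w. \<Phi> (x + Re w *\<^sub>R v) (y + Im w *\<^sub>R v)) holomorphic_on {w. y + Im w *\<^sub>R v \<in> D}" for x y v
    by (rule holomorphic_on_subset[where s = "{w. y + Im w *\<^sub>R v \<in> C}"]) (use assms in \<open>auto simp: tube_holomorphic_def\<close>)
qed

lemma tube_holomorphic_translate:
  assumes "tube_holomorphic \<Phi> C" shows "tube_holomorphic (\<lambda>x y. \<Phi> (x + s) y) C"
  unfolding tube_holomorphic_def
proof (intro conjI allI)
  have "continuous_on (UNIV \<times> C) (\<lambda>p. (\<lambda>p. \<Phi> (fst p) (snd p)) (fst p + s, snd p))"
    by (rule continuous_on_compose2[where t = "UNIV \<times> C"]) (use assms in \<open>auto simp: tube_holomorphic_def intro!: continuous_intros\<close>)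
  then show "continuous_on (UNIV \<times> C) (\<lambda>p. \<Phi> (fst p + s) (snd p))" by simp
  have "(\<lambda>w. \<Phi> ((x + s) + Re w *\<^sub>R v) (y + Im w *\<^sub>R v)) holomorphic_on {w. y + Im w *\<^sub>R v \<in> C}" for x y v
    using assms unfolding tube_holomorphic_def by blast
  moreover have eq: "x + Re w *\<^sub>R v + s = x + s + Re w *\<^sub>R v" for x v :: 'a and w by (simp add: add_ac)
  ultimately show "(\<lambda>w. \<Phi> (x + Re w *\<^sub>R v + s) (y + Im w *\<^sub>R v)) holomorphic_on {w. y + Im w *\<^sub>R v \<in> C}" for x y v
    by (simp only: eq)
qed

definition exp_char :: "'a::euclidean_space \<Rightarrow> 'a \<Rightarrow> 'a \<Rightarrow> complex" where
  "exp_char l x y = exp (\<i> * of_real (x \<bullet> l) - of_real (y \<bullet> l))"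

lemma exp_char_0: "exp_char l x 0 = cis (x \<bullet> l)"
  by (simp add: exp_char_def cis_conv_exp)

lemma exp_char_eq: "exp_char l x y = of_real (exp (- (y \<bullet> l))) * cis (x \<bullet> l)"
  unfolding exp_char_def by (simp add: exp_diff exp_minus cis_conv_exp exp_of_real divide_inverse mult.commute)

lemma norm_exp_char: "cmod (exp_char l x y) = exp (- (y \<bullet> l))"
  by (simp add: exp_char_eq norm_mult)

lemma tube_holomorphic_exp_char: "tube_holomorphic (exp_char l) C"
  unfolding tube_holomorphic_def
proof (intro conjI allI)
  show "continuous_on (UNIV \<times> C) (\<lambda>p. exp_char l (fst p) (snd p))"
    unfolding exp_char_def by (intro continuous_intros)
  have "exp_char l (x + Re w *\<^sub>R v) (y + Im w *\<^sub>R v) = exp (\<i> * of_real (x \<bullet> l) - of_real (y \<bullet> l) + \<i> * w * of_real (v \<bullet> l))" for x y v w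
    unfolding exp_char_def by (rule arg_cong[where f = exp]) (simp add: complex_eq_iff inner_add_left algebra_simps)
  then show "(\<lambda>w. exp_char l (x + Re w *\<^sub>R v) (y + Im w *\<^sub>R v)) holomorphic_on {w. y + Im w *\<^sub>R v \<in> C}" for x y v
    by (simp add: holomorphic_intros)
qed

lemma bounded_tube_diff:
  assumes "bounded_tube \<Phi> C" "bounded_tube \<Psi> C"
  shows "bounded_tube (\<lambda>x y. \<Phi> x y - \<Psi> x y) C"
  unfolding bounded_tube_def
proof (intro conjI ballI)
  show "tube_holomorphic (\<lambda>x y. \<Phi> x y - \<Psi> x y) C"
    using assms by (intro tube_holomorphic_diff) (auto simp: bounded_tube_def)
  fix y assume y: "y \<in> C"
  show "continuous_on (UNIV \<times> {0..}) (\<lambda>p. \<Phi> (fst p) (snd p *\<^sub>R y) - \<Psi> (fst p) (snd p *\<^sub>R y))"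
    using assms y by (intro continuous_on_diff) (auto simp: bounded_tube_def)
  obtain B1 where B1: "\<forall>x. \<forall>t\<ge>0. cmod (\<Phi> x (t *\<^sub>R y)) \<le> B1" using assms(1) y unfolding bounded_tube_def by blast
  obtain B2 where B2: "\<forall>x. \<forall>t\<ge>0. cmod (\<Psi> x (t *\<^sub>R y)) \<le> B2" using assms(2) y unfolding bounded_tube_def by blast
  have "cmod (\<Phi> x (t *\<^sub>R y) - \<Psi> x (t *\<^sub>R y)) \<le> B1 + B2" if "t \<ge> 0" for x t
    using B1 B2 that norm_triangle_ineq4[of "\<Phi> x (t *\<^sub>R y)" "\<Psi> x (t *\<^sub>R y)"] by (smt (verit))
  then show "\<exists>B. \<forall>x. \<forall>t\<ge>0. cmod (\<Phi> x (t *\<^sub>R y) - \<Psi> x (t *\<^sub>R y)) \<le> B" by blast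
qed

lemma bounded_tube_mult:
  assumes "bounded_tube \<Phi> C" "bounded_tube \<Psi> C"
  shows "bounded_tube (\<lambda>x y. \<Phi> x y * \<Psi> x y) C"
  unfolding bounded_tube_def
proof (intro conjI ballI)
  show "tube_holomorphic (\<lambda>x y. \<Phi> x y * \<Psi> x y) C"
    using assms by (intro tube_holomorphic_mult) (auto simp: bounded_tube_def)
  fix y assume y: "y \<in> C"
  show "continuous_on (UNIV \<times> {0..}) (\<lambda>p. \<Phi> (fst p) (snd p *\<^sub>R y) * \<Psi> (fst p) (snd p *\<^sub>R y))"
    using assms y by (intro continuous_on_mult) (auto simp: bounded_tube_def)
  obtain B1 where B1: "\<forall>x. \<forall>t\<ge>0. cmod (\<Phi> x (t *\<^sub>R y)) \<le> B1" using assms(1) y unfolding bounded_tube_def by blast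
  obtain B2 where B2: "\<forall>x. \<forall>t\<ge>0. cmod (\<Psi> x (t *\<^sub>R y)) \<le> B2" using assms(2) y unfolding bounded_tube_def by blast
  have "cmod (\<Phi> x (t *\<^sub>R y) * \<Psi> x (t *\<^sub>R y)) \<le> B1 * B2" if t: "t \<ge> 0" for x t
    unfolding norm_mult using B1 B2 t order_trans[OF norm_ge_zero] by (intro mult_mono) blast+
  then show "\<exists>B. \<forall>x. \<forall>t\<ge>0. cmod (\<Phi> x (t *\<^sub>R y) * \<Psi> x (t *\<^sub>R y)) \<le> B" by blast
qed

lemma bounded_tube_const: "bounded_tube (\<lambda>x y. c) C"
  unfolding bounded_tube_def tube_holomorphic_def by auto

lemma bounded_tube_sum:
  assumes "\<And>i. i \<in> I \<Longrightarrow> bounded_tube (\<Phi> i) C"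
  shows "bounded_tube (\<lambda>x y. \<Sum>i\<in>I. \<Phi> i x y) C"
  using assms
proof (induction I rule: infinite_finite_induct)
  case (insert i I)
  have "bounded_tube (\<lambda>x y. \<Phi> i x y - ((-1) * (\<Sum>i\<in>I. \<Phi> i x y))) C"
    by (intro bounded_tube_diff bounded_tube_mult bounded_tube_const insert) auto
  then show ?case using insert.hyps by simp
qed (simp_all add: bounded_tube_const)

lemma bounded_tube_exp_char:
  assumes "\<And>y. y \<in> C \<Longrightarrow> y \<bullet> l \<ge> 0" shows "bounded_tube (exp_char l) C"
  unfolding bounded_tube_def
proof (intro conjI ballI)
  show "tube_holomorphic (exp_char l) C" by (rule tube_holomorphic_exp_char)
  fix y assume y: "y \<in> C"
  show "continuous_on (UNIV \<times> {0..}) (\<lambda>p. exp_char l (fst p) (snd p *\<^sub>R y))"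
    unfolding exp_char_def by (intro continuous_intros)
  show "\<exists>B. \<forall>x. \<forall>t\<ge>0. cmod (exp_char l x (t *\<^sub>R y)) \<le> B"
    by (rule exI[of _ 1]) (use assms[OF y] in \<open>simp add: norm_exp_char\<close>)
qed

lemma bounded_tube_translate:
  assumes "bounded_tube \<Phi> C" shows "bounded_tube (\<lambda>x y. \<Phi> (x + s) y) C"
  unfolding bounded_tube_def
proof (intro conjI ballI)
  show "tube_holomorphic (\<lambda>x y. \<Phi> (x + s) y) C"
    using assms by (intro tube_holomorphic_translate) (simp add: bounded_tube_def)
  fix y assume y: "y \<in> C"
  have "continuous_on (UNIV \<times> {0..}) (\<lambda>p. (\<lambda>p. \<Phi> (fst p) (snd p *\<^sub>R y)) (fst p + s, snd p))"
    by (rule continuous_on_compose2[where t = "UNIV \<times> {0..}"])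
      (use assms y in \<open>auto simp: bounded_tube_def intro!: continuous_intros\<close>)
  then show "continuous_on (UNIV \<times> {0..}) (\<lambda>p. \<Phi> (fst p + s) (snd p *\<^sub>R y))" by simp
  show "\<exists>B. \<forall>x. \<forall>t\<ge>0. cmod (\<Phi> (x + s) (t *\<^sub>R y)) \<le> B"
    using assms y unfolding bounded_tube_def by meson
qed

text \<open>The maximum principle turns almost periods of the boundary values into almost periods on every
level of the tube.\<close>

lemma bounded_tube_close:
  assumes T: "bounded_tube \<Phi> C" and cone: "pos_cone C"
    and cl: "close_translates (\<lambda>x. \<Phi> x 0) d x x'" and y: "y \<in> C"
  shows "cmod (\<Phi> x y - \<Phi> x' y) \<le> d"
proof -
  have "bounded_tube (\<lambda>u y. \<Phi> (u + x) y - \<Phi> (u + x') y) C"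
    by (intro bounded_tube_diff bounded_tube_translate T)
  moreover have "cmod (\<Phi> (u + x) 0 - \<Phi> (u + x') 0) \<le> d" for u
    using close_translatesD[OF cl, of u] by (simp add: dist_norm add.commute)
  ultimately have "cmod (\<Phi> (0 + x) y - \<Phi> (0 + x') y) \<le> d"
    by (rule bounded_tube_maximum[OF _ cone _ y])
  then show ?thesis by simp
qed

lemma bounded_tube_ap:
  assumes T: "bounded_tube \<Phi> C" and cone: "pos_cone C"
    and ap: "ap (\<lambda>x. \<Phi> x 0)" and y: "y \<in> C"
  shows "ap (\<lambda>x. \<Phi> x y)"
  by (rule ap_dominated[OF ap]) (use bounded_tube_close[OF T cone _ y] in \<open>auto simp: dominated_def dist_norm\<close>)

text \<open>As \<open>bounded_tube_close\<close> holds on all levels at once, convergence needs to be checked at the finitely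
many points of a net only.\<close>

lemma bounded_tube_uniform_tendsto:
  assumes T: "bounded_tube \<Phi> C" and cone: "pos_cone C"
    and ap: "ap (\<lambda>x. \<Phi> x 0)" and pw: "\<And>x. ((\<lambda>i. \<Phi> x (\<gamma> i)) \<longlongrightarrow> \<Phi> x y) F"
    and \<gamma>: "\<forall>\<^sub>F i in F. \<gamma> i \<in> C" and y: "y \<in> C \<or> y = 0" and e: "e > 0"
  shows "\<forall>\<^sub>F i in F. \<forall>x. cmod (\<Phi> x (\<gamma> i) - \<Phi> x y) \<le> e"
proof -
  obtain X where X: "finite X" "\<And>x. \<exists>x'\<in>X. close_translates (\<lambda>x. \<Phi> x 0) (e/3) x x'"
    using ap_net[OF ap, of "e/3"] e by auto
  have "\<forall>\<^sub>F i in F. \<forall>x\<in>X. dist (\<Phi> x (\<gamma> i)) (\<Phi> x y) < e/3"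
    using X(1) e by (intro eventually_ball_finite ballI tendstoD[OF pw]) auto
  with \<gamma> show ?thesis
  proof eventually_elim
    case (elim i)
    show ?case
    proof
      fix x
      obtain x' where x': "x' \<in> X" "close_translates (\<lambda>x. \<Phi> x 0) (e/3) x x'" using X(2) by blast
      have 1: "cmod (\<Phi> x (\<gamma> i) - \<Phi> x' (\<gamma> i)) \<le> e/3" by (rule bounded_tube_close[OF T cone x'(2) elim(1)])
      have 2: "cmod (\<Phi> x y - \<Phi> x' y) \<le> e/3"
        using y bounded_tube_close[OF T cone x'(2)] close_translates_dist[OF x'(2)] by (auto simp: dist_norm)
      have 3: "cmod (\<Phi> x' (\<gamma> i) - \<Phi> x' y) \<le> e/3" using elim(2) x'(1) by (force simp: dist_norm)
      have "\<Phi> x (\<gamma> i) - \<Phi> x y = (\<Phi> x (\<gamma> i) - \<Phi> x' (\<gamma> i)) + (\<Phi> x' (\<gamma> i) - \<Phi> x' y) - (\<Phi> x y - \<Phi> x' y)" by simp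
      also have "cmod \<dots> \<le> e/3 + e/3 + e/3"
        using 1 2 3 norm_triangle_ineq4 norm_triangle_ineq by (smt (verit))
      finally show "cmod (\<Phi> x (\<gamma> i) - \<Phi> x y) \<le> e" by simp
    qed
  qed
qed

section \<open>Dependence of Fourier coefficients on the level\<close>

definition uniformly_continuous_levels :: "('a::euclidean_space \<Rightarrow> 'a \<Rightarrow> complex) \<Rightarrow> 'a set \<Rightarrow> bool" where
  "uniformly_continuous_levels \<Phi> C \<longleftrightarrow>
     (\<forall>y\<in>C. \<forall>e>0. \<exists>d>0. \<forall>y'\<in>C. dist y' y < d \<longrightarrow> (\<forall>x. cmod (\<Phi> x y' - \<Phi> x y) \<le> e))"

lemma bounded_tube_levels:
  assumes T: "bounded_tube \<Phi> C" and cone: "pos_cone C"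
    and ap: "ap (\<lambda>x. \<Phi> x 0)"
  shows "uniformly_continuous_levels \<Phi> C"
  unfolding uniformly_continuous_levels_def
proof (intro ballI allI impI)
  fix y e assume y: "y \<in> C" and e: "(0::real) < e"
  have "\<forall>\<^sub>F y' in at y within C. \<forall>x. cmod (\<Phi> x y' - \<Phi> x y) \<le> e"
  proof (rule bounded_tube_uniform_tendsto[OF T cone ap _ _ _ e])
    have "tube_holomorphic \<Phi> C" using T by (simp add: bounded_tube_def)
    from tube_holomorphic_continuous_y[OF this]
    show "((\<lambda>i. \<Phi> x i) \<longlongrightarrow> \<Phi> x y) (at y within C)" for x using y by (simp add: continuous_on_def)
    show "\<forall>\<^sub>F i in at y within C. i \<in> C" by (simp add: eventually_at_filter)
  qed (use y in auto)
  then obtain d where "d > 0" "\<And>y'. y' \<in> C \<Longrightarrow> y' \<noteq> y \<Longrightarrow> dist y' y < d \<Longrightarrow> \<forall>x. cmod (\<Phi> x y' - \<Phi> x y) \<le> e"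
    unfolding eventually_at by blast
  then have "\<forall>y'\<in>C. dist y' y < d \<longrightarrow> (\<forall>x. cmod (\<Phi> x y' - \<Phi> x y) \<le> e)"
    using e by (metis cancel_comm_monoid_add_class.diff_cancel less_imp_le norm_zero)
  with \<open>d > 0\<close> show "\<exists>d>0. \<forall>y'\<in>C. dist y' y < d \<longrightarrow> (\<forall>x. cmod (\<Phi> x y' - \<Phi> x y) \<le> e)" by blast
qed

text \<open>Let \<open>u w\<close> be the mean over \<open>x\<close> of \<open>\<Phi>\<close> at the point \<open>x + iy + wv\<close>, times \<open>cis (- (x \<bullet> l))\<close>. It is holomorphic as
a locally uniform limit of finite convex combinations of values at points \<open>x\<close>. Invariance of the mean under
translations shows that \<open>u w * exp (- \<i>w(v \<bullet> l))\<close> depends on \<open>Im w\<close> only, so this function is constant.\<close>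

lemma fourier_level:
  fixes \<Phi> :: "'a::euclidean_space \<Rightarrow> 'a \<Rightarrow> complex"
  assumes T: "tube_holomorphic \<Phi> C" and C: "open C" "convex C"
    and ap: "\<And>y. y \<in> C \<Longrightarrow> ap (\<lambda>x. \<Phi> x y)" and uc: "uniformly_continuous_levels \<Phi> C"
    and y: "y \<in> C" "y + v \<in> C"
  shows "fourier (\<lambda>x. \<Phi> x (y + v)) l = of_real (exp (- (v \<bullet> l))) * fourier (\<lambda>x. \<Phi> x y) l"
proof -
  define \<Omega> where "\<Omega> = {w. y + Im w *\<^sub>R v \<in> C}"
  define h where "h w x = \<Phi> (x + Re w *\<^sub>R v) (y + Im w *\<^sub>R v) * cis (- (x \<bullet> l))" for w x
  have op: "open \<Omega>" unfolding \<Omega>_def by (rule open_slice[OF C(1)])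
  have cv: "convex \<Omega>" unfolding \<Omega>_def by (rule convex_slice[OF C(2)])
  have aph: "ap (h w)" if "w \<in> \<Omega>" for w
    unfolding h_def by (intro ap_intros ap_translate(1)[OF ap]) (use that in \<open>simp add: \<Omega>_def\<close>)
  have holh: "(\<lambda>w. h w x) holomorphic_on \<Omega>" for x
    unfolding h_def \<Omega>_def using T unfolding tube_holomorphic_def by (intro holomorphic_intros) blast
  have cont: "\<exists>d>0. \<forall>w\<in>\<Omega>. dist w w1 < d \<longrightarrow> (\<forall>x. cmod (h w x - h w1 x) \<le> e)" if w1: "w1 \<in> \<Omega>" and e: "e > 0" for w1 e
  proof -
    define y1 where "y1 = y + Im w1 *\<^sub>R v"
    have y1: "y1 \<in> C" using w1 by (simp add: y1_def \<Omega>_def)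
    obtain d1 where d1: "d1 > 0" "\<And>y' x. y' \<in> C \<Longrightarrow> dist y' y1 < d1 \<Longrightarrow> cmod (\<Phi> x y' - \<Phi> x y1) \<le> e/2"
      using uc y1 e unfolding uniformly_continuous_levels_def by (metis half_gt_zero)
    obtain d2 where d2: "d2 > 0" "\<And>x x'. dist x x' < d2 \<Longrightarrow> close_translates (\<lambda>x. \<Phi> x y1) (e/2) x x'"
      using ap_uniformly_close[OF ap[OF y1], of "e/2"] e by auto
    define d where "d = min d1 d2 / (norm v + 1)"
    have d: "d > 0" using d1 d2 by (simp add: d_def add_nonneg_pos)
    have "cmod (h w x - h w1 x) \<le> e" if w: "w \<in> \<Omega>" "dist w w1 < d" for w x
    proof -
      have "cmod (w - w1) * (norm v + 1) < min d1 d2"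
        using w(2) by (simp add: d_def dist_norm pos_less_divide_eq add_nonneg_pos)
      moreover have "\<bar>t\<bar> * norm v \<le> cmod (w - w1) * (norm v + 1)" if "\<bar>t\<bar> \<le> cmod (w - w1)" for t
        using that by (intro mult_mono) auto
      ultimately have "\<bar>Im (w - w1)\<bar> * norm v < d1" "\<bar>Re (w - w1)\<bar> * norm v < d2"
        using abs_Im_le_cmod[of "w - w1"] abs_Re_le_cmod[of "w - w1"] by (meson le_less_trans min_less_iff_conj)+
      moreover have "dist (y + Im w *\<^sub>R v) y1 = \<bar>Im (w - w1)\<bar> * norm v"
        by (simp add: y1_def dist_norm flip: scaleR_left_diff_distrib)
      moreover have "dist (x + Re w *\<^sub>R v) (x + Re w1 *\<^sub>R v) = \<bar>Re (w - w1)\<bar> * norm v"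
        by (simp add: dist_norm flip: scaleR_left_diff_distrib)
      ultimately have dd: "dist (y + Im w *\<^sub>R v) y1 < d1" "dist (x + Re w *\<^sub>R v) (x + Re w1 *\<^sub>R v) < d2" by simp_all
      have 1: "cmod (\<Phi> (x + Re w *\<^sub>R v) (y + Im w *\<^sub>R v) - \<Phi> (x + Re w *\<^sub>R v) y1) \<le> e/2"
        by (rule d1(2)[OF _ dd(1)]) (use w(1) in \<open>simp add: \<Omega>_def\<close>)
      have 2: "cmod (\<Phi> (x + Re w *\<^sub>R v) y1 - \<Phi> (x + Re w1 *\<^sub>R v) y1) \<le> e/2"
        using close_translates_dist[OF d2(2)[OF dd(2)]] by (simp add: dist_norm)
      have "cmod (h w x - h w1 x) = cmod (\<Phi> (x + Re w *\<^sub>R v) (y + Im w *\<^sub>R v) - \<Phi> (x + Re w1 *\<^sub>R v) y1)"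
        unfolding h_def y1_def by (simp add: left_diff_distrib[symmetric] norm_mult)
      also have "\<dots> \<le> e/2 + e/2" by (rule norm_diff_triangle_le[OF 1 2])
      finally show ?thesis by simp
    qed
    with d show ?thesis by blast
  qed
  define u where "u w = mean (h w)" for w
  have hol_u: "u holomorphic_on \<Omega>"
  proof -
    have "\<exists>\<rho>>0. u holomorphic_on ball w0 \<rho>" if w0: "w0 \<in> \<Omega>" for w0
    proof -
      obtain \<rho> where \<rho>: "\<rho> > 0" "cball w0 \<rho> \<subseteq> \<Omega>" using op w0 open_contains_cball by blast
      define H where "H = h ` cball w0 \<rho>"
      have nets: "finite_nets H"
        unfolding finite_nets_def
      proof (intro allI impI)
        fix e :: real assume e: "e > 0"
        have "\<forall>w1\<in>cball w0 \<rho>. \<exists>d>0. \<forall>w\<in>\<Omega>. dist w w1 < d \<longrightarrow> (\<forall>x. cmod (h w x - h w1 x) \<le> e)"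
          using cont[OF _ e] \<rho>(2) by blast
        from bchoice[OF this] obtain d where d: "\<And>w1. w1 \<in> cball w0 \<rho> \<Longrightarrow> d w1 > 0"
          "\<And>w1 w x. w1 \<in> cball w0 \<rho> \<Longrightarrow> w \<in> \<Omega> \<Longrightarrow> dist w w1 < d w1 \<Longrightarrow> cmod (h w x - h w1 x) \<le> e" by blast
        have "cball w0 \<rho> \<subseteq> (\<Union>w1\<in>cball w0 \<rho>. ball w1 (d w1))" using d(1) by auto
        then obtain W where W: "W \<subseteq> cball w0 \<rho>" "finite W" "cball w0 \<rho> \<subseteq> (\<Union>w1\<in>W. ball w1 (d w1))"
          by (rule compactE_image[OF compact_cball open_ball])
        show "\<exists>J. finite J \<and> J \<subseteq> H \<and> (\<forall>k\<in>H. \<exists>j\<in>J. \<forall>x. cmod (k x - j x) \<le> e)"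
        proof (intro exI[of _ "h ` W"] conjI ballI)
          show "finite (h ` W)" "h ` W \<subseteq> H" using W by (auto simp: H_def)
          fix k assume "k \<in> H"
          then obtain w where w: "w \<in> cball w0 \<rho>" "k = h w" by (auto simp: H_def)
          then obtain w1 where w1: "w1 \<in> W" "w \<in> ball w1 (d w1)" using W(3) by blast
          have "w1 \<in> cball w0 \<rho>" "w \<in> \<Omega>" "dist w w1 < d w1"
            using w w1 W(1) \<rho>(2) by (auto simp: dist_commute)
          from d(2)[OF this] have "\<forall>x. cmod (k x - h w1 x) \<le> e" unfolding w(2) by blast
          then show "\<exists>j\<in>h ` W. \<forall>x. cmod (k x - j x) \<le> e" using w1(1) by blast
        qed
      qed
      have apH: "ap k" if "k \<in> H" for k using that \<rho>(2) aph by (auto simp: H_def)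
      have "\<exists>X c. finite X \<and> (\<forall>w\<in>cball w0 \<rho>. cmod (u w - (\<Sum>x\<in>X. c x *\<^sub>R h w x)) \<le> 1 / real (Suc n))" for n
        using mean_uniform_approx[OF nets apH, of "1 / real (Suc n)"] unfolding H_def u_def by auto
      then obtain X c where Xc: "\<And>n. finite (X n)"
          "\<And>n w. w \<in> cball w0 \<rho> \<Longrightarrow> cmod (u w - (\<Sum>x\<in>X n. c n x *\<^sub>R h w x)) \<le> 1 / real (Suc n)" by metis
      define p where "p n w = (\<Sum>x\<in>X n. c n x *\<^sub>R h w x)" for n w
      have holp: "p n holomorphic_on \<Omega>" for n
        unfolding p_def scaleR_conv_of_real by (intro holomorphic_intros holh)
      have lim: "uniform_limit (cball w0 \<rho>) p u sequentially"
        unfolding uniform_limit_sequentially_iff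
      proof (intro allI impI)
        fix e :: real assume "e > 0"
        then obtain N where N: "1 / real (Suc N) < e" using nat_approx_posE by blast
        have "dist (p n w) (u w) < e" if "n \<ge> N" "w \<in> cball w0 \<rho>" for n w
        proof -
          have "dist (p n w) (u w) \<le> 1 / real (Suc n)" using Xc(2)[OF that(2)] by (simp add: p_def dist_norm norm_minus_commute)
          also have "\<dots> \<le> 1 / real (Suc N)" using that(1) by (simp add: frac_le)
          finally show ?thesis using N by simp
        qed
        then show "\<exists>N. \<forall>n\<ge>N. \<forall>w\<in>cball w0 \<rho>. dist (p n w) (u w) < e" by blast
      qed
      have "\<forall>\<^sub>F n in sequentially. continuous_on (cball w0 \<rho>) (p n) \<and> p n holomorphic_on ball w0 \<rho>"
        using holp \<rho>(2) ball_subset_cball[of w0 \<rho>]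
        by (intro always_eventually allI conjI holomorphic_on_imp_continuous_on) (blast intro: holomorphic_on_subset)+
      from holomorphic_uniform_limit[OF this lim sequentially_bot] have "u holomorphic_on ball w0 \<rho>" by blast
      with \<rho>(1) show ?thesis by blast
    qed
    then show ?thesis
      using op unfolding holomorphic_on_def
      by (metis at_within_open centre_in_ball open_ball)
  qed
  define U where "U s = fourier (\<lambda>x. \<Phi> x (y + s *\<^sub>R v)) l" for s
  have u_eq: "u w = cis (Re w * (v \<bullet> l)) * U (Im w)" if "w \<in> \<Omega>" for w
    using fourier_translate[OF ap, of "y + Im w *\<^sub>R v" "Re w *\<^sub>R v" l] that
    unfolding u_def h_def U_def fourier_def[of "\<lambda>x. \<Phi> (x + Re w *\<^sub>R v) (y + Im w *\<^sub>R v)"] by (simp add: \<Omega>_def)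
  define g where "g w = u w * exp (- (\<i> * w * of_real (v \<bullet> l)))" for w
  have holg: "g holomorphic_on \<Omega>" unfolding g_def by (intro holomorphic_intros hol_u)
  have g_eq: "g w = U (Im w) * of_real (exp (Im w * (v \<bullet> l)))" if "w \<in> \<Omega>" for w
  proof -
    have "cis (Re w * (v \<bullet> l)) * exp (- (\<i> * w * of_real (v \<bullet> l))) = of_real (exp (Im w * (v \<bullet> l)))"
      unfolding cis_conv_exp exp_of_real[symmetric] exp_add[symmetric]
      by (rule arg_cong[where f = exp]) (simp add: complex_eq_iff algebra_simps)
    then show ?thesis unfolding g_def u_eq[OF that] by (metis mult.assoc mult.commute)
  qed
  have "(g has_field_derivative 0) (at w)" if w: "w \<in> \<Omega>" for w
  proof -
    obtain D where D: "(g has_field_derivative D) (at w)"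
      using holg op w by (metis holomorphic_on_open field_differentiable_def holomorphic_on_imp_differentiable_at)
    have line: "((\<lambda>t::real. w + of_real t) has_vector_derivative 1) (at 0)"
      by (auto intro!: derivative_eq_intros simp: has_vector_derivative_def scaleR_conv_of_real)
    have "((\<lambda>t::real. g (w + of_real t)) has_vector_derivative (1 * D)) (at 0)"
      using field_vector_diff_chain_at[OF line, of g D] D by (simp add: o_def)
    moreover have "w + of_real t \<in> \<Omega>" for t using w by (simp add: \<Omega>_def)
    then have "g (w + of_real t) = g w" for t using g_eq w by simp
    ultimately have "((\<lambda>t::real. g w) has_vector_derivative D) (at 0)" by simp
    then have "D = 0" using vector_derivative_unique_at has_vector_derivative_const by blast
    with D show ?thesis by simp
  qed
  then have "\<exists>c. \<forall>w\<in>\<Omega>. g w = c"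
    using has_field_derivative_zero_constant[OF cv] has_field_derivative_at_within by metis
  moreover have "0 \<in> \<Omega>" "\<i> \<in> \<Omega>" using y by (auto simp: \<Omega>_def)
  ultimately have "g 0 = g \<i>" by metis
  then have "U 0 = U 1 * of_real (exp (v \<bullet> l))" using g_eq \<open>0 \<in> \<Omega>\<close> \<open>\<i> \<in> \<Omega>\<close> by simp
  then have "of_real (exp (- (v \<bullet> l))) * U 0 = U 1 * (of_real (exp (- (v \<bullet> l))) * of_real (exp (v \<bullet> l)))" by simp
  also have "of_real (exp (- (v \<bullet> l))) * of_real (exp (v \<bullet> l)) = (1::complex)"
    by (simp only: of_real_mult[symmetric] exp_add[symmetric]) simp
  finally show ?thesis by (simp add: U_def)
qed

lemma fourier_level_boundary:
  assumes T: "bounded_tube \<Phi> C" and C: "open C" "convex C" and cone: "pos_cone C"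
    and ap: "ap (\<lambda>x. \<Phi> x 0)" and y: "y \<in> C"
  shows "fourier (\<lambda>x. \<Phi> x y) l = of_real (exp (- (y \<bullet> l))) * fourier (\<lambda>x. \<Phi> x 0) l"
proof -
  have lim1: "((\<lambda>s. fourier (\<lambda>x. \<Phi> x (s *\<^sub>R y)) l) \<longlongrightarrow> fourier (\<lambda>x. \<Phi> x 0) l) (at_right (0::real))"
  proof (rule tendstoI)
    fix e :: real assume e: "e > 0"
    have pos: "\<forall>\<^sub>F s::real in at_right 0. s *\<^sub>R y \<in> C"
      by (rule eventually_mono[OF eventually_at_right_less]) (rule pos_coneD[OF cone y])
    have "\<forall>\<^sub>F s in at_right (0::real). \<forall>x. cmod (\<Phi> x (s *\<^sub>R y) - \<Phi> x 0) \<le> e/2"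
    proof (rule bounded_tube_uniform_tendsto[OF T cone ap _ pos])
      fix x
      have "continuous_on (UNIV \<times> {0..}) (\<lambda>p. \<Phi> (fst p) (snd p *\<^sub>R y))" using T y by (auto simp: bounded_tube_def)
      then have "continuous_on {0..} (\<lambda>s. (\<lambda>p. \<Phi> (fst p) (snd p *\<^sub>R y)) (x, s))"
        by (rule continuous_on_compose2) (auto intro!: continuous_intros)
      then have "((\<lambda>s. \<Phi> x (s *\<^sub>R y)) \<longlongrightarrow> \<Phi> x (0 *\<^sub>R y)) (at 0 within {0..})"
        unfolding continuous_on_def fst_conv snd_conv by (rule bspec) simp
      then show "((\<lambda>s. \<Phi> x (s *\<^sub>R y)) \<longlongrightarrow> \<Phi> x 0) (at_right 0)"
        unfolding scaleR_zero_left by (rule tendsto_mono[OF at_le, rotated]) auto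
    qed (use e in auto)
    then show "\<forall>\<^sub>F s in at_right (0::real). dist (fourier (\<lambda>x. \<Phi> x (s *\<^sub>R y)) l) (fourier (\<lambda>x. \<Phi> x 0) l) < e"
      using pos
    proof eventually_elim
      case (elim s)
      have "cmod (fourier (\<lambda>x. \<Phi> x (s *\<^sub>R y)) l - fourier (\<lambda>x. \<Phi> x 0) l) \<le> e/2"
        by (rule fourier_close[OF bounded_tube_ap[OF T cone ap elim(2)] ap]) (use elim in auto)
      then show ?case using e by (simp add: dist_norm)
    qed
  qed
  have "((\<lambda>s. of_real (exp (- ((1 - s) * (y \<bullet> l)))) * fourier (\<lambda>x. \<Phi> x (s *\<^sub>R y)) l)
      \<longlongrightarrow> of_real (exp (- ((1 - 0) * (y \<bullet> l)))) * fourier (\<lambda>x. \<Phi> x 0) l) (at_right (0::real))"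
    by (intro tendsto_intros lim1)
  moreover have "\<forall>\<^sub>F s in at_right (0::real). of_real (exp (- ((1 - s) * (y \<bullet> l)))) * fourier (\<lambda>x. \<Phi> x (s *\<^sub>R y)) l = fourier (\<lambda>x. \<Phi> x y) l"
  proof (rule eventually_mono[OF eventually_at_right_less])
    fix s :: real assume s: "0 < s"
    have th: "tube_holomorphic \<Phi> C" using T by (simp add: bounded_tube_def)
    have "fourier (\<lambda>x. \<Phi> x (s *\<^sub>R y + (1 - s) *\<^sub>R y)) l = of_real (exp (- (((1 - s) *\<^sub>R y) \<bullet> l))) * fourier (\<lambda>x. \<Phi> x (s *\<^sub>R y)) l"
      by (rule fourier_level[OF th C bounded_tube_ap[OF T cone ap] bounded_tube_levels[OF T cone ap] pos_coneD[OF cone y s]])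
        (use y in \<open>simp_all add: algebra_simps\<close>)
    then show "of_real (exp (- ((1 - s) * (y \<bullet> l)))) * fourier (\<lambda>x. \<Phi> x (s *\<^sub>R y)) l = fourier (\<lambda>x. \<Phi> x y) l"
      by (simp add: algebra_simps)
  qed
  ultimately have "((\<lambda>s::real. fourier (\<lambda>x. \<Phi> x y) l) \<longlongrightarrow> of_real (exp (- ((1 - 0) * (y \<bullet> l)))) * fourier (\<lambda>x. \<Phi> x 0) l) (at_right 0)"
    by (rule Lim_transform_eventually)
  then show ?thesis by (simp add: tendsto_const_iff)
qed

section \<open>Logarithms of almost periodic functions\<close>

text \<open>The difference \<open>L2 - L1\<close> and the principal logarithm of the quotient of the exponentials, which is close to 1,
differ by a continuous function whose exponential is 1.\<close>

lemma log_quotient_branch: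
  fixes L1 L2 :: "'s::topological_space \<Rightarrow> complex"
  assumes S: "connected S" and L: "continuous_on S L1" "continuous_on S L2"
    and close: "\<And>s. s \<in> S \<Longrightarrow> cmod (exp (L2 s) - exp (L1 s)) \<le> \<eta> * cmod (exp (L1 s))" and \<eta>: "\<eta> < 1/2"
  shows "\<exists>k. \<forall>s\<in>S. cmod (L2 s - L1 s - k) \<le> 2 * \<eta>"
    and "s0 \<in> S \<Longrightarrow> L2 s0 = L1 s0 \<Longrightarrow> s \<in> S \<Longrightarrow> cmod (L2 s - L1 s) \<le> 2 * \<eta>"
proof -
  define q where "q s = exp (L2 s - L1 s)" for s
  have q: "cmod (q s - 1) \<le> \<eta>" if "s \<in> S" for s
  proof -
    have "(q s - 1) * exp (L1 s) = exp (L2 s) - exp (L1 s)" by (simp add: q_def exp_diff left_diff_distrib)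
    then have "cmod (q s - 1) * cmod (exp (L1 s)) \<le> \<eta> * cmod (exp (L1 s))"
      using close[OF that] by (metis norm_mult)
    then show ?thesis by (rule mult_right_le_imp_le) simp
  qed
  have Re_q: "Re (q s) > 0" if "s \<in> S" for s
    using q[OF that] \<eta> abs_Re_le_cmod[of "q s - 1"] by (simp add: abs_le_iff)
  have "(\<lambda>s. L2 s - L1 s - Ln (q s)) constant_on S"
  proof (rule continuous_exp_eq_1_constant[OF S])
    show "continuous_on S (\<lambda>s. L2 s - L1 s - Ln (q s))"
      unfolding q_def[abs_def]
      by (intro continuous_intros L) (use Re_q in \<open>force simp: q_def complex_nonpos_Reals_iff\<close>)
    show "exp (L2 s - L1 s - Ln (q s)) = 1" if "s \<in> S" for s
    proof -
      have "q s \<noteq> 0" by (simp add: q_def)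
      then show ?thesis by (simp add: exp_diff[of _ "Ln (q s)"]) (simp add: q_def)
    qed
  qed
  then obtain k where k: "\<And>s. s \<in> S \<Longrightarrow> L2 s - L1 s - Ln (q s) = k" unfolding constant_on_def by blast
  have Ln_le: "cmod (Ln (q s)) \<le> 2 * \<eta>" if "s \<in> S" for s
    using norm_Ln_le[of "q s - 1"] q[OF that] \<eta> by simp
  have "cmod (L2 s - L1 s - k) \<le> 2 * \<eta>" if "s \<in> S" for s
    using Ln_le[OF that] by (simp flip: k[OF that])
  then show "\<exists>k. \<forall>s\<in>S. cmod (L2 s - L1 s - k) \<le> 2 * \<eta>" by blast
  show "cmod (L2 s - L1 s) \<le> 2 * \<eta>" if s: "s0 \<in> S" "L2 s0 = L1 s0" "s \<in> S"
  proof -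
    have "k = 0" using k[OF s(1)] s(2) by (simp add: q_def)
    then show ?thesis using k[OF s(3)] Ln_le[OF s(3)] by simp
  qed
qed

text \<open>For an almost period \<open>t\<close> of \<open>g\<close> the increments \<open>D t s = L(s + t) - L(s)\<close> are nearly constant in \<open>s\<close>, and for every
\<open>t\<close> the function \<open>D t\<close> is almost periodic. Its mean \<open>c t\<close> is additive and
continuous in \<open>t\<close> with bounded real part, hence \<open>c t = \<i> (t \<bullet> \<kappa>)\<close>. When this linear function is subtracted from \<open>L\<close>, the increments over an
almost period of \<open>g\<close> are nearly constant with mean zero, that is, small.\<close>

theorem Bohr_logarithm:
  fixes g L :: "'a::euclidean_space \<Rightarrow> complex"
  assumes g: "ap g" and low: "\<And>x. \<delta> \<le> cmod (g x)" "\<delta> > 0"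
    and L: "continuous_on UNIV L" "\<And>x. g x = exp (L x)"
  obtains \<kappa> where "ap (\<lambda>x. L x - \<i> * of_real (x \<bullet> \<kappa>))"
proof -
  obtain B where B: "B > 0" "\<And>x. cmod (g x) \<le> B" using ap_bounded[OF g] by blast
  have contL: "continuous_on S (\<lambda>s. L (h s))" if "continuous_on S h" for S and h :: "'s::topological_space \<Rightarrow> 'a"
    by (rule continuous_on_compose2[OF L(1) that]) auto
  have period: "\<exists>k. \<forall>s. cmod (L (x + s) - L (y + s) - k) \<le> 2 * \<eta>"
    if \<eta>: "\<eta> < 1/2" and cl: "close_translates g (\<eta> * \<delta>) x y" for x y \<eta>
  proof -
    have \<eta>0: "0 \<le> \<eta>" using close_translatesD[OF cl, of 0] low(2) zero_le_dist[of "g (x + 0)" "g (y + 0)"]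
      by (metis dual_order.trans linorder_not_less mult_neg_pos)
    have "\<exists>k. \<forall>s\<in>UNIV. cmod (L (x + s) - L (y + s) - k) \<le> 2 * \<eta>"
    proof (rule log_quotient_branch(1)[OF connected_UNIV])
      show "continuous_on UNIV (\<lambda>s. L (x + s))" "continuous_on UNIV (\<lambda>s. L (y + s))"
        by (intro contL continuous_intros)+
      fix s
      have "cmod (g (x + s) - g (y + s)) \<le> \<eta> * \<delta>" using close_translatesD[OF cl, of s] by (simp add: dist_norm)
      also have "\<dots> \<le> \<eta> * cmod (g (y + s))" using low \<eta>0 by (intro mult_left_mono) auto
      finally show "cmod (exp (L (x + s)) - exp (L (y + s))) \<le> \<eta> * cmod (exp (L (y + s)))" by (simp flip: L(2))
    qed (rule \<eta>)
    then show ?thesis by simp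
  qed
  define D where "D t s = L (s + t) - L s" for t s
  have D_close: "cmod (D t x - D t y) \<le> 4 * \<eta>" if \<eta>: "\<eta> < 1/2" and cl: "close_translates g (\<eta> * \<delta>) x y" for t x y \<eta>
  proof -
    obtain k where k: "\<And>s. cmod (L (x + s) - L (y + s) - k) \<le> 2 * \<eta>" using period[OF \<eta> cl] by blast
    have "D t x - D t y = (L (x + t) - L (y + t) - k) - (L (x + 0) - L (y + 0) - k)" by (simp add: D_def)
    also have "cmod \<dots> \<le> 2 * \<eta> + 2 * \<eta>" by (intro norm_triangle_le_diff add_mono k)
    finally show ?thesis by simp
  qed
  have \<eta>_ex: "\<exists>\<eta>>0. \<eta> < 1/2 \<and> 4 * \<eta> \<le> e" if "e > 0" for e :: real
    using that by (intro exI[of _ "min (1/4) (e/4)"]) auto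
  have apD: "ap (D t)" for t
  proof (rule ap_dominated[OF g], unfold dominated_def, intro allI impI)
    fix e :: real assume "e > 0"
    then obtain \<eta> where \<eta>: "\<eta> > 0" "\<eta> < 1/2" "4 * \<eta> \<le> e" using \<eta>_ex by blast
    show "\<exists>d>0. \<forall>x y. close_translates g d x y \<longrightarrow> dist (D t x) (D t y) \<le> e"
    proof (intro exI[of _ "\<eta> * \<delta>"] conjI allI impI)
      show "dist (D t x) (D t y) \<le> e" if "close_translates g (\<eta> * \<delta>) x y" for x y
        using D_close[OF \<eta>(2) that, of t] \<eta>(3) by (simp add: dist_norm)
    qed (use \<eta> low in auto)
  qed
  define c where "c t = mean (D t)" for t
  have add: "c (t + t') = c t + c t'" for t t'
  proof -
    have "D (t + t') = (\<lambda>s. D t (s + t') + D t' s)" by (rule ext) (simp add: D_def add_ac)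
    then show ?thesis
      unfolding c_def by (simp add: mean_add ap_translate apD mean_translate)
  qed
  have small: "\<exists>d>0. \<forall>t. norm t < d \<longrightarrow> cmod (c t) \<le> e" if "e > 0" for e
  proof -
    obtain \<eta> where \<eta>: "\<eta> > 0" "\<eta> < 1/2" "4 * \<eta> \<le> e" using \<eta>_ex[OF \<open>e > 0\<close>] by blast
    obtain d where d: "d > 0" "\<And>x y. dist x y < d \<Longrightarrow> close_translates g (\<eta> * \<delta>) x y"
      using ap_uniformly_close[OF g, of "\<eta> * \<delta>"] \<eta> low by auto
    have "cmod (c t) \<le> e" if t: "norm t < d" for t
      unfolding c_def
    proof (rule norm_mean_bound[OF apD])
      fix s
      have "cmod (L (snd (t, s) + fst (t, s)) - L (snd (t, s))) \<le> 2 * \<eta>"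
      proof (rule log_quotient_branch(2)[where S = "ball 0 d \<times> UNIV" and ?s0.0 = "(0, s)"])
        show "connected ((ball 0 d :: 'a set) \<times> (UNIV :: 'a set))" by (intro connected_Times convex_connected convex_ball convex_UNIV)
        show "continuous_on ((ball 0 d :: 'a set) \<times> UNIV) (\<lambda>p. L (snd p))" "continuous_on ((ball 0 d :: 'a set) \<times> UNIV) (\<lambda>p. L (snd p + fst p))"
          by (intro contL continuous_intros)+
        fix p :: "'a \<times> 'a" assume "p \<in> ball 0 d \<times> UNIV"
        then have "close_translates g (\<eta> * \<delta>) (fst p) 0" using d(2)[of "fst p" 0] by (auto simp: dist_commute)
        from close_translatesD[OF this, of "snd p"] have "cmod (g (snd p + fst p) - g (snd p)) \<le> \<eta> * \<delta>"
          by (simp add: dist_norm add.commute)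
        also have "\<dots> \<le> \<eta> * cmod (g (snd p))" using low \<eta> by (intro mult_left_mono) auto
        finally show "cmod (exp (L (snd p + fst p)) - exp (L (snd p))) \<le> \<eta> * cmod (exp (L (snd p)))" by (simp flip: L(2))
      qed (use \<eta> t d in auto)
      then show "cmod (D t s) \<le> e" using \<eta> by (simp add: D_def)
    qed
    with d(1) show ?thesis by blast
  qed
  have c_diff: "c t - c t' = c (t - t')" for t t' using add[of "t - t'" t'] by simp
  have cont: "continuous_on UNIV c"
    by (rule continuous_on_UNIV_if_close, unfold dist_norm c_diff) (use small in blast)
  have ReL: "ln \<delta> \<le> Re (L x)" "Re (L x) \<le> ln B" for x
  proof -
    have "exp (Re (L x)) = cmod (g x)" by (simp add: L(2))
    then have "Re (L x) = ln (cmod (g x))" by (metis ln_exp)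
    then show "ln \<delta> \<le> Re (L x)" "Re (L x) \<le> ln B"
      using low(1)[of x] B(2)[of x] low(2) B(1) less_le_trans[OF low(2) low(1)[of x]]
      by (simp_all add: ln_le_cancel_iff)
  qed
  have bdd: "\<bar>Re (c t)\<bar> \<le> ln B - ln \<delta>" for t
  proof -
    have "\<bar>Re (D t s)\<bar> \<le> ln B - ln \<delta>" for s
      using ReL[of s] ReL[of "s + t"] by (simp add: D_def abs_le_iff)
    then have "cmod (mean (\<lambda>s. of_real (Re (D t s)))) \<le> ln B - ln \<delta>"
      by (intro norm_mean_bound ap_intros apD) simp
    moreover have "mean (\<lambda>s. complex_of_real (Re (D t s))) = of_real (Re (c t))"
      unfolding c_def by (simp add: mean_of_real ap_Re apD mean_Re)
    ultimately show ?thesis by simp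
  qed
  obtain \<kappa> where \<kappa>: "\<And>t. c t = \<i> * of_real (t \<bullet> \<kappa>)"
    using additive_imaginary_representation[OF add cont bdd] by blast
  have "ap (\<lambda>x. L x - \<i> * of_real (x \<bullet> \<kappa>))"
  proof (rule ap_dominated[OF g], unfold dominated_def, intro allI impI)
    fix e :: real assume "e > 0"
    then obtain \<eta> where \<eta>: "\<eta> > 0" "\<eta> < 1/2" "4 * \<eta> \<le> e" using \<eta>_ex by blast
    show "\<exists>d>0. \<forall>x y. close_translates g d x y \<longrightarrow> dist (L x - \<i> * of_real (x \<bullet> \<kappa>)) (L y - \<i> * of_real (y \<bullet> \<kappa>)) \<le> e"
    proof (intro exI[of _ "\<eta> * \<delta>"] conjI allI impI)
      fix x y assume cl: "close_translates g (\<eta> * \<delta>) x y"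
      obtain k where k: "\<And>s. cmod (L (x + s) - L (y + s) - k) \<le> 2 * \<eta>" using period[OF \<eta>(2) cl] by blast
      have "cmod (mean (D (x - y)) - mean (\<lambda>s::'a. k)) \<le> 2 * \<eta>"
      proof (rule mean_close[OF apD ap_const])
        show "cmod (D (x - y) s - k) \<le> 2 * \<eta>" for s using k[of "s - y"] by (simp add: D_def algebra_simps)
      qed
      then have c': "cmod (k - c (x - y)) \<le> 2 * \<eta>" by (simp add: c_def norm_minus_commute)
      have "(L x - \<i> * of_real (x \<bullet> \<kappa>)) - (L y - \<i> * of_real (y \<bullet> \<kappa>)) = (L (x + 0) - L (y + 0) - k) + (k - c (x - y))"
        unfolding \<kappa> by (simp add: inner_diff_left algebra_simps)
      also have "cmod \<dots> \<le> 2 * \<eta> + 2 * \<eta>" by (intro norm_triangle_le add_mono k c')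
      finally show "dist (L x - \<i> * of_real (x \<bullet> \<kappa>)) (L y - \<i> * of_real (y \<bullet> \<kappa>)) \<le> e"
        using \<eta>(3) by (simp add: dist_norm)
    qed (use \<eta> low in auto)
  qed
  then show ?thesis by (rule that)
qed

section \<open>Zero-free almost periodic functions on tubes\<close>

text \<open>A continuous logarithm differs from a holomorphic one by a constant.\<close>

lemma holomorphic_on_if_exp_holomorphic:
  assumes "open \<Omega>" "convex \<Omega>" and g: "continuous_on \<Omega> g" and h: "(\<lambda>w. exp (g w)) holomorphic_on \<Omega>"
  shows "g holomorphic_on \<Omega>"
proof -
  obtain k where k: "k holomorphic_on \<Omega>" "\<And>w. w \<in> \<Omega> \<Longrightarrow> exp (g w) = exp (k w)"
    using contractible_imp_holomorphic_log[OF h convex_imp_contractible[OF assms(2)]] by auto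
  have "continuous_on \<Omega> (\<lambda>w. g w - k w)"
    by (intro continuous_on_diff g holomorphic_on_imp_continuous_on k)
  then have "(\<lambda>w. g w - k w) constant_on \<Omega>"
    by (rule continuous_exp_eq_1_constant[OF convex_connected[OF assms(2)]]) (use k in \<open>simp add: exp_diff\<close>)
  then obtain c where "\<And>w. w \<in> \<Omega> \<Longrightarrow> g w = k w + c" unfolding constant_on_def by (metis diff_add_cancel add.commute)
  moreover have "(\<lambda>w. k w + c) holomorphic_on \<Omega>" by (intro holomorphic_intros k)
  ultimately show ?thesis using holomorphic_transform by metis
qed

text \<open>Suppose that values on the level of \<open>y\<close> come arbitrarily close to 0. Then suitable translates of \<open>\<Phi>\<close>
converge uniformly on the tube to a function \<open>\<Psi>\<close> with a zero on this level. By Hurwitz's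
theorem \<open>\<Psi>\<close> vanishes on all complex lines with real direction through this zero, hence on the whole level. By
uniform convergence \<open>\<Phi>\<close> would be arbitrarily small everywhere on the level.\<close>

lemma zero_free_lower_bound:
  fixes \<Phi> :: "'a::euclidean_space \<Rightarrow> 'a \<Rightarrow> complex"
  assumes T: "bounded_tube \<Phi> C" and cone: "pos_cone C" and ap: "ap (\<lambda>x. \<Phi> x 0)"
    and D: "open D" "convex D" "D \<subseteq> C" and nz: "\<And>x y. y \<in> D \<Longrightarrow> \<Phi> x y \<noteq> 0" and y: "y \<in> D"
  shows "\<exists>\<delta>>0. \<forall>x. \<delta> \<le> cmod (\<Phi> x y)"
proof (rule ccontr)
  assume neg: "\<not> (\<exists>\<delta>>0. \<forall>x. \<delta> \<le> cmod (\<Phi> x y))"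
  have "\<exists>x. cmod (\<Phi> x y) < 1 / real (Suc n)" for n
    using neg by (metis linorder_not_less of_nat_0_less_iff zero_less_Suc zero_less_divide_1_iff)
  then obtain X where X: "\<And>n. cmod (\<Phi> (X n) y) < 1 / real (Suc n)" by metis
  obtain B where B: "\<And>x. cmod (\<Phi> x 0) \<le> B" using ap_bounded[OF ap] by blast
  obtain r g0 where r: "strict_mono (r :: nat \<Rightarrow> nat)" "uniform_limit UNIV (\<lambda>n x. \<Phi> (x + X (r n)) 0) g0 sequentially"
  proof (rule ap_uniform_subsequence[OF ap, of "\<lambda>n x. \<Phi> (x + X n) 0" B 1])
    show "cmod (\<Phi> (x + X n) 0) \<le> B" for n x by (rule B)
    show "cmod (\<Phi> (x + X n) 0 - \<Phi> (z + X n) 0) \<le> d * 1" if "close_translates (\<lambda>x. \<Phi> x 0) d x z" for n x z d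
      using close_translatesD[OF that, of "X n"] by (simp add: dist_norm)
  qed (use that in auto)
  have "uniformly_Cauchy_on (UNIV \<times> C) (\<lambda>n p. \<Phi> (fst p + X (r n)) (snd p))"
    unfolding uniformly_Cauchy_on_def
  proof (intro allI impI)
    fix e :: real assume e: "e > 0"
    then have "e/4 > 0" by simp
    with r(2) obtain N where N: "\<And>n x. n \<ge> N \<Longrightarrow> dist (\<Phi> (x + X (r n)) 0) (g0 x) < e/4"
      unfolding uniform_limit_sequentially_iff by blast
    have "dist (\<Phi> (fst p + X (r m)) (snd p)) (\<Phi> (fst p + X (r n)) (snd p)) < e"
      if mn: "m \<ge> N" "n \<ge> N" and p: "p \<in> UNIV \<times> C" for m n p
    proof -
      have "close_translates (\<lambda>x. \<Phi> x 0) (e/2) (X (r m)) (X (r n))"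
        unfolding close_translates_def
      proof
        fix s show "dist (\<Phi> (X (r m) + s) 0) (\<Phi> (X (r n) + s) 0) \<le> e/2"
          using N[OF mn(1), of s] N[OF mn(2), of s] dist_triangle2[of "\<Phi> (X (r m) + s) 0" "\<Phi> (X (r n) + s) 0" "g0 s"]
          by (simp add: add.commute)
      qed
      then have "close_translates (\<lambda>x. \<Phi> x 0) (e/2) (X (r m) + fst p) (X (r n) + fst p)"
        by (rule close_translates_shift)
      then have "cmod (\<Phi> (X (r m) + fst p) (snd p) - \<Phi> (X (r n) + fst p) (snd p)) \<le> e/2"
        by (rule bounded_tube_close[OF T cone]) (use p in auto)
      then show ?thesis using e by (simp add: dist_norm add.commute)
    qed
    then show "\<exists>M. \<forall>x\<in>UNIV \<times> C. \<forall>m\<ge>M. \<forall>n\<ge>M. dist (\<Phi> (fst x + X (r m)) (snd x)) (\<Phi> (fst x + X (r n)) (snd x)) < e"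
      by blast
  qed
  then obtain \<Psi> where \<Psi>: "uniform_limit (UNIV \<times> C) (\<lambda>n p. \<Phi> (fst p + X (r n)) (snd p)) \<Psi> sequentially"
    using Cauchy_uniformly_convergent uniformly_convergent_on_def by blast
  have \<Psi>0: "\<Psi> (0, y) = 0"
  proof (rule LIMSEQ_unique)
    show "(\<lambda>n. \<Phi> (0 + X (r n)) y) \<longlonglongrightarrow> \<Psi> (0, y)"
      using tendsto_uniform_limitI[OF \<Psi>, of "(0, y)"] y D(3) by auto
    have l0: "(\<lambda>n. 1 / real (Suc (r n))) \<longlonglongrightarrow> 0"
      using LIMSEQ_subseq_LIMSEQ[OF LIMSEQ_Suc[OF lim_const_over_n[of 1]] r(1)] by (simp add: o_def)
    show "(\<lambda>n. \<Phi> (0 + X (r n)) y) \<longlonglongrightarrow> 0"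
      by (rule Lim_null_comparison[OF always_eventually l0]) (use X in \<open>auto intro: less_imp_le\<close>)
  qed
  \<comment> \<open>by Hurwitz, the limit vanishes on every complex line through its zero\<close>
  have zero: "\<Psi> (v, y) = 0" for v
  proof -
    define \<Omega> where "\<Omega> = {w. y + Im w *\<^sub>R v \<in> D}"
    define k where "k w = \<Psi> (Re w *\<^sub>R v, y + Im w *\<^sub>R v)" for w
    define p where "p n w = \<Phi> (X (r n) + Re w *\<^sub>R v) (y + Im w *\<^sub>R v)" for n w
    have op: "open \<Omega>" and co: "connected \<Omega>"
      unfolding \<Omega>_def using open_slice[OF D(1)] convex_connected[OF convex_slice[OF D(2)]] by auto
    have holp: "p n holomorphic_on \<Omega>" for n
      using tube_holomorphic_subset[OF _ D(3), of \<Phi>] T unfolding p_def[abs_def] \<Omega>_def bounded_tube_def tube_holomorphic_def by blast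
    have lim: "uniform_limit K p k sequentially" if "K \<subseteq> \<Omega>" for K
      unfolding uniform_limit_iff
    proof (intro allI impI)
      fix e :: real assume "e > 0"
      with \<Psi> have "\<forall>\<^sub>F n in sequentially. \<forall>q\<in>UNIV \<times> C. dist (\<Phi> (fst q + X (r n)) (snd q)) (\<Psi> q) < e"
        unfolding uniform_limit_iff by blast
      then show "\<forall>\<^sub>F n in sequentially. \<forall>w\<in>K. dist (p n w) (k w) < e"
      proof eventually_elim
        case (elim n)
        show ?case
        proof
          fix w assume "w \<in> K"
          then have "(Re w *\<^sub>R v, y + Im w *\<^sub>R v) \<in> UNIV \<times> C" using that D(3) by (auto simp: \<Omega>_def)
          from bspec[OF elim this] show "dist (p n w) (k w) < e" by (simp add: p_def k_def add.commute)
        qed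
      qed
    qed
    have holk: "k holomorphic_on \<Omega>"
    proof (rule holomorphic_uniform_sequence[OF op holp])
      fix w assume "w \<in> \<Omega>"
      then obtain d where "d > 0" "cball w d \<subseteq> \<Omega>" using op open_contains_cball by blast
      then show "\<exists>d>0. cball w d \<subseteq> \<Omega> \<and> uniform_limit (cball w d) p k sequentially" using lim by blast
    qed
    have in\<Omega>: "0 \<in> \<Omega>" "1 \<in> \<Omega>" using y by (auto simp: \<Omega>_def)
    have k0: "k 0 = 0" using \<Psi>0 by (simp add: k_def)
    have "k constant_on \<Omega>"
    proof (rule ccontr)
      assume nc: "\<not> k constant_on \<Omega>"
      have "k 0 \<noteq> 0"
        by (rule Hurwitz_no_zeros[OF op co holp holk lim nc _ in\<Omega>(1)]) (auto simp: p_def \<Omega>_def nz)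
      with k0 show False by simp
    qed
    then have "k 1 = k 0" using in\<Omega> unfolding constant_on_def by metis
    then show ?thesis using k0 by (simp add: k_def)
  qed
  have pos: "cmod (\<Phi> 0 y) > 0" using nz[OF y] by simp
  with \<Psi> have "\<forall>\<^sub>F n in sequentially. \<forall>q\<in>UNIV \<times> C. dist (\<Phi> (fst q + X (r n)) (snd q)) (\<Psi> q) < cmod (\<Phi> 0 y)"
    unfolding uniform_limit_iff by blast
  then obtain n where n: "\<forall>q\<in>UNIV \<times> C. dist (\<Phi> (fst q + X (r n)) (snd q)) (\<Psi> q) < cmod (\<Phi> 0 y)"
    unfolding eventually_sequentially by blast
  have "(- X (r n), y) \<in> UNIV \<times> C" using y D(3) by auto
  from bspec[OF n this] show False using zero[of "- X (r n)"] by (simp add: dist_norm)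
qed

section \<open>Proper cones and their conjugates\<close>

locale proper_cone =
  fixes \<Gamma> :: "'a::euclidean_space set"
  assumes closed: "closed \<Gamma>" and convex: "convex \<Gamma>" and pos_cone: "pos_cone \<Gamma>"
    and interior_ne: "interior \<Gamma> \<noteq> {}" and pointed: "\<Gamma> \<inter> uminus ` \<Gamma> = {0}"
begin

abbreviation C :: "'a set" where "C \<equiv> interior (conjugate_cone \<Gamma>)"

lemma zero_in: "0 \<in> \<Gamma>"
  using pointed by blast

lemma scale_in: "x \<in> \<Gamma> \<Longrightarrow> t \<ge> 0 \<Longrightarrow> t *\<^sub>R x \<in> \<Gamma>"
  using pos_coneD[OF pos_cone, of x t] zero_in by (cases "t = 0") auto

lemma add_in: assumes "x \<in> \<Gamma>" "y \<in> \<Gamma>" shows "x + y \<in> \<Gamma>"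
proof -
  have "(1/2) *\<^sub>R x + (1/2) *\<^sub>R y \<in> \<Gamma>" using convexD[OF convex assms, of "1/2" "1/2"] by simp
  from scale_in[OF this, of 2] show ?thesis by (simp add: scaleR_add_right)
qed

lemma pointedD: assumes "x \<in> \<Gamma>" "- x \<in> \<Gamma>" shows "x = 0"
proof -
  have "x \<in> uminus ` \<Gamma>" using assms(2) by (metis imageI minus_minus)
  then show ?thesis using assms(1) pointed by blast
qed

lemma C_D: "y \<in> C \<Longrightarrow> l \<in> \<Gamma> \<Longrightarrow> 0 \<le> y \<bullet> l"
  using interior_subset[of "conjugate_cone \<Gamma>"] by (auto simp: conjugate_cone_def)

text \<open>A point of the interior may be moved slightly in the direction of \<open>-l\<close>.\<close>

lemma C_pos:
  assumes y: "y \<in> C" and l: "l \<in> \<Gamma>" "l \<noteq> 0" shows "0 < y \<bullet> l"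
proof -
  obtain e where e: "e > 0" "ball y e \<subseteq> conjugate_cone \<Gamma>" using y unfolding mem_interior by blast
  define s where "s = e / (2 * norm l)"
  have s: "s > 0" using e l by (simp add: s_def)
  have "y - s *\<^sub>R l \<in> ball y e" using e l by (simp add: dist_norm s_def)
  then have "y - s *\<^sub>R l \<in> conjugate_cone \<Gamma>" using e(2) by blast
  then have "0 \<le> (y - s *\<^sub>R l) \<bullet> l" using l(1) by (simp add: conjugate_cone_def)
  moreover have "s * (l \<bullet> l) > 0" using s l by simp
  ultimately show ?thesis by (simp add: inner_diff_left)
qed

lemma convex_C: "convex C"
  by (intro convex_interior) (auto simp: convex_def conjugate_cone_def inner_add_left)

lemma conjugate_add_C: assumes x: "x \<in> conjugate_cone \<Gamma>" and y: "y \<in> C" shows "x + y \<in> C"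
proof -
  obtain e where e: "e > 0" "ball y e \<subseteq> conjugate_cone \<Gamma>" using y unfolding mem_interior by blast
  have "ball (x + y) e \<subseteq> conjugate_cone \<Gamma>"
  proof
    fix z assume "z \<in> ball (x + y) e"
    then have "z - x \<in> ball y e" by (simp add: dist_norm algebra_simps)
    then have "z - x \<in> conjugate_cone \<Gamma>" using e(2) by blast
    then have "0 \<le> x \<bullet> l + (z - x) \<bullet> l" if "l \<in> \<Gamma>" for l
      using x that by (auto simp: conjugate_cone_def)
    then show "z \<in> conjugate_cone \<Gamma>" by (simp add: conjugate_cone_def inner_diff_left)
  qed
  with e(1) show ?thesis unfolding mem_interior by blast
qed

lemma C_add: "x \<in> C \<Longrightarrow> y \<in> C \<Longrightarrow> x + y \<in> C"
  using conjugate_add_C interior_subset by blast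

lemma pos_cone_C: "pos_cone C"
  unfolding pos_cone_def
proof (intro ballI allI impI)
  fix y and t :: real assume y: "y \<in> C" and t: "t > 0"
  obtain e where e: "e > 0" "ball y e \<subseteq> conjugate_cone \<Gamma>" using y unfolding mem_interior by blast
  have "ball (t *\<^sub>R y) (t * e) \<subseteq> conjugate_cone \<Gamma>"
  proof
    fix z assume z: "z \<in> ball (t *\<^sub>R y) (t * e)"
    have "t *\<^sub>R y - z = t *\<^sub>R (y - (1/t) *\<^sub>R z)" using t by (simp add: scaleR_diff_right)
    then have "t * norm (y - (1/t) *\<^sub>R z) < t * e" using z t by (simp add: dist_norm)
    then have "(1/t) *\<^sub>R z \<in> conjugate_cone \<Gamma>" using e(2) t by (auto simp: dist_norm)
    then show "z \<in> conjugate_cone \<Gamma>" using t by (auto simp: conjugate_cone_def zero_le_divide_iff)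
  qed
  moreover have "t * e > 0" using t e by simp
  ultimately show "t *\<^sub>R y \<in> C" unfolding mem_interior by blast
qed

text \<open>The bipolar theorem: a half-space that contains a cone also contains it after its boundary is moved to the
origin.\<close>

lemma separate_conjugate: assumes "l \<notin> \<Gamma>" shows "\<exists>y\<in>conjugate_cone \<Gamma>. y \<bullet> l < 0"
proof -
  obtain a b where ab: "a \<bullet> l < b" "\<And>x. x \<in> \<Gamma> \<Longrightarrow> b < a \<bullet> x"
    using separating_hyperplane_closed_point[OF convex closed assms] by blast
  have b: "b < 0" using ab(2)[OF zero_in] by simp
  have "0 \<le> a \<bullet> x" if x: "x \<in> \<Gamma>" for x
  proof (rule ccontr)
    assume "\<not> 0 \<le> a \<bullet> x"
    then have neg: "a \<bullet> x < 0" by simp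
    then have "(b / (a \<bullet> x)) *\<^sub>R x \<in> \<Gamma>" using b by (intro scale_in x) (simp add: divide_nonpos_nonpos)
    from ab(2)[OF this] neg show False by simp
  qed
  then show ?thesis using ab(1) b by (intro bexI[of _ a]) (auto simp: conjugate_cone_def)
qed

text \<open>Otherwise the conjugate cone lies in a hyperplane with normal vector \<open>a\<close>, so that \<open>a\<close> and \<open>-a\<close> belong to
\<open>\<Gamma>\<close> by \<open>separate_conjugate\<close>.\<close>

lemma C_nonempty: "C \<noteq> {}"
proof
  assume "C = {}"
  moreover have "convex (conjugate_cone \<Gamma>)" by (auto simp: convex_def conjugate_cone_def inner_add_left)
  ultimately obtain a b where ab: "a \<noteq> 0" "conjugate_cone \<Gamma> \<subseteq> {x. a \<bullet> x = b}"
    using empty_interior_subset_hyperplane by blast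
  have "0 \<in> conjugate_cone \<Gamma>" by (simp add: conjugate_cone_def)
  then have b: "b = 0" using ab(2) by auto
  have "a \<in> \<Gamma>" using separate_conjugate[of a] ab(2) b by (force simp: inner_commute)
  moreover have "- a \<in> \<Gamma>" using separate_conjugate[of "- a"] ab(2) b by (force simp: inner_commute)
  ultimately show False using pointedD ab(1) by blast
qed

lemma separate_C: assumes "l \<notin> \<Gamma>" shows "\<exists>y\<in>C. y \<bullet> l < 0"
proof -
  obtain y where y: "y \<in> conjugate_cone \<Gamma>" "y \<bullet> l < 0" using separate_conjugate[OF assms] by blast
  obtain v where v: "v \<in> C" using C_nonempty by blast
  define s where "s = - (y \<bullet> l) / (2 * (\<bar>v \<bullet> l\<bar> + 1))"
  have s: "s > 0" using y(2) by (simp add: s_def divide_neg_pos add_nonneg_pos)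
  have "s * (v \<bullet> l) \<le> s * (\<bar>v \<bullet> l\<bar> + 1)" using s by (intro mult_left_mono) auto
  also have "\<dots> = - (y \<bullet> l) / 2" by (simp add: s_def divide_simps)
  finally have "(y + s *\<^sub>R v) \<bullet> l < 0" using y(2) by (simp add: inner_add_left)
  then show ?thesis using conjugate_add_C[OF y(1) pos_coneD[OF pos_cone_C v s]] by blast
qed

text \<open>A ball of radius \<open>\<delta>\<close> around \<open>e\<close> lies in \<open>\<Gamma>\<close>; pair its point \<open>e - \<delta> y / \<bar>y\<bar>\<close> with \<open>y\<close>.\<close>

lemma interior_coercive:
  assumes e: "e \<in> interior \<Gamma>" shows "\<exists>\<delta>>0. \<forall>y\<in>conjugate_cone \<Gamma>. \<delta> * norm y \<le> y \<bullet> e"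
proof -
  obtain d where d: "d > 0" "cball e d \<subseteq> \<Gamma>" using e unfolding mem_interior_cball by blast
  have "d * norm y \<le> y \<bullet> e" if y: "y \<in> conjugate_cone \<Gamma>" for y
  proof (cases "y = 0")
    case False
    have "e - (d / norm y) *\<^sub>R y \<in> \<Gamma>" using d False by (intro subsetD[OF d(2)]) (simp add: dist_norm)
    then have "0 \<le> y \<bullet> (e - (d / norm y) *\<^sub>R y)" using y by (simp add: conjugate_cone_def)
    then show ?thesis using False by (simp add: inner_diff_right dot_square_norm power2_eq_square)
  qed simp
  with d(1) show ?thesis by blast
qed

lemma ex_nonzero: "\<exists>l\<in>\<Gamma>. l \<noteq> 0"
proof (rule ccontr)
  assume "\<not> (\<exists>l\<in>\<Gamma>. l \<noteq> 0)"
  then have "\<Gamma> \<subseteq> {0}" by blast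
  then have "interior \<Gamma> \<subseteq> interior {0}" by (rule interior_mono)
  then show False using interior_ne by simp
qed

lemma zero_notin_C: "0 \<notin> C"
  using ex_nonzero C_pos[of 0] by auto

section \<open>The spectrum of a zero-free function\<close>

text \<open>On the open convex set \<open>D\<close>, whose tube contains no zeros, take a continuous logarithm \<open>L\<close> of \<open>\<Phi>\<close>. By Bohr's theorem
\<open>L\<close> is on each level the sum of an almost periodic function and a linear one, and the linear part is the same for
all levels. So \<open>\<Phi>\<close> is the character of some frequency \<open>c\<close> times \<open>exp H\<close>, with \<open>H\<close> almost periodic on the levels.
As \<open>\<Phi>\<close> is bounded, \<open>Re H\<close> has an upper bound of linear growth in \<open>y\<close>, while its mean does not depend on \<open>y\<close>; so the mean of
\<open>\<bar>Re H\<bar>\<close> grows at most linearly. A frequency \<open>l\<close> outside \<open>\<Gamma>\<close> would make it grow exponentially in a direction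
\<open>v\<close> with \<open>v \<bullet> l < 0\<close>. Therefore \<open>exp H\<close> has its spectrum in \<open>\<Gamma>\<close> and a nonzero constant term, and the spectra
on all levels of the tube agree with the one of the boundary values.\<close>

theorem zero_free_spectrum:
  fixes \<Phi> :: "'a \<Rightarrow> 'a \<Rightarrow> complex"
  assumes T: "bounded_tube \<Phi> C" and ap: "ap (\<lambda>x. \<Phi> x 0)"
    and nz: "\<And>x y. y \<in> C \<Longrightarrow> q < norm y \<Longrightarrow> \<Phi> x y \<noteq> 0"
  shows "\<exists>c. fourier (\<lambda>x. \<Phi> x 0) c \<noteq> 0 \<and> (\<forall>l. fourier (\<lambda>x. \<Phi> x 0) l \<noteq> 0 \<longrightarrow> l - c \<in> \<Gamma>)"
proof -
  obtain e where e: "e \<in> \<Gamma>" "e \<noteq> 0" using ex_nonzero by blast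
  \<comment> \<open>a convex part of the region \<open>q < norm y\<close>, which itself need not be convex\<close>
  define D where "D = C \<inter> {y. \<bar>q\<bar> * norm e < e \<bullet> y}"
  have D: "open D" "convex D" "D \<subseteq> C"
    unfolding D_def by (auto intro!: open_Int convex_Int convex_C open_halfspace_gt convex_halfspace_gt)
  have D_norm: "q < norm y" if "y \<in> D" for y
  proof -
    have "\<bar>q\<bar> * norm e < norm y * norm e" using that norm_cauchy_schwarz[of e y] by (simp add: D_def mult.commute)
    then have "\<bar>q\<bar> < norm y" using mult_less_cancel_right_pos[of "norm e"] e(2) by simp
    then show ?thesis by linarith
  qed
  have D_add: "y + r *\<^sub>R v \<in> D" if "y \<in> D" "v \<in> C" "r \<ge> 0" for y v r
  proof (cases "r = 0")
    case False
    then have "r *\<^sub>R v \<in> C" using that pos_coneD[OF pos_cone_C] by simp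
    then show ?thesis using that C_add C_D[of "r *\<^sub>R v" e] e(1) by (auto simp: D_def inner_add_right inner_commute)
  qed (use that in simp)
  obtain v0 where v0: "v0 \<in> C" using C_nonempty by blast
  have ev: "0 < v0 \<bullet> e" by (rule C_pos[OF v0 e])
  define y1 where "y1 = ((\<bar>q\<bar> * norm e + 1) / (v0 \<bullet> e)) *\<^sub>R v0"
  have y1: "y1 \<in> D"
  proof -
    have "y1 \<in> C" unfolding y1_def using ev by (intro pos_coneD[OF pos_cone_C v0] divide_pos_pos) (simp_all add: add_nonneg_pos)
    moreover have "e \<bullet> y1 = \<bar>q\<bar> * norm e + 1" using ev by (simp add: y1_def inner_commute)
    ultimately show ?thesis by (simp add: D_def)
  qed
  have nzD: "\<Phi> x y \<noteq> 0" if "y \<in> D" for x y using nz D(3) D_norm that by blast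
  have th: "tube_holomorphic \<Phi> C" using T by (simp add: bounded_tube_def)
  have apl: "ap (\<lambda>x. \<Phi> x y)" if "y \<in> D" for y using bounded_tube_ap[OF T pos_cone_C ap] D(3) that by blast
  have low: "\<exists>\<delta>>0. \<forall>x. \<delta> \<le> cmod (\<Phi> x y)" if "y \<in> D" for y
    by (rule zero_free_lower_bound[OF T pos_cone_C ap D]) (use nzD that in auto)
  have ucl: "uniformly_continuous_levels \<Phi> C" by (rule bounded_tube_levels[OF T pos_cone_C ap])
  have contD: "continuous_on (UNIV \<times> D) (\<lambda>p. \<Phi> (fst p) (snd p))"
    using tube_holomorphic_subset[OF th D(3)] by (simp add: tube_holomorphic_def)
  have "contractible ((UNIV :: 'a set) \<times> D)"
    by (intro convex_imp_contractible convex_Times convex_UNIV D)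
  moreover have "\<Phi> (fst p) (snd p) \<noteq> 0" if "p \<in> UNIV \<times> D" for p using nzD that by auto
  ultimately obtain L0 where L0: "continuous_on (UNIV \<times> D) L0" "\<And>p. p \<in> UNIV \<times> D \<Longrightarrow> \<Phi> (fst p) (snd p) = exp (L0 p)"
    using continuous_logarithm_on_contractible[OF contD] by blast
  define L where "L x y = L0 (x, y)" for x y
  have contL: "continuous_on S (\<lambda>s. L (a s) (b s))"
    if "continuous_on S a" "continuous_on S b" "\<And>s. s \<in> S \<Longrightarrow> b s \<in> D" for S and a b :: "'s::topological_space \<Rightarrow> 'a"
    unfolding L_def by (rule continuous_on_compose2[OF L0(1)]) (use that in \<open>auto intro!: continuous_intros\<close>)
  have L_exp: "\<Phi> x y = exp (L x y)" if "y \<in> D" for x y using L0(2)[of "(x, y)"] that by (simp add: L_def)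
  have thL: "tube_holomorphic L D"
    unfolding tube_holomorphic_def
  proof (intro conjI allI)
    show "continuous_on (UNIV \<times> D) (\<lambda>p. L (fst p) (snd p))" by (intro contL continuous_intros) auto
    fix x y v
    show "(\<lambda>w. L (x + Re w *\<^sub>R v) (y + Im w *\<^sub>R v)) holomorphic_on {w. y + Im w *\<^sub>R v \<in> D}"
    proof (rule holomorphic_on_if_exp_holomorphic[OF open_slice[OF D(1)] convex_slice[OF D(2)]])
      show "continuous_on {w. y + Im w *\<^sub>R v \<in> D} (\<lambda>w. L (x + Re w *\<^sub>R v) (y + Im w *\<^sub>R v))"
        by (intro contL continuous_intros) auto
      have "(\<lambda>w. \<Phi> (x + Re w *\<^sub>R v) (y + Im w *\<^sub>R v)) holomorphic_on {w. y + Im w *\<^sub>R v \<in> D}"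
        using tube_holomorphic_subset[OF th D(3)] unfolding tube_holomorphic_def by blast
      then show "(\<lambda>w. exp (L (x + Re w *\<^sub>R v) (y + Im w *\<^sub>R v))) holomorphic_on {w. y + Im w *\<^sub>R v \<in> D}"
        by (rule holomorphic_transform) (simp add: L_exp)
    qed
  qed
  have uclL: "uniformly_continuous_levels L D"
    unfolding uniformly_continuous_levels_def
  proof (intro ballI allI impI)
    fix y \<epsilon> assume y: "y \<in> D" and \<epsilon>: "(0::real) < \<epsilon>"
    obtain \<delta> where \<delta>: "\<delta> > 0" "\<And>x. \<delta> \<le> cmod (\<Phi> x y)" using low[OF y] by blast
    define \<eta> where "\<eta> = min (1/4) (\<epsilon>/2)"
    have \<eta>: "\<eta> > 0" "\<eta> < 1/2" "2 * \<eta> \<le> \<epsilon>" using \<epsilon> by (auto simp: \<eta>_def)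
    have "\<eta> * \<delta> > 0" using \<eta> \<delta> by simp
    with ucl y D(3) obtain d where d: "d > 0" "\<And>y' x. y' \<in> C \<Longrightarrow> dist y' y < d \<Longrightarrow> cmod (\<Phi> x y' - \<Phi> x y) \<le> \<eta> * \<delta>"
      unfolding uniformly_continuous_levels_def by blast
    have "cmod (L x y' - L x y) \<le> \<epsilon>" if y': "y' \<in> D" "dist y' y < d" for x y'
    proof -
      have "cmod (L (fst (x, y')) (snd (x, y')) - L (fst (x, y')) y) \<le> 2 * \<eta>"
      proof (rule log_quotient_branch(2)[where S = "UNIV \<times> (ball y d \<inter> D)" and ?s0.0 = "(x, y)"
            and ?L2.0 = "\<lambda>p. L (fst p) (snd p)" and ?L1.0 = "\<lambda>p. L (fst p) y"])
        show "connected ((UNIV :: 'a set) \<times> (ball y d \<inter> D))"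
          by (intro connected_Times convex_connected convex_Int convex_ball convex_UNIV D)
        show "continuous_on (UNIV \<times> (ball y d \<inter> D)) (\<lambda>p. L (fst p) y)"
          by (intro contL continuous_intros) (use y in auto)
        show "continuous_on (UNIV \<times> (ball y d \<inter> D)) (\<lambda>p. L (fst p) (snd p))"
          by (intro contL continuous_intros) auto
        fix p :: "'a \<times> 'a" assume p: "p \<in> UNIV \<times> (ball y d \<inter> D)"
        then have pD: "snd p \<in> D" "dist (snd p) y < d" by (auto simp: dist_commute)
        then have "cmod (\<Phi> (fst p) (snd p) - \<Phi> (fst p) y) \<le> \<eta> * \<delta>" using d(2) D(3) by blast
        also have "\<dots> \<le> \<eta> * cmod (\<Phi> (fst p) y)" using \<delta> \<eta> by (intro mult_left_mono) auto
        finally show "cmod (exp (L (fst p) (snd p)) - exp (L (fst p) y)) \<le> \<eta> * cmod (exp (L (fst p) y))"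
          using L_exp[OF pD(1)] L_exp[OF y] by simp
      qed (use y y' d \<eta> in \<open>auto simp: dist_commute\<close>)
      then show ?thesis using \<eta> by simp
    qed
    with d(1) show "\<exists>d>0. \<forall>y'\<in>D. dist y' y < d \<longrightarrow> (\<forall>x. cmod (L x y' - L x y) \<le> \<epsilon>)" by blast
  qed
  have "\<exists>\<kappa>. ap (\<lambda>x. L x y - \<i> * of_real (x \<bullet> \<kappa>))" if y: "y \<in> D" for y
  proof -
    obtain \<delta> where \<delta>: "\<delta> > 0" "\<And>x. \<delta> \<le> cmod (\<Phi> x y)" using low[OF y] by blast
    show ?thesis
      by (rule Bohr_logarithm[OF apl[OF y] \<delta>(2,1) contL[of UNIV "\<lambda>x. x" "\<lambda>x. y"] L_exp[OF y]]) (use y in auto)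
  qed
  then obtain \<kappa> where \<kappa>: "\<And>y. y \<in> D \<Longrightarrow> ap (\<lambda>x. L x y - \<i> * of_real (x \<bullet> \<kappa> y))" by metis
  \<comment> \<open>the mean motion does not depend on the level\<close>
  have "\<kappa> constant_on D"
  proof (rule locally_constant_imp_constant[OF convex_connected[OF D(2)]])
    fix y assume y: "y \<in> D"
    obtain d where d: "d > 0" "\<And>y' x. y' \<in> D \<Longrightarrow> dist y' y < d \<Longrightarrow> cmod (L x y' - L x y) \<le> 1"
      using uclL y unfolding uniformly_continuous_levels_def by (metis zero_less_one)
    have "\<kappa> y' = \<kappa> y" if y': "y' \<in> D" "dist y' y < d" for y'
    proof (rule ccontr)
      assume ne: "\<kappa> y' \<noteq> \<kappa> y"
      obtain B1 where B1: "\<And>x. cmod (L x y' - \<i> * of_real (x \<bullet> \<kappa> y')) \<le> B1" using ap_bounded[OF \<kappa>[OF y'(1)]] by blast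
      obtain B2 where B2: "\<And>x. cmod (L x y - \<i> * of_real (x \<bullet> \<kappa> y)) \<le> B2" using ap_bounded[OF \<kappa>[OF y]] by blast
      define z where "z = \<kappa> y' - \<kappa> y"
      have bd: "\<bar>x \<bullet> z\<bar> \<le> 1 + B1 + B2" for x
      proof -
        have "\<i> * of_real (x \<bullet> z) = (L x y' - L x y) - (L x y' - \<i> * of_real (x \<bullet> \<kappa> y')) + (L x y - \<i> * of_real (x \<bullet> \<kappa> y))"
          by (simp add: z_def inner_diff_right algebra_simps)
        then have "\<bar>x \<bullet> z\<bar> = cmod ((L x y' - L x y) - (L x y' - \<i> * of_real (x \<bullet> \<kappa> y')) + (L x y - \<i> * of_real (x \<bullet> \<kappa> y)))"
          by (metis norm_mult norm_ii norm_of_real mult_1)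
        also have "\<dots> \<le> 1 + B1 + B2"
          by (intro norm_triangle_le norm_triangle_le_diff add_mono d(2) y' B1 B2)
        finally show ?thesis .
      qed
      have zz: "z \<bullet> z > 0" using ne by (simp add: z_def)
      obtain n where "real n * (z \<bullet> z) > 1 + B1 + B2" using reals_Archimedean3[OF zz] by blast
      then show False using bd[of "real n *\<^sub>R z"] by simp
    qed
    then have "\<forall>x\<in>D \<inter> ball y d. \<kappa> x = \<kappa> y" by (simp add: dist_commute)
    moreover have "openin (top_of_set D) (D \<inter> ball y d)" by (rule openin_open_Int) simp
    moreover have "y \<in> D \<inter> ball y d" using d(1) y by simp
    ultimately show "\<exists>T. openin (top_of_set D) T \<and> y \<in> T \<and> (\<forall>x\<in>T. \<kappa> x = \<kappa> y)" by blast
  qed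
  then obtain c where c: "\<And>y. y \<in> D \<Longrightarrow> \<kappa> y = c" unfolding constant_on_def by blast
  define \<Lambda> where "\<Lambda> x y = \<i> * of_real (x \<bullet> c) - complex_of_real (y \<bullet> c)" for x y
  define H where "H x y = L x y - \<Lambda> x y" for x y
  have th\<Lambda>: "tube_holomorphic \<Lambda> D"
    unfolding tube_holomorphic_def
  proof (intro conjI allI)
    show "continuous_on (UNIV \<times> D) (\<lambda>p. \<Lambda> (fst p) (snd p))" unfolding \<Lambda>_def by (intro continuous_intros)
    have eq: "\<Lambda> (x + Re w *\<^sub>R v) (y + Im w *\<^sub>R v) = \<Lambda> x y + \<i> * w * of_real (v \<bullet> c)" for x y v w
      by (simp add: \<Lambda>_def complex_eq_iff inner_add_left algebra_simps)
    show "(\<lambda>w. \<Lambda> (x + Re w *\<^sub>R v) (y + Im w *\<^sub>R v)) holomorphic_on {w. y + Im w *\<^sub>R v \<in> D}" for x y v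
      unfolding eq by (intro holomorphic_intros)
  qed
  have thH: "tube_holomorphic H D" unfolding H_def by (rule tube_holomorphic_diff[OF thL th\<Lambda>])
  have apH: "ap (\<lambda>x. H x y)" if "y \<in> D" for y
  proof -
    have "ap (\<lambda>x. (L x y - \<i> * of_real (x \<bullet> c)) + of_real (y \<bullet> c))"
      using ap_add[OF \<kappa>[OF that] ap_const] unfolding c[OF that] .
    moreover have "H x y = (L x y - \<i> * of_real (x \<bullet> c)) + of_real (y \<bullet> c)" for x by (simp add: H_def \<Lambda>_def)
    ultimately show ?thesis by simp
  qed
  have uclH: "uniformly_continuous_levels H D"
    unfolding uniformly_continuous_levels_def
  proof (intro ballI allI impI)
    fix y \<epsilon> assume y: "y \<in> D" and \<epsilon>: "(0::real) < \<epsilon>"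
    then have "\<epsilon>/2 > 0" by simp
    with uclL y obtain d1 where d1: "d1 > 0" "\<And>y' x. y' \<in> D \<Longrightarrow> dist y' y < d1 \<Longrightarrow> cmod (L x y' - L x y) \<le> \<epsilon>/2"
      unfolding uniformly_continuous_levels_def by blast
    define d where "d = min d1 (\<epsilon> / (2 * (norm c + 1)))"
    have d: "d > 0" using d1 \<epsilon> by (simp add: d_def add_nonneg_pos)
    have "cmod (H x y' - H x y) \<le> \<epsilon>" if y': "y' \<in> D" "dist y' y < d" for x y'
    proof -
      have "\<bar>(y' - y) \<bullet> c\<bar> \<le> norm (y' - y) * norm c" by (rule Cauchy_Schwarz_ineq2)
      also have "\<dots> \<le> \<epsilon> / (2 * (norm c + 1)) * (norm c + 1)"
        using y'(2) \<epsilon> by (intro mult_mono) (auto simp: d_def dist_norm)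
      also have "\<dots> = \<epsilon>/2" by (simp add: divide_simps) (smt (verit) norm_ge_zero)
      finally have 1: "cmod (complex_of_real ((y' - y) \<bullet> c)) \<le> \<epsilon>/2" by simp
      have "cmod (L x y' - L x y) \<le> \<epsilon>/2" using d1(2) y' by (simp add: d_def)
      moreover have "H x y' - H x y = (L x y' - L x y) + of_real ((y' - y) \<bullet> c)"
        by (simp add: H_def \<Lambda>_def inner_diff_left)
      ultimately show ?thesis using 1 norm_triangle_le[of "L x y' - L x y" "of_real ((y' - y) \<bullet> c)" \<epsilon>] by simp
    qed
    with d show "\<exists>d>0. \<forall>y'\<in>D. dist y' y < d \<longrightarrow> (\<forall>x. cmod (H x y' - H x y) \<le> \<epsilon>)" by blast
  qed
  obtain B0 where B0: "\<And>x. cmod (\<Phi> x 0) \<le> B0" using ap_bounded[OF ap] by blast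
  define B where "B = max 1 B0"
  have B: "B \<ge> 1" "cmod (\<Phi> x y) \<le> B" if "y \<in> D" for x y
  proof -
    have "cmod (\<Phi> x y) \<le> B0" by (rule bounded_tube_maximum[OF T pos_cone_C B0]) (use that D(3) in blast)
    then show "cmod (\<Phi> x y) \<le> B" by (simp add: B_def)
  qed (simp add: B_def)
  have ReH: "Re (H x y) \<le> ln B + y \<bullet> c" if y: "y \<in> D" for x y
  proof -
    have "exp (Re (L x y)) \<le> B" using B(2)[OF y] by (simp add: L_exp[OF y])
    then have "Re (L x y) \<le> ln B" using B(1)[OF y1] by (metis exp_gt_zero ln_exp ln_mono)
    then show ?thesis by (simp add: H_def \<Lambda>_def)
  qed
  \<comment> \<open>the logarithm grows at most linearly in the mean, so that its frequencies lie in the cone\<close>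
  have specH: "fourier (\<lambda>x. H x y1) l = 0" if l: "l \<notin> \<Gamma>" for l
  proof -
    obtain v where v: "v \<in> C" "v \<bullet> l < 0" using separate_C[OF l] by blast
    define s where "s = - (v \<bullet> l)"
    have s: "s > 0" using v by (simp add: s_def)
    define a where "a = fourier (\<lambda>x. H x y1) l"
    define b where "b = fourier (\<lambda>x. H x y1) (- l)"
    define a0 where "a0 = fourier (\<lambda>x. H x y1) 0"
    define K where "K r = ln B + \<bar>y1 \<bullet> c\<bar> + r * \<bar>v \<bullet> c\<bar>" for r
    \<comment> \<open>compare the coefficients of \<open>Re H\<close> on the level of \<open>y1 + r v\<close> with the mean of its modulus\<close>
    have est: "cmod a * exp (r * s) \<le> cmod b + 4 * K r + 2 * cmod a0" if r: "r \<ge> 0" for r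
    proof -
      define y where "y = y1 + r *\<^sub>R v"
      have y: "y \<in> D" unfolding y_def by (rule D_add[OF y1 v(1) r])
      have level: "fourier (\<lambda>x. H x y) k = of_real (exp (- (r * (v \<bullet> k)))) * fourier (\<lambda>x. H x y1) k" for k
        using fourier_level[OF thH D(1,2) apH uclH y1, of "r *\<^sub>R v" k] y by (simp add: y_def)
      define u where "u x = Re (H x y)" for x
      have apu: "ap u" unfolding u_def by (intro ap_intros apH y)
      have apu': "ap (\<lambda>x. complex_of_real (u x))" by (intro ap_intros apu)
      have Kr: "0 \<le> K r" "\<And>x. u x \<le> K r"
      proof -
        show "0 \<le> K r" using B(1)[OF y1] r by (simp add: K_def)
        fix x
        have "y \<bullet> c \<le> \<bar>y1 \<bullet> c\<bar> + r * \<bar>v \<bullet> c\<bar>"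
          using r mult_left_mono[of "v \<bullet> c" "\<bar>v \<bullet> c\<bar>" r] by (simp add: y_def inner_add_left abs_le_iff add_mono)
        then show "u x \<le> K r" using ReH[OF y, of x] by (simp add: u_def K_def)
      qed
      have mu: "mean u = Re a0"
        using mean_Re[OF apH[OF y]] level[of 0] by (simp add: u_def[abs_def] fourier_def a0_def)
      have "cmod (fourier (\<lambda>x. of_real (u x)) l) \<le> mean (\<lambda>x. cmod (of_real (u x) * cis (- (x \<bullet> l))))"
        unfolding fourier_def by (rule norm_mean_le) (intro ap_intros apu)
      \<comment> \<open>\<open>u \<le> K r\<close> and \<open>0 \<le> K r\<close> imply \<open>\<bar>u\<bar> \<le> 2 K r - u\<close>\<close>
      also have "\<dots> \<le> mean (\<lambda>x. 2 * K r + - 1 * u x)"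
      proof (rule mean_mono)
        show "ap (\<lambda>x. cmod (of_real (u x) * cis (- (x \<bullet> l))))" by (intro ap_intros apu)
        show "ap (\<lambda>x. 2 * K r + - 1 * u x)" by (rule ap_compose_UNIV[OF apu]) (intro continuous_intros)
        show "cmod (of_real (u x) * cis (- (x \<bullet> l))) \<le> 2 * K r + - 1 * u x" for x
          using Kr(1) Kr(2)[of x] by (simp add: norm_mult)
      qed
      also have "\<dots> = 2 * K r - Re a0"
      proof -
        have "ap (\<lambda>x. - 1 * u x)" by (rule ap_compose_UNIV[OF apu]) (intro continuous_intros)
        moreover have "mean (\<lambda>x. - 1 * u x) = - 1 * mean u" by (rule mean_linear[OF apu bounded_linear_mult_right])
        ultimately show ?thesis by (subst mean_add[OF ap_const]) (simp_all add: mu)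
      qed
      finally have 1: "cmod (fourier (\<lambda>x. of_real (u x)) l) \<le> 2 * K r - Re a0" .
      have "fourier (\<lambda>x. 2 * of_real (u x)) l = fourier (\<lambda>x. H x y + cnj (H x y)) l"
        by (simp add: u_def complex_add_cnj)
      also have "\<dots> = fourier (\<lambda>x. H x y) l + fourier (\<lambda>x. cnj (H x y)) l" by (intro fourier_add ap_intros apH y)
      also have "fourier (\<lambda>x. cnj (H x y)) l = cnj (fourier (\<lambda>x. H x y) (- l))"
        unfolding fourier_def by (subst mean_cnj[symmetric]) (auto intro!: ap_intros apH y simp: cis_cnj)
      finally have 2: "2 * fourier (\<lambda>x. of_real (u x)) l = of_real (exp (r * s)) * a + of_real (exp (- (r * s))) * cnj b"
        unfolding fourier_cmult[OF apu'] level by (simp add: a_def b_def s_def)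
      have "cmod a * exp (r * s) = cmod (of_real (exp (r * s)) * a)" by (simp add: norm_mult)
      also have "\<dots> = cmod (2 * fourier (\<lambda>x. of_real (u x)) l - of_real (exp (- (r * s))) * cnj b)" unfolding 2 by simp
      also have "\<dots> \<le> 2 * (2 * K r - Re a0) + exp (- (r * s)) * cmod b"
        using 1 by (intro norm_triangle_le_diff add_mono) (simp_all add: norm_mult)
      finally have "cmod a * exp (r * s) \<le> 2 * (2 * K r - Re a0) + exp (- (r * s)) * cmod b" .
      moreover have "exp (- (r * s)) * cmod b \<le> cmod b"
        using mult_right_mono[of "exp (- (r * s))" 1 "cmod b"] r s by simp
      moreover have "- Re a0 \<le> cmod a0" using abs_Re_le_cmod[of a0] by linarith
      ultimately show ?thesis by argo
    qed
    have "cmod a = 0"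
    proof (rule ccontr)
      assume "cmod a \<noteq> 0"
      then have pos: "cmod a * s\<^sup>2 / 2 > 0" using s by simp
      define P where "P = cmod b + 4 * (ln B + \<bar>y1 \<bullet> c\<bar>) + 2 * cmod a0"
      obtain n where n: "real n * (cmod a * s\<^sup>2 / 2) > P + 4 * \<bar>v \<bullet> c\<bar>" using reals_Archimedean3[OF pos] by blast
      define r where "r = real (Suc n)"
      have r: "r \<ge> 1" by (simp add: r_def)
      have P0: "P \<ge> 0" using B(1)[OF y1] by (simp add: P_def)
      have "real n * (cmod a * s\<^sup>2 / 2) \<le> r * (cmod a * s\<^sup>2 / 2)" using pos by (intro mult_right_mono) (auto simp: r_def)
      then have "P + 4 * \<bar>v \<bullet> c\<bar> < r * (cmod a * s\<^sup>2 / 2)" using n by linarith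
      then have "r * (P + 4 * \<bar>v \<bullet> c\<bar>) < r * (r * (cmod a * s\<^sup>2 / 2))" using r by (intro mult_strict_left_mono) auto
      moreover have "P \<le> r * P" using r P0 mult_right_mono[of 1 r P] by simp
      moreover have rs: "0 \<le> r * s" using r s by simp
      have "(r * s)\<^sup>2 / 2 \<le> exp (r * s)" using exp_lower_Taylor_quadratic[OF rs] rs by linarith
      then have "cmod a * ((r * s)\<^sup>2 / 2) \<le> cmod a * exp (r * s)" by (intro mult_left_mono) auto
      then have "cmod a * ((r * s)\<^sup>2 / 2) \<le> P + 4 * (r * \<bar>v \<bullet> c\<bar>)" using est[of r] r by (simp add: K_def P_def)
      moreover have "cmod a * ((r * s)\<^sup>2 / 2) = r * (r * (cmod a * s\<^sup>2 / 2))" by (simp add: power2_eq_square)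
      moreover have "r * (P + 4 * \<bar>v \<bullet> c\<bar>) = r * P + 4 * (r * \<bar>v \<bullet> c\<bar>)" by (simp add: algebra_simps)
      ultimately show False by argo
    qed
    then show ?thesis by (simp add: a_def)
  qed
  note expH = fourier_exp_semigroup[OF apH[OF y1] zero_in add_in pointedD specH]
  have "\<Phi> x y1 = of_real (exp (- (y1 \<bullet> c))) * (cis (x \<bullet> c) * exp (H x y1))" for x
  proof -
    have "L x y1 = \<Lambda> x y1 + H x y1" by (simp add: H_def)
    then have "\<Phi> x y1 = exp_char c x y1 * exp (H x y1)"
      unfolding L_exp[OF y1] exp_char_def \<Lambda>_def by (simp only: exp_add)
    then show ?thesis by (simp only: exp_char_eq mult.assoc)
  qed
  then have fc1: "fourier (\<lambda>x. \<Phi> x y1) l = of_real (exp (- (y1 \<bullet> c))) * fourier (\<lambda>x. exp (H x y1)) (l - c)" for l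
    by (simp add: fourier_cmult fourier_cis_mult ap_intros apH y1)
  have bd: "fourier (\<lambda>x. \<Phi> x y1) l = of_real (exp (- (y1 \<bullet> l))) * fourier (\<lambda>x. \<Phi> x 0) l" for l
    using fourier_level_boundary[OF T _ convex_C pos_cone_C ap] y1 D(3) by auto
  show ?thesis
  proof (intro exI[of _ c] conjI allI impI)
    have "fourier (\<lambda>x. exp (H x y1)) 0 \<noteq> 0" using expH(2) by simp
    then show "fourier (\<lambda>x. \<Phi> x 0) c \<noteq> 0" using fc1[of c] bd[of c] by auto
    fix l assume "fourier (\<lambda>x. \<Phi> x 0) l \<noteq> 0"
    then have "fourier (\<lambda>x. exp (H x y1)) (l - c) \<noteq> 0" using fc1[of l] bd[of l] by auto
    then show "l - c \<in> \<Gamma>" using expH(1) by blast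
  qed
qed

end

section \<open>The given spectrum and extension\<close>

lemma scaleR_One_vec: "S *\<^sub>R (One :: real ^ 'p) = (\<chi> i. S)"
proof -
  have "(One :: real ^ 'p) $ i = 1" for i
    using inner_One[of "axis i 1 :: real ^ 'p"] by (simp add: inner_axis axis_in_Basis_iff)
  then show ?thesis by (simp add: vec_eq_iff)
qed

lemma spectrum_average:
  fixes f :: "real ^ 'p \<Rightarrow> complex"
  assumes f: "continuous_on UNIV f"
  shows "(LINT x:cbox (\<chi> i. - S) (\<chi> i. S)|lborel. f x * exp (- \<i> * of_real (x \<bullet> \<mu>))) / of_real ((2 * S) ^ CARD('p))
    = avg S (\<lambda>x. f x * cis (- (x \<bullet> \<mu>))) 0"
proof -
  have cube: "cbox (\<chi> i. - S) (\<chi> i. S) = (cube S :: (real ^ 'p) set)"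
  proof -
    have "(\<chi> i. - S) = - (S *\<^sub>R (One :: real ^ 'p))" unfolding scaleR_One_vec by (simp add: vec_eq_iff)
    then show ?thesis unfolding scaleR_One_vec by simp
  qed
  have ex: "exp (- \<i> * of_real (x \<bullet> \<mu>)) = cis (- (x \<bullet> \<mu>))" for x :: "real ^ 'p"
    by (simp add: cis_conv_exp)
  have cont: "continuous_on UNIV (\<lambda>x. f x * cis (- (x \<bullet> \<mu>)))" by (intro continuous_intros f)
  have "set_integrable lborel (cube S :: (real ^ 'p) set) (\<lambda>x. f x * cis (- (x \<bullet> \<mu>)))"
    unfolding set_integrable_def
    by (rule borel_integrable_compact) (auto intro: continuous_on_subset[OF cont])
  from set_borel_integral_eq_integral(2)[OF this]
  show ?thesis unfolding cube ex avg_def by (simp add: scaleR_conv_of_real divide_inverse mult.commute)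
qed

lemma spectrum_eq:
  fixes f :: "real ^ 'p \<Rightarrow> complex"
  assumes f: "ap f" shows "spectrum f = {\<mu>. fourier f \<mu> \<noteq> 0}"
proof -
  have "((\<lambda>S. avg S (\<lambda>x. f x * cis (- (x \<bullet> \<mu>))) 0) \<longlongrightarrow> fourier f \<mu>) at_top" for \<mu>
    unfolding fourier_def by (rule mean_tendsto) (intro ap_intros f)
  then have "((\<lambda>S. avg S (\<lambda>x. f x * cis (- (x \<bullet> \<mu>))) 0) \<longlongrightarrow> a) at_top \<longleftrightarrow> a = fourier f \<mu>" for a \<mu>
    using tendsto_unique[OF trivial_limit_at_top_linorder] by blast
  then show ?thesis
    unfolding spectrum_def spectrum_average[OF ap_continuous[OF f]] by auto
qed

lemma continuous_cvec: "continuous_on S (\<lambda>p. cvec (fst p) (snd p :: real ^ 'p))"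
  unfolding cvec_def Complex_eq by (intro continuous_on_vec_lambda continuous_intros)

lemma cvec_line: "cvec (x + Re w *\<^sub>R v) (y + Im w *\<^sub>R v) = cvec x y + w *s cvec v (0 :: real ^ 'p)"
  by (simp add: cvec_def vec_eq_iff complex_eq_iff)

lemma cvec_in_tube: "y \<in> K \<Longrightarrow> cvec x y \<in> tube K"
  by (auto simp: tube_def)

lemma tube_holomorphic_extension:
  fixes F :: "complex ^ 'p \<Rightarrow> complex"
  assumes F: "holomorphic_vec_on F (tube C)" and C: "open C"
  shows "tube_holomorphic (\<lambda>x y. F (cvec x y)) C"
  unfolding tube_holomorphic_def
proof (intro conjI allI)
  have "continuous_on (tube C) F"
    using F unfolding holomorphic_vec_on_def
    by (meson continuous_at_imp_continuous_on has_derivative_continuous)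
  then show "continuous_on (UNIV \<times> C) (\<lambda>p. F (cvec (fst p) (snd p)))"
    by (rule continuous_on_compose2[OF _ continuous_cvec]) (auto intro: cvec_in_tube)
  fix x y v
  show "(\<lambda>w. F (cvec (x + Re w *\<^sub>R v) (y + Im w *\<^sub>R v))) holomorphic_on {w. y + Im w *\<^sub>R v \<in> C}"
  proof (subst holomorphic_on_open[OF open_slice[OF C]], intro ballI)
    fix w assume "w \<in> {w. y + Im w *\<^sub>R v \<in> C}"
    then have "cvec x y + w *s cvec v 0 \<in> tube C" unfolding cvec_line[symmetric] by (intro cvec_in_tube) simp
    then obtain D where D: "(F has_derivative D) (at (cvec x y + w *s cvec v 0))" "\<And>c u. D (c *s u) = c * D u"
      using F unfolding holomorphic_vec_on_def by blast
    have "linear (\<lambda>h::complex. h *s cvec v 0)"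
      by (intro linearI) (simp_all add: vec_eq_iff distrib_right)
    then have "bounded_linear (\<lambda>h::complex. h *s cvec v 0)" by (rule linear_conv_bounded_linear[THEN iffD1])
    then have "((\<lambda>w. cvec x y + w *s cvec v 0) has_derivative (\<lambda>h. 0 + h *s cvec v 0)) (at w)"
      by (intro has_derivative_add has_derivative_const bounded_linear_imp_has_derivative)
    from has_derivative_compose[OF this D(1)]
    have "((\<lambda>w. F (cvec x y + w *s cvec v 0)) has_derivative (\<lambda>h. D (cvec v 0) * h)) (at w)"
      by (simp add: D(2) mult.commute)
    then show "\<exists>f'. ((\<lambda>w. F (cvec (x + Re w *\<^sub>R v) (y + Im w *\<^sub>R v))) has_field_derivative f') (at w)"
      unfolding cvec_line has_field_derivative_def by blast
  qed
qed

lemma cvec_in_far_tube: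
  fixes \<Gamma> :: "(real ^ 'p) set"
  assumes y: "y \<in> interior (conjugate_cone \<Gamma>)" "q < norm y"
  shows "cvec x y \<in> far_tube \<Gamma> q"
proof -
  define im where "im z = (\<chi> i. Im (z $ i))" for z :: "complex ^ 'p"
  define U where "U = interior (conjugate_cone \<Gamma>) \<inter> {y. q < norm y}"
  have "open U" unfolding U_def by (intro open_Int open_interior open_Collect_less continuous_intros)
  moreover have "continuous_on UNIV im" unfolding im_def by (intro continuous_on_vec_lambda continuous_intros)
  ultimately have "open (im -` U)" by (simp add: open_vimage)
  moreover have "im -` U \<subseteq> tube (conjugate_cone \<Gamma> \<inter> {y. q < norm y})"
  proof
    fix z assume z: "z \<in> im -` U"
    have "z = cvec (\<chi> i. Re (z $ i)) (im z)" by (simp add: cvec_def im_def vec_eq_iff)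
    moreover have "im z \<in> conjugate_cone \<Gamma> \<inter> {y. q < norm y}"
      using z interior_subset[of "conjugate_cone \<Gamma>"] by (auto simp: U_def)
    ultimately show "z \<in> tube (conjugate_cone \<Gamma> \<inter> {y. q < norm y})" using cvec_in_tube by metis
  qed
  moreover have "cvec x y \<in> im -` U" using y by (simp add: im_def cvec_def U_def)
  ultimately show ?thesis unfolding far_tube_def by (meson interior_maximal subsetD)
qed

lemma closed_ray:
  fixes y :: "'a::euclidean_space"
  assumes "y \<noteq> 0" shows "closed ((\<lambda>t. t *\<^sub>R y) ` {0..})"
proof -
  have "(\<lambda>t. t *\<^sub>R y) ` {0..} = {z. z = ((z \<bullet> y) / (y \<bullet> y)) *\<^sub>R y} \<inter> {z. 0 \<le> z \<bullet> y}"
  proof (intro equalityI subsetI)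
    fix z assume "z \<in> (\<lambda>t. t *\<^sub>R y) ` {0..}"
    then obtain t where "t \<ge> 0" "z = t *\<^sub>R y" by auto
    then show "z \<in> {z. z = ((z \<bullet> y) / (y \<bullet> y)) *\<^sub>R y} \<inter> {z. 0 \<le> z \<bullet> y}" using assms by simp
  next
    fix z assume "z \<in> {z. z = ((z \<bullet> y) / (y \<bullet> y)) *\<^sub>R y} \<inter> {z. 0 \<le> z \<bullet> y}"
    then have "z = ((z \<bullet> y) / (y \<bullet> y)) *\<^sub>R y" "(z \<bullet> y) / (y \<bullet> y) \<ge> 0" by auto
    then show "z \<in> (\<lambda>t. t *\<^sub>R y) ` {0..}" by (metis atLeast_iff imageI)
  qed
  moreover have "closed \<dots>"
    by (intro closed_Int closed_Collect_eq closed_Collect_le continuous_intros) (use assms in auto)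
  ultimately show ?thesis by simp
qed

section \<open>Limits along inner cones\<close>

locale vec_proper_cone = proper_cone \<Gamma> for \<Gamma> :: "(real ^ 'p) set"
begin

lemma inner_cone_ray:
  assumes y: "y \<in> C" shows "inner_cone \<Gamma> ((\<lambda>t. t *\<^sub>R y) ` {0..})"
  unfolding inner_cone_def
proof (intro conjI)
  show "closed ((\<lambda>t. t *\<^sub>R y) ` {0..})" using y zero_notin_C by (intro closed_ray) auto
  show "pos_cone ((\<lambda>t. t *\<^sub>R y) ` {0..})"
    unfolding pos_cone_def
  proof (intro ballI allI impI)
    fix z and s :: real assume z: "z \<in> (\<lambda>t. t *\<^sub>R y) ` {0..}" and s: "s > 0"
    then obtain t where t: "t \<ge> 0" "z = t *\<^sub>R y" by auto
    then have "s *\<^sub>R z = (s * t) *\<^sub>R y" "s * t \<ge> 0" using s by simp_all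
    then show "s *\<^sub>R z \<in> (\<lambda>t. t *\<^sub>R y) ` {0..}" by (metis atLeast_iff imageI)
  qed
  show "(\<lambda>t. t *\<^sub>R y) ` {0..} \<subseteq> C \<union> {0}"
  proof
    fix z assume "z \<in> (\<lambda>t. t *\<^sub>R y) ` {0..}"
    then obtain t where t: "t \<ge> 0" "z = t *\<^sub>R y" by auto
    then show "z \<in> C \<union> {0}" using pos_coneD[OF pos_cone_C y, of t] by (cases "t = 0") auto
  qed
qed

text \<open>On the compact set of unit vectors of \<open>K\<close> the product with \<open>l\<close> has a positive minimum.\<close>

lemma inner_at_top:
  assumes K: "inner_cone \<Gamma> K" and l: "l \<in> \<Gamma>" "l \<noteq> 0"
  shows "filterlim (\<lambda>y. y \<bullet> l) at_top (to_infinity_in K)"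
proof -
  have Kc: "closed K" "pos_cone K" "K \<subseteq> C \<union> {0}" using K by (auto simp: inner_cone_def)
  have "\<exists>k>0. \<forall>y\<in>K. k * norm y \<le> y \<bullet> l"
  proof (cases "K \<inter> sphere 0 1 = {}")
    case True
    have "1 * norm y \<le> y \<bullet> l" if "y \<in> K" for y
    proof -
      have "y = 0"
      proof (rule ccontr)
        assume "y \<noteq> 0"
        then have "(1 / norm y) *\<^sub>R y \<in> K \<inter> sphere 0 1" using pos_coneD[OF Kc(2) that, of "1 / norm y"] by simp
        with True show False by blast
      qed
      then show ?thesis by simp
    qed
    then show ?thesis using zero_less_one by blast
  next
    case False
    have "compact (K \<inter> sphere 0 1)" using Kc(1) by (intro closed_Int_compact) auto
    moreover have "continuous_on (K \<inter> sphere 0 1) (\<lambda>y. y \<bullet> l)" by (intro continuous_intros)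
    ultimately obtain y0 where y0: "y0 \<in> K \<inter> sphere 0 1" "\<And>y. y \<in> K \<inter> sphere 0 1 \<Longrightarrow> y0 \<bullet> l \<le> y \<bullet> l"
      using continuous_attains_inf[of "K \<inter> sphere 0 1" "\<lambda>y. y \<bullet> l"] False by blast
    have "y0 \<in> C" using y0(1) Kc(3) by auto
    then have pos: "y0 \<bullet> l > 0" by (rule C_pos[OF _ l])
    have "(y0 \<bullet> l) * norm y \<le> y \<bullet> l" if y: "y \<in> K" for y
    proof (cases "y = 0")
      case False
      then have "(1 / norm y) *\<^sub>R y \<in> K \<inter> sphere 0 1" using pos_coneD[OF Kc(2) y, of "1 / norm y"] by simp
      from y0(2)[OF this] show ?thesis using False by (simp add: field_simps)
    qed simp
    with pos show ?thesis by blast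
  qed
  then obtain k where k: "k > 0" "\<And>y. y \<in> K \<Longrightarrow> k * norm y \<le> y \<bullet> l" by blast
  show ?thesis
  proof (rule filterlim_at_top_mono)
    have "filterlim (\<lambda>y::real^'p. k * norm y) at_top at_infinity"
      by (rule filterlim_tendsto_pos_mult_at_top[OF tendsto_const k(1) filterlim_norm_at_top])
    then show "filterlim (\<lambda>y. k * norm y) at_top (to_infinity_in K)" by (rule filterlim_mono) auto
    show "\<forall>\<^sub>F y in to_infinity_in K. k * norm y \<le> y \<bullet> l"
      unfolding eventually_inf_principal by (rule always_eventually) (use k(2) in auto)
  qed
qed

lemma exp_char_tendsto_0:
  assumes "inner_cone \<Gamma> K" "l \<in> \<Gamma>" "l \<noteq> 0"
  shows "((\<lambda>y. exp (- (y \<bullet> l))) \<longlongrightarrow> 0) (to_infinity_in K)"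
  by (rule filterlim_compose[OF exp_at_bot]) (intro filterlim_uminus_at_top[THEN iffD1] inner_at_top assms)

text \<open>Trigonometric polynomials with frequencies in \<open>\<Gamma>\<close> that are close on the boundary are close in the tube. That they converge to
\<open>\<Phi>\<close> is seen after multiplication by \<open>exp_char k\<close>, which makes the maximum principle applicable to the
difference; undoing this costs a factor \<open>exp (y \<bullet> k)\<close>, which is constant at each fixed point and therefore
disappears in the limit.\<close>

lemma trig_approx_tube:
  fixes \<Phi> :: "real ^ 'p \<Rightarrow> real ^ 'p \<Rightarrow> complex"
  assumes ap: "ap (\<lambda>x. \<Phi> x 0)" and k: "k \<in> \<Gamma>" and T: "bounded_tube (\<lambda>x y. \<Phi> x y * exp_char k x y) C"
    and sp: "\<And>l. fourier (\<lambda>x. \<Phi> x 0) l \<noteq> 0 \<Longrightarrow> l \<in> \<Gamma>" and e: "e > 0"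
  shows "\<exists>A c. finite A \<and> A \<subseteq> \<Gamma> \<and> (\<forall>x y. y \<in> C \<or> y = 0 \<longrightarrow> cmod (\<Phi> x y - (\<Sum>l\<in>A. c l * exp_char l x y)) \<le> e)"
proof -
  have poly: "bounded_tube (\<lambda>x y. \<Sum>l\<in>A. c l * exp_char l x y) C" if "A \<subseteq> \<Gamma>" for A and c :: "real ^ 'p \<Rightarrow> complex"
    by (intro bounded_tube_sum bounded_tube_mult bounded_tube_const bounded_tube_exp_char) (use that C_D in blast)
  have appr: "\<exists>A c. finite A \<and> A \<subseteq> \<Gamma> \<and> (\<forall>x. cmod (\<Phi> x 0 - (\<Sum>l\<in>A. c l * exp_char l x 0)) \<le> d)" if "d > 0" for d
    using trig_approx[OF ap that] sp unfolding exp_char_0 by blast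
  obtain A c where A: "finite A" "A \<subseteq> \<Gamma>" "\<And>x. cmod (\<Phi> x 0 - (\<Sum>l\<in>A. c l * exp_char l x 0)) \<le> e"
    using appr[OF e] by blast
  have "cmod (\<Phi> x y - (\<Sum>l\<in>A. c l * exp_char l x y)) \<le> e" if y: "y \<in> C" for x y
  proof (rule field_le_epsilon)
    fix \<eta> :: real assume \<eta>: "\<eta> > 0"
    define E where "E = exp (y \<bullet> k)"
    define d where "d = \<eta> / (E + 1)"
    have E: "E > 0" and d: "d > 0" using \<eta> by (auto simp: E_def d_def add_pos_pos)
    obtain A' c' where A': "finite A'" "A' \<subseteq> \<Gamma>" "\<And>x. cmod (\<Phi> x 0 - (\<Sum>l\<in>A'. c' l * exp_char l x 0)) \<le> d"
      using appr[OF d] by blast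
    have chk: "bounded_tube (exp_char k) C" by (rule bounded_tube_exp_char) (use k C_D in blast)
    have "bounded_tube (\<lambda>x y. \<Phi> x y * exp_char k x y - (\<Sum>l\<in>A'. c' l * exp_char l x y) * exp_char k x y) C"
      by (intro bounded_tube_diff T bounded_tube_mult poly[OF A'(2)] chk)
    moreover have "cmod (\<Phi> x 0 * exp_char k x 0 - (\<Sum>l\<in>A'. c' l * exp_char l x 0) * exp_char k x 0) \<le> d" for x
      using A'(3)[of x] by (simp add: left_diff_distrib[symmetric] norm_mult norm_exp_char)
    ultimately have "cmod (\<Phi> x y * exp_char k x y - (\<Sum>l\<in>A'. c' l * exp_char l x y) * exp_char k x y) \<le> d"
      by (rule bounded_tube_maximum[OF _ pos_cone_C _ y])
    then have "cmod (\<Phi> x y - (\<Sum>l\<in>A'. c' l * exp_char l x y)) * exp (- (y \<bullet> k)) \<le> d"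
      by (simp add: left_diff_distrib[symmetric] norm_mult norm_exp_char)
    then have 1: "cmod (\<Phi> x y - (\<Sum>l\<in>A'. c' l * exp_char l x y)) \<le> d * E"
      by (simp add: E_def exp_minus field_simps)
    have "bounded_tube (\<lambda>x y. (\<Sum>l\<in>A'. c' l * exp_char l x y) - (\<Sum>l\<in>A. c l * exp_char l x y)) C"
      by (intro bounded_tube_diff poly A A')
    moreover have "cmod ((\<Sum>l\<in>A'. c' l * exp_char l x 0) - (\<Sum>l\<in>A. c l * exp_char l x 0)) \<le> d + e" for x
      by (rule norm_diff_triangle_le[OF _ A(3)]) (use A'(3)[of x] in \<open>simp add: norm_minus_commute\<close>)
    ultimately have 2: "cmod ((\<Sum>l\<in>A'. c' l * exp_char l x y) - (\<Sum>l\<in>A. c l * exp_char l x y)) \<le> d + e"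
      by (rule bounded_tube_maximum[OF _ pos_cone_C _ y])
    have "d * E + (d + e) = e + d * (E + 1)" by (simp add: algebra_simps)
    also have "\<dots> = e + \<eta>" using E by (simp add: d_def)
    finally show "cmod (\<Phi> x y - (\<Sum>l\<in>A. c l * exp_char l x y)) \<le> e + \<eta>"
      using norm_diff_triangle_le[OF 1 2] by simp
  qed
  with A show ?thesis by (intro exI[of _ A] exI[of _ c]) auto
qed

theorem uniform_limit_at_infinity:
  fixes \<Phi> :: "real ^ 'p \<Rightarrow> real ^ 'p \<Rightarrow> complex"
  assumes ap: "ap (\<lambda>x. \<Phi> x 0)" and k: "k \<in> \<Gamma>" and T: "bounded_tube (\<lambda>x y. \<Phi> x y * exp_char k x y) C"
    and sp: "\<And>l. fourier (\<lambda>x. \<Phi> x 0) l \<noteq> 0 \<Longrightarrow> l \<in> \<Gamma>" and K: "inner_cone \<Gamma> K"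
  shows "uniform_limit UNIV (\<lambda>y x. \<Phi> x y) (\<lambda>x. fourier (\<lambda>x. \<Phi> x 0) 0) (to_infinity_in K)"
  unfolding uniform_limit_iff
proof (intro allI impI)
  fix e :: real assume e: "e > 0"
  then have "e/4 > 0" by simp
  from trig_approx_tube[OF ap k T sp this] obtain A c where A: "finite A" "A \<subseteq> \<Gamma>"
    "\<And>x y. y \<in> C \<or> y = 0 \<Longrightarrow> cmod (\<Phi> x y - (\<Sum>l\<in>A. c l * exp_char l x y)) \<le> e/4" by blast
  define c0 where "c0 = (if 0 \<in> A then c 0 else 0)"
  define S where "S y = (\<Sum>l\<in>A - {0}. cmod (c l) * exp (- (y \<bullet> l)))" for y
  have "cmod (fourier (\<lambda>x. \<Phi> x 0) 0 - fourier (\<lambda>x. \<Sum>l\<in>A. c l * cis (x \<bullet> l)) 0) \<le> e/4"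
    by (rule fourier_close[OF ap]) (use A(3)[of 0] in \<open>auto intro!: ap_intros simp: exp_char_0\<close>)
  then have 1: "cmod (c0 - fourier (\<lambda>x. \<Phi> x 0) 0) \<le> e/4"
    by (simp add: fourier_trig_poly[OF A(1)] c0_def norm_minus_commute)
  have 2: "cmod ((\<Sum>l\<in>A. c l * exp_char l x y) - c0) \<le> S y" for x y
  proof -
    have "(\<Sum>l\<in>A. c l * exp_char l x y) = c0 + (\<Sum>l\<in>A - {0}. c l * exp_char l x y)"
      using A(1) by (cases "0 \<in> A") (simp_all add: sum.remove c0_def exp_char_def)
    then have "cmod ((\<Sum>l\<in>A. c l * exp_char l x y) - c0) = cmod (\<Sum>l\<in>A - {0}. c l * exp_char l x y)" by simp
    also have "\<dots> \<le> S y" unfolding S_def by (rule sum_norm_le) (simp add: norm_mult norm_exp_char)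
    finally show ?thesis .
  qed
  have "(S \<longlongrightarrow> (\<Sum>l\<in>A - {0}. cmod (c l) * 0)) (to_infinity_in K)"
    unfolding S_def by (intro tendsto_intros exp_char_tendsto_0[OF K]) (use A(2) in auto)
  then have "\<forall>\<^sub>F y in to_infinity_in K. S y < e/4"
    using e by (intro order_tendstoD) auto
  moreover have "\<forall>\<^sub>F y in to_infinity_in K. y \<in> C \<or> y = 0"
    unfolding eventually_inf_principal using K by (intro always_eventually) (auto simp: inner_cone_def)
  ultimately show "\<forall>\<^sub>F y in to_infinity_in K. \<forall>x\<in>UNIV. dist (\<Phi> x y) (fourier (\<lambda>x. \<Phi> x 0) 0) < e"
  proof eventually_elim
    case (elim y)
    show ?case
    proof
      fix x
      have "cmod (\<Phi> x y - c0) \<le> e/4 + e/4"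
        by (rule norm_diff_triangle_le[OF A(3)[OF elim(2)]]) (use 2[of x y] elim(1) in linarith)
      from norm_diff_triangle_le[OF this 1] show "dist (\<Phi> x y) (fourier (\<lambda>x. \<Phi> x 0) 0) < e"
        using e by (simp add: dist_norm)
    qed
  qed
qed

section \<open>Omitted values\<close>

text \<open>Choose \<open>k\<close> as so large a multiple of an interior point of \<open>\<Gamma>\<close> that \<open>y \<bullet> k\<close> is at least \<open>b \<bar>y\<bar>\<close> on the conjugate
cone.\<close>

lemma bounded_tube_extension:
  assumes ext: "holomorphic_extension \<Gamma> f F"
    and growth: "\<And>K. inner_cone \<Gamma> K \<Longrightarrow> \<exists>B. \<forall>x. \<forall>y\<in>K. cmod (F (cvec x y)) \<le> B * exp (b * norm y)"
  obtains k where "k \<in> \<Gamma>" "bounded_tube (\<lambda>x y. F (cvec x y) * exp_char k x y) C"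
proof -
  obtain e where e: "e \<in> interior \<Gamma>" using interior_ne by blast
  obtain d where d: "d > 0" "\<And>y. y \<in> conjugate_cone \<Gamma> \<Longrightarrow> d * norm y \<le> y \<bullet> e" using interior_coercive[OF e] by blast
  define k where "k = (\<bar>b\<bar> / d) *\<^sub>R e"
  have kG: "k \<in> \<Gamma>" unfolding k_def using d e interior_subset by (intro scale_in) auto
  have kb: "b * norm y \<le> y \<bullet> k" if "y \<in> conjugate_cone \<Gamma>" for y
  proof -
    have "b * norm y \<le> (\<bar>b\<bar> / d) * (d * norm y)" using d(1) by (simp add: mult_right_mono)
    also have "\<dots> \<le> (\<bar>b\<bar> / d) * (y \<bullet> e)" using d that by (intro mult_left_mono) auto
    finally show ?thesis by (simp add: k_def)
  qed
  have "bounded_tube (\<lambda>x y. F (cvec x y) * exp_char k x y) C"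
    unfolding bounded_tube_def
  proof (intro conjI ballI)
    show "tube_holomorphic (\<lambda>x y. F (cvec x y) * exp_char k x y) C"
      using ext by (intro tube_holomorphic_mult tube_holomorphic_exp_char tube_holomorphic_extension)
        (auto simp: holomorphic_extension_def)
    fix y assume y: "y \<in> C"
    let ?K = "(\<lambda>t. t *\<^sub>R y) ` {0..}"
    have K: "inner_cone \<Gamma> ?K" by (rule inner_cone_ray[OF y])
    have "continuous_on (tube ?K) F" using ext K by (auto simp: holomorphic_extension_def)
    moreover have "continuous_on (UNIV \<times> {0..}) (\<lambda>p. cvec (fst p) (snd p *\<^sub>R y))"
      using continuous_on_compose2[OF continuous_cvec[of UNIV], of "UNIV \<times> {0..}" "\<lambda>p. (fst p, snd p *\<^sub>R y)"]
      by (simp add: continuous_intros)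
    ultimately have "continuous_on (UNIV \<times> {0..}) (\<lambda>p. F (cvec (fst p) (snd p *\<^sub>R y)))"
      by (rule continuous_on_compose2) (auto intro!: cvec_in_tube)
    then show "continuous_on (UNIV \<times> {0..}) (\<lambda>p. F (cvec (fst p) (snd p *\<^sub>R y)) * exp_char k (fst p) (snd p *\<^sub>R y))"
      unfolding exp_char_def by (intro continuous_intros)
    obtain B where B: "\<And>x z. z \<in> ?K \<Longrightarrow> cmod (F (cvec x z)) \<le> B * exp (b * norm z)" using growth[OF K] by blast
    have "cmod (F (cvec x (t *\<^sub>R y)) * exp_char k x (t *\<^sub>R y)) \<le> B" if t: "t \<ge> 0" for x t
    proof -
      define z where "z = t *\<^sub>R y"
      have z: "z \<in> ?K" "z \<in> conjugate_cone \<Gamma>"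
        using t y interior_subset[of "conjugate_cone \<Gamma>"] by (auto simp: z_def conjugate_cone_def)
      have B0: "B \<ge> 0" using order_trans[OF norm_ge_zero B[OF z(1), of 0]] by (simp add: zero_le_mult_iff)
      have "cmod (F (cvec x z) * exp_char k x z) \<le> B * exp (b * norm z) * exp (- (z \<bullet> k))"
        unfolding norm_mult norm_exp_char by (intro mult_right_mono B z) auto
      also have "\<dots> = B * exp (b * norm z - z \<bullet> k)" by (simp add: exp_diff exp_minus divide_inverse)
      also have "\<dots> \<le> B * 1" using kb[OF z(2)] B0 by (intro mult_left_mono) auto
      finally show ?thesis by (simp add: z_def)
    qed
    then show "\<exists>B. \<forall>x. \<forall>t\<ge>0. cmod (F (cvec x (t *\<^sub>R y)) * exp_char k x (t *\<^sub>R y)) \<le> B" by blast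
  qed
  with kG show ?thesis by (rule that)
qed

text \<open>Apply \<open>zero_free_spectrum\<close> to \<open>F - w\<close> times \<open>exp_char k\<close>, whose spectrum on the boundary is the one of \<open>f - w\<close>
translated by \<open>k\<close>.\<close>

lemma omitted_value_spectrum:
  fixes F :: "complex ^ 'p \<Rightarrow> complex"
  assumes f: "ap f" and F0: "\<And>x. F (cvec x 0) = f x"
    and k: "k \<in> \<Gamma>" and T: "bounded_tube (\<lambda>x y. F (cvec x y) * exp_char k x y) C"
    and omit: "\<And>z. z \<in> far_tube \<Gamma> q \<Longrightarrow> F z \<noteq> w"
  shows "\<exists>c. fourier (\<lambda>x. f x - w) c \<noteq> 0 \<and> (\<forall>l. fourier (\<lambda>x. f x - w) l \<noteq> 0 \<longrightarrow> l - c \<in> \<Gamma>)"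
proof -
  define \<Phi> where "\<Phi> x y = (F (cvec x y) - w) * exp_char k x y" for x y
  have chk: "bounded_tube (exp_char k) C" by (rule bounded_tube_exp_char) (use k C_D in blast)
  have "bounded_tube (\<lambda>x y. F (cvec x y) * exp_char k x y - w * exp_char k x y) C"
    by (intro bounded_tube_diff T bounded_tube_mult bounded_tube_const chk)
  then have T\<Phi>: "bounded_tube \<Phi> C" by (simp add: \<Phi>_def[abs_def] left_diff_distrib)
  have \<Phi>0: "\<Phi> x 0 = cis (x \<bullet> k) * (f x - w)" for x by (simp add: \<Phi>_def F0 exp_char_0)
  have ap0: "ap (\<lambda>x. f x - w)" by (intro ap_intros f)
  have "ap (\<lambda>x. \<Phi> x 0)" unfolding \<Phi>0 by (rule ap_mult[OF ap_cis ap0])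
  moreover have "\<Phi> x y \<noteq> 0" if "y \<in> C" "q < norm y" for x y
    using omit[OF cvec_in_far_tube[OF that, of x]] by (simp add: \<Phi>_def exp_char_def)
  ultimately obtain c where c: "fourier (\<lambda>x. \<Phi> x 0) c \<noteq> 0" "\<And>l. fourier (\<lambda>x. \<Phi> x 0) l \<noteq> 0 \<Longrightarrow> l - c \<in> \<Gamma>"
    using zero_free_spectrum[OF T\<Phi>] by blast
  have eq: "fourier (\<lambda>x. \<Phi> x 0) l = fourier (\<lambda>x. f x - w) (l - k)" for l
    unfolding \<Phi>0 by (rule fourier_cis_mult[OF ap0])
  show ?thesis
  proof (intro exI[of _ "c - k"] conjI allI impI)
    show "fourier (\<lambda>x. f x - w) (c - k) \<noteq> 0" using c(1) eq by simp
    fix l assume "fourier (\<lambda>x. f x - w) l \<noteq> 0"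
    then have "fourier (\<lambda>x. \<Phi> x 0) (l + k) \<noteq> 0" using eq[of "l + k"] by simp
    from c(2)[OF this] show "l - (c - k) \<in> \<Gamma>" by (simp add: algebra_simps)
  qed
qed

end

lemma fourier_shift_const:
  fixes f :: "'a::euclidean_space \<Rightarrow> complex"
  assumes "ap f" shows "fourier (\<lambda>x. f x - w) l = fourier f l - (if l = 0 then w else 0)"
  using fourier_diff[OF assms ap_const] by (simp add: fourier_const)

theorem theorem2:
  fixes \<Gamma> :: "(real ^ 'p) set"
    and f :: "real ^ 'p \<Rightarrow> complex"
    and F :: "complex ^ 'p \<Rightarrow> complex"
  assumes "closed \<Gamma>" and "convex \<Gamma>" and "pos_cone \<Gamma>"
    and "interior \<Gamma> \<noteq> {}"
    and "\<Gamma> \<inter> uminus ` \<Gamma> = {0}"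
    and "almost_periodic f"
    and "holomorphic_extension \<Gamma> f F"
    and "\<exists>b::real. \<forall>\<Gamma>'. inner_cone \<Gamma> \<Gamma>' \<longrightarrow>
           (\<exists>B::real. \<forall>x. \<forall>y\<in>\<Gamma>'. cmod (F (cvec x y)) \<le> B * exp (b * norm y))"
  shows
    "(spectrum f - {0} \<subseteq> \<Gamma> \<longrightarrow>
        (\<forall>\<Gamma>'. inner_cone \<Gamma> \<Gamma>' \<longrightarrow>
           (\<exists>l. uniform_limit UNIV (\<lambda>y x. F (cvec x y)) (\<lambda>x. l) (to_infinity_in \<Gamma>'))))
   \<and> ((\<exists>\<Lambda> \<in> (spectrum f \<inter> uminus ` \<Gamma>) - {0}. spectrum f - {0} \<subseteq> (+) \<Lambda> ` \<Gamma>) \<longrightarrow>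
        (\<forall>\<Gamma>'. inner_cone \<Gamma> \<Gamma>' \<longrightarrow>
           (\<forall>M::real. \<forall>\<^sub>F y in to_infinity_in \<Gamma>'. \<forall>x. M < cmod (F (cvec x y)))))
   \<and> ((\<exists>\<Lambda> \<in> ((closure (spectrum f) - spectrum f) \<inter> uminus ` \<Gamma>) - {0}.
          spectrum f - {0} \<subseteq> (+) \<Lambda> ` \<Gamma>) \<longrightarrow>
        (\<forall>q::real. \<forall>w. \<exists>z\<in>far_tube \<Gamma> q. F z = w))
   \<and> ((\<exists>\<Lambda> \<in> closure (spectrum f) - (uminus ` \<Gamma> \<union> \<Gamma>). spectrum f - {0} \<subseteq> (+) \<Lambda> ` \<Gamma>) \<longrightarrow>
        (\<forall>q::real. \<exists>w\<^sub>0. \<forall>w. w \<noteq> w\<^sub>0 \<longrightarrow> (\<exists>z\<in>far_tube \<Gamma> q. F z = w)))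
   \<and> ((\<forall>\<Lambda> \<in> closure (spectrum f). \<not> spectrum f - {0} \<subseteq> (+) \<Lambda> ` \<Gamma>) \<and> \<not> spectrum f \<subseteq> \<Gamma> \<longrightarrow>
        (\<forall>q::real. \<forall>w. \<exists>z\<in>far_tube \<Gamma> q. F z = w))"
proof -
  interpret vec_proper_cone \<Gamma> by unfold_locales (use assms in auto)
  have apf: "ap f" by (rule almost_periodic_imp_ap[OF assms(6)])
  note sp = spectrum_eq[OF apf]
  have F0: "F (cvec x 0) = f x" for x using assms(7) by (simp add: holomorphic_extension_def)
  obtain b where b: "\<And>K. inner_cone \<Gamma> K \<Longrightarrow> \<exists>B. \<forall>x. \<forall>y\<in>K. cmod (F (cvec x y)) \<le> B * exp (b * norm y)"
    using assms(8) by blast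
  obtain k where k: "k \<in> \<Gamma>" "bounded_tube (\<lambda>x y. F (cvec x y) * exp_char k x y) C"
    by (rule bounded_tube_extension[OF assms(7) b])
  have in_shift: "l \<in> (+) \<Lambda> ` \<Gamma> \<longleftrightarrow> l - \<Lambda> \<in> \<Gamma>" for l \<Lambda>
    by (auto simp: image_iff algebra_simps intro: bexI[of _ "l - \<Lambda>"])
  have in_neg: "l \<in> uminus ` \<Gamma> \<longleftrightarrow> - l \<in> \<Gamma>" for l
    by (auto simp: image_iff intro: bexI[of _ "- l"])
  have closed_shift: "closed ((+) \<Lambda> ` \<Gamma>)" for \<Lambda> using assms(1) by (rule closed_translation)
  \<comment> \<open>\<open>c\<close> is the vertex of the spectrum of \<open>f - w\<close>; passing to \<open>f\<close> changes the spectrum only at 0\<close>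
  have omitted: "\<exists>c. (c = 0 \<or> c \<in> spectrum f) \<and> fourier (\<lambda>x. f x - w) c \<noteq> 0 \<and>
      (fourier (\<lambda>x. f x - w) 0 \<noteq> 0 \<longrightarrow> - c \<in> \<Gamma>) \<and> spectrum f - {0} \<subseteq> (+) c ` \<Gamma>"
    if om: "\<not> (\<exists>z\<in>far_tube \<Gamma> q. F z = w)" for q w
  proof -
    obtain c where c: "fourier (\<lambda>x. f x - w) c \<noteq> 0" "\<And>l. fourier (\<lambda>x. f x - w) l \<noteq> 0 \<Longrightarrow> l - c \<in> \<Gamma>"
      using omitted_value_spectrum[OF apf F0 k, of q w] om by blast
    have "c = 0 \<or> c \<in> spectrum f" using c(1) by (auto simp: sp fourier_shift_const[OF apf])
    moreover have "fourier (\<lambda>x. f x - w) 0 \<noteq> 0 \<longrightarrow> - c \<in> \<Gamma>" using c(2)[of 0] by simp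
    moreover have "l - c \<in> \<Gamma>" if "l \<in> spectrum f - {0}" for l
      using c(2)[of l] that by (simp add: sp fourier_shift_const[OF apf])
    then have "spectrum f - {0} \<subseteq> (+) c ` \<Gamma>" unfolding subset_iff in_shift by blast
    ultimately show ?thesis using c(1) by blast
  qed
  have in_closure: "l \<in> (+) c ` \<Gamma>" if l: "l \<in> closure (spectrum f)" "l \<noteq> 0" and c: "spectrum f - {0} \<subseteq> (+) c ` \<Gamma>" for l c
  proof -
    have "spectrum f \<subseteq> insert 0 (spectrum f - {0})" by blast
    then have "closure (spectrum f) \<subseteq> closure (insert 0 (spectrum f - {0}))" by (rule closure_mono)
    also have "\<dots> = insert 0 (closure (spectrum f - {0}))" by (rule closure_insert)
    finally have "l \<in> closure (spectrum f - {0})" using l by blast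
    also have "\<dots> \<subseteq> (+) c ` \<Gamma>" by (rule closure_minimal[OF c closed_shift])
    finally show ?thesis .
  qed
  have part1: "\<exists>l. uniform_limit UNIV (\<lambda>y x. F (cvec x y)) (\<lambda>x. l) (to_infinity_in K)"
    if "spectrum f - {0} \<subseteq> \<Gamma>" "inner_cone \<Gamma> K" for K
  proof -
    have "l \<in> \<Gamma>" if "fourier (\<lambda>x. F (cvec x 0)) l \<noteq> 0" for l
      using that \<open>spectrum f - {0} \<subseteq> \<Gamma>\<close> zero_in unfolding F0 by (cases "l = 0") (auto simp: sp)
    moreover have "ap (\<lambda>x. F (cvec x 0))" using apf by (simp add: F0)
    ultimately show ?thesis using uniform_limit_at_infinity[OF _ k _ that(2)] by blast
  qed
  have part2: "\<forall>\<^sub>F y in to_infinity_in K. \<forall>x. M < cmod (F (cvec x y))"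
    if \<Lambda>: "\<Lambda> \<in> (spectrum f \<inter> uminus ` \<Gamma>) - {0}" "spectrum f - {0} \<subseteq> (+) \<Lambda> ` \<Gamma>" and K: "inner_cone \<Gamma> K" for \<Lambda> K M
  proof -
    have \<Lambda>': "- \<Lambda> \<in> \<Gamma>" "- \<Lambda> \<noteq> 0" "\<Lambda> \<in> spectrum f" using \<Lambda>(1) by (auto simp: in_neg)
    define \<Phi> where "\<Phi> x y = F (cvec x y) * exp_char (- \<Lambda>) x y" for x y
    have \<Phi>0: "\<Phi> x 0 = cis (x \<bullet> (- \<Lambda>)) * f x" for x unfolding \<Phi>_def exp_char_0 F0 by (rule mult.commute)
    have ap\<Phi>: "ap (\<lambda>x. \<Phi> x 0)" unfolding \<Phi>0 by (rule ap_mult[OF ap_cis apf])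
    have fourier\<Phi>: "fourier (\<lambda>x. \<Phi> x 0) l = fourier f (l + \<Lambda>)" for l unfolding \<Phi>0 fourier_cis_mult[OF apf] by simp
    have "bounded_tube (\<lambda>x y. (F (cvec x y) * exp_char k x y) * exp_char (- \<Lambda>) x y) C"
      by (intro bounded_tube_mult k bounded_tube_exp_char) (use C_D \<Lambda>' in blast)
    then have T: "bounded_tube (\<lambda>x y. \<Phi> x y * exp_char k x y) C" by (simp add: \<Phi>_def mult_ac)
    have spG: "l \<in> \<Gamma>" if "fourier (\<lambda>x. \<Phi> x 0) l \<noteq> 0" for l
    proof (cases "l + \<Lambda> = 0")
      case True
      then have "l = - \<Lambda>" by (simp add: eq_neg_iff_add_eq_0)
      then show ?thesis using \<Lambda>' by simp
    next
      case False
      then have "l + \<Lambda> \<in> spectrum f - {0}" using that by (simp add: fourier\<Phi> sp)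
      then have "l + \<Lambda> \<in> (+) \<Lambda> ` \<Gamma>" using \<Lambda>(2) by blast
      then show ?thesis by (simp add: in_shift)
    qed
    define a where "a = cmod (fourier f \<Lambda>)"
    have a: "a > 0" using \<Lambda>'(3) by (simp add: a_def sp)
    have "uniform_limit UNIV (\<lambda>y x. \<Phi> x y) (\<lambda>x. fourier (\<lambda>x. \<Phi> x 0) 0) (to_infinity_in K)"
      by (rule uniform_limit_at_infinity[OF ap\<Phi> k(1) T spG K])
    then have "\<forall>\<^sub>F y in to_infinity_in K. \<forall>x\<in>UNIV. dist (\<Phi> x y) (fourier f \<Lambda>) < a/2"
      unfolding uniform_limit_iff fourier\<Phi> using a by (elim allE[of _ "a/2"]) simp
    moreover have "filterlim (\<lambda>y. exp (y \<bullet> (- \<Lambda>))) at_top (to_infinity_in K)"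
      by (rule filterlim_compose[OF exp_at_top inner_at_top[OF K \<Lambda>'(1,2)]])
    then have "\<forall>\<^sub>F y in to_infinity_in K. 2 * \<bar>M\<bar> / a < exp (y \<bullet> (- \<Lambda>))"
      by (simp add: filterlim_at_top_dense)
    ultimately show ?thesis
    proof eventually_elim
      case (elim y)
      show ?case
      proof
        fix x
        have "dist (\<Phi> x y) (fourier f \<Lambda>) < a/2" using elim(1) by blast
        then have "a/2 \<le> cmod (\<Phi> x y)"
          using norm_triangle_ineq2[of "fourier f \<Lambda>" "\<Phi> x y"] by (simp add: a_def dist_norm norm_minus_commute)
        also have "cmod (\<Phi> x y) = cmod (F (cvec x y)) * exp (- (y \<bullet> (- \<Lambda>)))"
          by (simp only: \<Phi>_def norm_mult norm_exp_char)
        finally have low: "a/2 * exp (y \<bullet> (- \<Lambda>)) \<le> cmod (F (cvec x y))"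
          by (simp add: exp_minus field_simps)
        have "\<bar>M\<bar> < a/2 * exp (y \<bullet> (- \<Lambda>))" using elim(2) a by (simp add: field_simps)
        then show "M < cmod (F (cvec x y))" using low by linarith
      qed
    qed
  qed
  have part3: "\<exists>z\<in>far_tube \<Gamma> q. F z = w"
    if \<Lambda>: "\<Lambda> \<in> ((closure (spectrum f) - spectrum f) \<inter> uminus ` \<Gamma>) - {0}" "spectrum f - {0} \<subseteq> (+) \<Lambda> ` \<Gamma>" for \<Lambda> q w
  proof (rule ccontr)
    assume "\<not> (\<exists>z\<in>far_tube \<Gamma> q. F z = w)"
    from omitted[OF this] obtain c where c: "c = 0 \<or> c \<in> spectrum f" "spectrum f - {0} \<subseteq> (+) c ` \<Gamma>" by blast
    have "\<Lambda> - c \<in> \<Gamma>" using in_closure[OF _ _ c(2), of \<Lambda>] \<Lambda>(1) by (simp add: in_shift)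
    moreover have "- (\<Lambda> - c) \<in> \<Gamma>"
    proof (cases "c = 0")
      case True then show ?thesis using \<Lambda>(1) by (simp add: in_neg)
    next
      case False
      then have "c \<in> (+) \<Lambda> ` \<Gamma>" using c(1) \<Lambda>(2) by blast
      then show ?thesis by (simp add: in_shift)
    qed
    ultimately have "\<Lambda> = c" using pointedD by fastforce
    then show False using c(1) \<Lambda>(1) by blast
  qed
  have part4: "\<exists>w0. \<forall>w. w \<noteq> w0 \<longrightarrow> (\<exists>z\<in>far_tube \<Gamma> q. F z = w)"
    if \<Lambda>: "\<Lambda> \<in> closure (spectrum f) - (uminus ` \<Gamma> \<union> \<Gamma>)" "spectrum f - {0} \<subseteq> (+) \<Lambda> ` \<Gamma>" for \<Lambda> q
  \<comment> \<open>the only value that can be omitted is the mean of \<open>f\<close>\<close>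
  proof (intro exI[of _ "fourier f 0"] allI impI)
    fix w assume w: "w \<noteq> fourier f 0"
    have ne: "\<Lambda> \<noteq> 0" "\<Lambda> \<notin> \<Gamma>" "- \<Lambda> \<notin> \<Gamma>" using \<Lambda>(1) zero_in by (auto simp: in_neg)
    show "\<exists>z\<in>far_tube \<Gamma> q. F z = w"
    proof (rule ccontr)
      assume "\<not> (\<exists>z\<in>far_tube \<Gamma> q. F z = w)"
      from omitted[OF this] obtain c where c: "c = 0 \<or> c \<in> spectrum f" "spectrum f - {0} \<subseteq> (+) c ` \<Gamma>"
        "fourier (\<lambda>x. f x - w) 0 \<noteq> 0 \<longrightarrow> - c \<in> \<Gamma>" by blast
      have "- c \<in> \<Gamma>" using c(3) w by (simp add: fourier_shift_const[OF apf])
      have l: "\<Lambda> - c \<in> \<Gamma>" using in_closure[OF _ ne(1) c(2)] \<Lambda>(1) by (simp add: in_shift)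
      then have "c \<noteq> 0" using ne by auto
      then have "c \<in> (+) \<Lambda> ` \<Gamma>" using c(1) \<Lambda>(2) by blast
      then have "- (\<Lambda> - c) \<in> \<Gamma>" by (simp add: in_shift)
      with l have "\<Lambda> - c = 0" by (rule pointedD)
      then show False using \<open>- c \<in> \<Gamma>\<close> ne by simp
    qed
  qed
  have part5: "\<exists>z\<in>far_tube \<Gamma> q. F z = w"
    if h: "\<forall>\<Lambda> \<in> closure (spectrum f). \<not> spectrum f - {0} \<subseteq> (+) \<Lambda> ` \<Gamma>" "\<not> spectrum f \<subseteq> \<Gamma>" for q w
  proof (rule ccontr)
    assume "\<not> (\<exists>z\<in>far_tube \<Gamma> q. F z = w)"
    from omitted[OF this] obtain c where c: "c = 0 \<or> c \<in> spectrum f" "spectrum f - {0} \<subseteq> (+) c ` \<Gamma>" by blast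
    then have "c = 0" using h(1) closure_subset by blast
    then have "spectrum f - {0} \<subseteq> \<Gamma>" using c(2) by (auto simp: in_shift)
    then show False using h(2) zero_in by blast
  qed
  show ?thesis
  proof (intro conjI impI allI)
    fix K assume "spectrum f - {0} \<subseteq> \<Gamma>" "inner_cone \<Gamma> K"
    then show "\<exists>l. uniform_limit UNIV (\<lambda>y x. F (cvec x y)) (\<lambda>x. l) (to_infinity_in K)" by (rule part1)
  next
    fix K M
    assume "\<exists>\<Lambda> \<in> (spectrum f \<inter> uminus ` \<Gamma>) - {0}. spectrum f - {0} \<subseteq> (+) \<Lambda> ` \<Gamma>" "inner_cone \<Gamma> K"
    then show "\<forall>\<^sub>F y in to_infinity_in K. \<forall>x. M < cmod (F (cvec x y))" by (elim bexE) (rule part2)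
  next
    fix q w
    assume "\<exists>\<Lambda> \<in> ((closure (spectrum f) - spectrum f) \<inter> uminus ` \<Gamma>) - {0}. spectrum f - {0} \<subseteq> (+) \<Lambda> ` \<Gamma>"
    then show "\<exists>z\<in>far_tube \<Gamma> q. F z = w" by (elim bexE) (rule part3)
  next
    fix q
    assume "\<exists>\<Lambda> \<in> closure (spectrum f) - (uminus ` \<Gamma> \<union> \<Gamma>). spectrum f - {0} \<subseteq> (+) \<Lambda> ` \<Gamma>"
    then show "\<exists>w\<^sub>0. \<forall>w. w \<noteq> w\<^sub>0 \<longrightarrow> (\<exists>z\<in>far_tube \<Gamma> q. F z = w)" by (elim bexE) (rule part4)
  next
    fix q w
    assume "(\<forall>\<Lambda> \<in> closure (spectrum f). \<not> spectrum f - {0} \<subseteq> (+) \<Lambda> ` \<Gamma>) \<and> \<not> spectrum f \<subseteq> \<Gamma>"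
    then show "\<exists>z\<in>far_tube \<Gamma> q. F z = w" by (elim conjE) (rule part5)
  qed
qed

end
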